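(* Let $Q$ be a finitely presented group. The following are equivalent: (A) for every short exact sequence of groups $1\to N\overset{\iota}{\to} G\overset{p}{\to} Q\to 1$ with $G$ finitely generated, the inclusion $P\hookrightarrow G\times G$ of the associated fibre product $P=\{(g,g')\in G\times G\mid p(g)=p(g')\}$ induces an isomorphism of profinite completions $\hat P\to\hat G\times\hat G$; (B) both of the following conditions hold: (1) $Q$ has no proper subgroups of finite index, and (2) $H_2(Q;\mathbb{Z})=0$.
   Context: The profinite completion $\hat\Gamma$ of a group $\Gamma$ is the inverse limit of the system of finite quotients of $\Gamma$. A homomorphism $u:\Gamma_1\to\Gamma_2$ induces a continuous homomorphism $\hat u:\hat\Gamma_1\to\hat\Gamma_2$. The profinite completion of $G\times G$ is identified with $\hat G\times\hat G$. $H_2(Q;\mathbb{Z})$ is the second homology of the group $Q$ with trivial integer coefficients. *)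

theory Defs
  imports "HOL-Analysis.Analysis" "HOL-Algebra.Free_Abelian_Groups"
begin

definition finitely_generated :: "('a, 'm) monoid_scheme \<Rightarrow> bool" where
  "finitely_generated G \<longleftrightarrow>
     group G \<and> (\<exists>S. finite S \<and> S \<subseteq> carrier G \<and> generate G S = carrier G)"


section \<open>Free groups and finite presentations\<close>

text \<open>
  A word over \<open>X\<close> is a list of letters \<open>(x, b)\<close>, where \<open>(x, True)\<close> stands for \<open>x\<close> and
  \<open>(x, False)\<close> for its formal inverse. The free group on \<open>X\<close> consists of the words over \<open>X\<close>
  up to insertion and deletion of pairs of adjacent mutually inverse letters.
\<close>

definition words :: "'x set \<Rightarrow> ('x \<times> bool) list set" where
  "words X = lists (X \<times> UNIV)"

inductive free_eq :: "'x set \<Rightarrow> ('x \<times> bool) list \<Rightarrow> ('x \<times> bool) list \<Rightarrow> bool" for X where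
  refl: "w \<in> words X \<Longrightarrow> free_eq X w w"
| sym: "free_eq X v w \<Longrightarrow> free_eq X w v"
| trans: "free_eq X u v \<Longrightarrow> free_eq X v w \<Longrightarrow> free_eq X u w"
| cancel: "u \<in> words X \<Longrightarrow> v \<in> words X \<Longrightarrow> x \<in> X \<Longrightarrow>
    free_eq X (u @ [(x, b), (x, \<not> b)] @ v) (u @ v)"

definition free_group :: "'x set \<Rightarrow> ('x \<times> bool) list set monoid" where
  "free_group X =
     \<lparr>carrier = words X // {(v, w). free_eq X v w},
      mult = (\<lambda>A B. {w. \<exists>u\<in>A. \<exists>v\<in>B. free_eq X (u @ v) w}),
      one = {w. free_eq X [] w}\<rparr>"

definition normal_closure :: "('a, 'm) monoid_scheme \<Rightarrow> 'a set \<Rightarrow> 'a set" where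
  "normal_closure G R = generate G {g \<otimes>\<^bsub>G\<^esub> r \<otimes>\<^bsub>G\<^esub> inv\<^bsub>G\<^esub> g | g r. g \<in> carrier G \<and> r \<in> R}"

definition finitely_presented :: "('a, 'm) monoid_scheme \<Rightarrow> bool" where
  "finitely_presented G \<longleftrightarrow>
     group G \<and>
     (\<exists>(X :: nat set) R. finite X \<and> finite R \<and> R \<subseteq> carrier (free_group X) \<and>
        G \<cong> free_group X Mod normal_closure (free_group X) R)"


section \<open>Short exact sequences and fibre products\<close>

text \<open>
  The library predicate \<open>exact_seq\<close> forces all groups to have elements of the same type.
\<close>

definition short_exact ::
  "('n, 'k) monoid_scheme \<Rightarrow> ('n \<Rightarrow> 'g) \<Rightarrow> ('g, 'l) monoid_scheme \<Rightarrow> ('g \<Rightarrow> 'q) \<Rightarrow>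
   ('q, 'm) monoid_scheme \<Rightarrow> bool" where
  "short_exact N i G p Q \<longleftrightarrow>
     group N \<and> group G \<and> group Q \<and>
     i \<in> hom N G \<and> p \<in> hom G Q \<and>
     inj_on i (carrier N) \<and>
     i ` carrier N = kernel G Q p \<and>
     p ` carrier G = carrier Q"

definition fibre_product :: "('g, 'm) monoid_scheme \<Rightarrow> ('g \<Rightarrow> 'q) \<Rightarrow> ('g \<times> 'g) monoid" where
  "fibre_product G p =
     (G \<times>\<times> G)\<lparr>carrier := {(g, g'). g \<in> carrier G \<and> g' \<in> carrier G \<and> p g = p g'}\<rparr>"


section \<open>Profinite completions\<close>

definition fin_index_normal :: "('a, 'm) monoid_scheme \<Rightarrow> 'a set set" where
  "fin_index_normal G = {N. N \<lhd> G \<and> finite (carrier (G Mod N))}"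

text \<open>
  The transition map \<open>G/N \<rightarrow> G/M\<close> for \<open>N \<subseteq> M\<close> sends a coset \<open>C\<close> of \<open>N\<close> to the coset
  \<open>C M\<close> of \<open>M\<close>.
\<close>

definition profinite_completion :: "('a, 'm) monoid_scheme \<Rightarrow> ('a set \<Rightarrow> 'a set) monoid" where
  "profinite_completion G =
     (product_group (fin_index_normal G) (\<lambda>N. G Mod N))
       \<lparr>carrier := {f \<in> (\<Pi>\<^sub>E N\<in>fin_index_normal G. carrier (G Mod N)).
          \<forall>N\<in>fin_index_normal G. \<forall>M\<in>fin_index_normal G. N \<subseteq> M \<longrightarrow> f N <#>\<^bsub>G\<^esub> M = f M}\<rparr>"

definition profinite_topology :: "('a, 'm) monoid_scheme \<Rightarrow> ('a set \<Rightarrow> 'a set) topology" where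
  "profinite_topology G =
     subtopology
       (product_topology (\<lambda>N. discrete_topology (carrier (G Mod N))) (fin_index_normal G))
       (carrier (profinite_completion G))"

text \<open>
  For a homomorphism \<open>u : G \<rightarrow> H\<close> and \<open>M\<close> of finite index in \<open>H\<close>, the component of
  \<open>profinite_map G H u f\<close> at \<open>M\<close> is the image of the component of \<open>f\<close> at the preimage
  \<open>L\<close> of \<open>M\<close> under the homomorphism \<open>G/L \<rightarrow> H/M\<close> induced by \<open>u\<close>.
\<close>

definition profinite_map ::
  "('a, 'm) monoid_scheme \<Rightarrow> ('b, 'n) monoid_scheme \<Rightarrow> ('a \<Rightarrow> 'b) \<Rightarrow>
   ('a set \<Rightarrow> 'a set) \<Rightarrow> ('b set \<Rightarrow> 'b set)" where
  "profinite_map G H u f =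
     (\<lambda>M\<in>fin_index_normal H. (u ` f {x \<in> carrier G. u x \<in> M}) <#>\<^bsub>H\<^esub> M)"

text \<open>
  The identification of the profinite completion of \<open>G \<times> H\<close> with the product of the profinite
  completions of \<open>G\<close> and \<open>H\<close>, given by the two projections.
\<close>

definition profinite_prod_map ::
  "('a, 'm) monoid_scheme \<Rightarrow> ('b, 'n) monoid_scheme \<Rightarrow>
   (('a \<times> 'b) set \<Rightarrow> ('a \<times> 'b) set) \<Rightarrow> ('a set \<Rightarrow> 'a set) \<times> ('b set \<Rightarrow> 'b set)" where
  "profinite_prod_map G H f =
     (profinite_map (G \<times>\<times> H) G fst f, profinite_map (G \<times>\<times> H) H snd f)"

definition topological_group_iso ::
  "('a, 'm) monoid_scheme \<Rightarrow> 'a topology \<Rightarrow> ('b, 'n) monoid_scheme \<Rightarrow> 'b topology \<Rightarrow>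
   ('a \<Rightarrow> 'b) \<Rightarrow> bool" where
  "topological_group_iso G S H T f \<longleftrightarrow> f \<in> iso G H \<and> homeomorphic_map S T f"

definition fibre_product_inclusion_profinite_iso ::
  "('g, 'm) monoid_scheme \<Rightarrow> ('g \<Rightarrow> 'q) \<Rightarrow> bool" where
  "fibre_product_inclusion_profinite_iso G p \<longleftrightarrow>
     topological_group_iso
       (profinite_completion (fibre_product G p)) (profinite_topology (fibre_product G p))
       (profinite_completion G \<times>\<times> profinite_completion G)
       (prod_topology (profinite_topology G) (profinite_topology G))
       (profinite_prod_map G G \<circ> profinite_map (fibre_product G p) (G \<times>\<times> G) (\<lambda>x. x))"


section \<open>Group homology with trivial integer coefficients\<close>

text \<open>
  The homology of the bar complex, i.e. of the coinvariants of the (unnormalised) bar resolution: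
  the \<open>n\<close>-chains are freely generated by the symbols \<open>[g\<^sub>1|\<dots>|g\<^sub>n]\<close>, and
  \<open>\<partial>[g\<^sub>1|\<dots>|g\<^sub>n] = [g\<^sub>2|\<dots>|g\<^sub>n]
     + (\<Sum>0<i<n. (-1)\<^sup>i [g\<^sub>1|\<dots>|g\<^sub>i g\<^sub>i\<^sub>+\<^sub>1|\<dots>|g\<^sub>n])
     + (-1)\<^sup>n [g\<^sub>1|\<dots>|g\<^sub>n\<^sub>-\<^sub>1]\<close>.
\<close>

definition bar_chains :: "('a, 'm) monoid_scheme \<Rightarrow> nat \<Rightarrow> ('a list \<Rightarrow>\<^sub>0 int) monoid" where
  "bar_chains G n = free_Abelian_group {gs \<in> lists (carrier G). length gs = n}"

definition bar_face :: "('a, 'm) monoid_scheme \<Rightarrow> nat \<Rightarrow> 'a list \<Rightarrow> 'a list" where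
  "bar_face G i gs =
     (if i = 0 then tl gs
      else if i = length gs then butlast gs
      else take (i - 1) gs @ [gs ! (i - 1) \<otimes>\<^bsub>G\<^esub> gs ! i] @ drop (i + 1) gs)"

definition bar_boundary ::
  "('a, 'm) monoid_scheme \<Rightarrow> nat \<Rightarrow> ('a list \<Rightarrow>\<^sub>0 int) \<Rightarrow> ('a list \<Rightarrow>\<^sub>0 int)" where
  "bar_boundary G n c =
     (if n = 0 then 0
      else frag_extend
        (\<lambda>gs. \<Sum>i\<le>n. frag_cmul ((-1) ^ i) (frag_of (bar_face G i gs))) c)"

definition group_homology :: "('a, 'm) monoid_scheme \<Rightarrow> nat \<Rightarrow> ('a list \<Rightarrow>\<^sub>0 int) set monoid" where
  "group_homology G n =
     (bar_chains G n)
       \<lparr>carrier := kernel (bar_chains G n) (bar_chains G (n - 1)) (bar_boundary G n)\<rparr>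
     Mod (bar_boundary G (n + 1) ` carrier (bar_chains G (n + 1)))"

section \<open>Groups on a fixed infinite type\<close>

text \<open>
  A statement about all finitely generated groups \<open>G\<close> cannot quantify over the type of the
  elements of \<open>G\<close>. Such groups and their subgroups are countable, so every one of them has an
  isomorphic copy on any given infinite type, and quantifying over the groups on one (arbitrary)
  infinite type loses no generality.
\<close>

lemma finitely_generated_countable:
  assumes "finitely_generated G" shows "countable (carrier G)"
proof -
  obtain S where "group G" and S: "finite S" "S \<subseteq> carrier G" "generate G S = carrier G"
    using assms by (auto simp: finitely_generated_def)
  interpret group G by fact
  define ev where "ev ws = foldr (\<lambda>(s, b) x. (if b then s else inv\<^bsub>G\<^esub> s) \<otimes>\<^bsub>G\<^esub> x) ws \<one>\<^bsub>G\<^esub>" for ws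
  have ev_closed: "ev ws \<in> carrier G" if "ws \<in> words S" for ws
    using that S(2) by (induction ws) (auto simp: ev_def words_def)
  have ev_append: "ev (vs @ ws) = ev vs \<otimes>\<^bsub>G\<^esub> ev ws" if "vs \<in> words S" "ws \<in> words S" for vs ws
    using that(1)
  proof (induction vs)
    case Nil
    then show ?case using ev_closed[OF that(2)] by (simp add: ev_def)
  next
    case (Cons a vs)
    then have vs: "vs \<in> words S" "fst a \<in> carrier G" using S(2) by (auto simp: words_def)
    have "ev vs \<in> carrier G" "ev ws \<in> carrier G" using ev_closed vs that by auto
    then show ?case using Cons.IH vs by (auto simp: ev_def m_assoc split: prod.splits)
  qed
  have "x \<in> ev ` words S" if "x \<in> generate G S" for x
    using that
  proof (induction rule: generate.induct)
    case one
    show ?case by (rule image_eqI[of _ _ "[]"]) (auto simp: ev_def words_def)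
  next
    case (incl h)
    then show ?case using S(2)
      by (intro image_eqI[of _ _ "[(h, True)]"]) (auto simp: ev_def words_def)
  next
    case (inv h)
    then show ?case using S(2)
      by (intro image_eqI[of _ _ "[(h, False)]"]) (auto simp: ev_def words_def)
  next
    case (eng h1 h2)
    then obtain v w where "v \<in> words S" "h1 = ev v" "w \<in> words S" "h2 = ev w" by auto
    then show ?case
      by (intro image_eqI[of _ _ "v @ w"]) (auto simp: ev_append words_def)
  qed
  then have "carrier G \<subseteq> ev ` words S" using S(3) by auto
  moreover have "countable (words S)"
    using S(1) by (auto simp: words_def intro: countable_finite)
  ultimately show ?thesis by (meson countable_image countable_subset)
qed

lemma group_iso_on_infinite_type:
  fixes G :: "('a, 'm) monoid_scheme"
  assumes "group G" "countable (carrier G)" "infinite (UNIV :: 'g set)"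
  obtains G' :: "'g monoid" and f where "group G'" "f \<in> iso G G'"
proof -
  interpret group G by fact
  obtain e :: "nat \<Rightarrow> 'g" where e: "inj e"
    using infinite_countable_subset[OF assms(3)] by auto
  define f where "f = e \<circ> to_nat_on (carrier G)"
  have inj: "inj_on f (carrier G)"
    unfolding f_def using assms(2) e by (metis comp_inj_on inj_on_subset inj_on_to_nat_on subset_UNIV)
  define g where "g = inv_into (carrier G) f"
  define G' :: "'g monoid" where
    "G' = \<lparr>carrier = f ` carrier G, mult = (\<lambda>x y. f (g x \<otimes>\<^bsub>G\<^esub> g y)), one = f \<one>\<^bsub>G\<^esub>\<rparr>"
  have gf: "g (f x) = x" if "x \<in> carrier G" for x
    using inj that by (simp add: g_def)
  have "f \<in> iso G G'"
    using inj by (auto simp: iso_def hom_def bij_betw_def G'_def gf)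
  moreover from this have "group G'"
    using gf by (intro groupI) (auto simp: G'_def m_assoc dest: l_inv_ex intro!: bexI[of _ "inv\<^bsub>G\<^esub> _"])
  ultimately show ?thesis using that by blast
qed

end

theory Submission
  imports Defs
begin

text \<open>
  The inclusion of the fibre product \<open>P\<close> induces an isomorphism of profinite completions iff \<open>P\<close> is
  dense in \<open>G \<times> G\<close> and every finite index normal subgroup of \<open>P\<close> contains \<open>P \<inter> (M \<times> M)\<close> for some finite
  index \<open>M \<lhd> G\<close>. Density is equivalent to \<open>Q\<close> having no proper subgroups of finite index, and then \<open>Q\<close>
  is perfect.

  If moreover \<open>H\<^sub>2(Q) = 0\<close>, then every 2-cocycle on \<open>Q\<close> is a coboundary. Given \<open>K \<lhd> P\<close> of finite index,
  put \<open>L = {n \<in> N. (1, n) \<in> K}\<close>; the centralizer of the finite group \<open>N/L\<close> in \<open>G/L\<close> is a central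
  extension of \<open>Q\<close>, a splitting of which yields a finite index subgroup of \<open>G\<close> meeting \<open>N\<close> inside \<open>L\<close>.

  Conversely, apply the hypothesis to a finitely generated subgroup \<open>G\<close>, mapping onto \<open>Q\<close>, of the central
  extension defined by the tautological cocycle with values in the 2-chains modulo boundaries. Its
  kernel is a finitely generated abelian group because \<open>Q\<close> is finitely presented, and residual finiteness
  forces \<open>[G, G] \<inter> N = 1\<close>. So \<open>[G, G]\<close> is a copy of \<open>Q\<close> splitting the extension, and \<open>H\<^sub>2(Q) = 0\<close>.
\<close>

text \<open>A finite index subgroup of the kernel need not be cut out by one of \<open>G\<close>;
  the splitting produces a complement that does this, and it has finite index because
  \<open>N/L\<close> is finite. The centralizer still maps onto \<open>Q\<close> because its image
  has finite index. Homology is reached through cocycles alone. Perfectness makes the boundary from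
  2-chains to 1-chains onto, so a homomorphism that kills the 2-cycles descends to 1-chains and no
  Ext term arises. Conversely, with coefficients in chains (not cycles) modulo boundaries,
  \<open>[a|b]\<close> is itself a cocycle; if it is a coboundary, the projection of 2-chains modulo
  boundaries factors through the boundary map and kills all cycles. The tautological extension need
  not be finitely generated, while (A) speaks of finitely generated \<open>G\<close> only. Lifting a
  presentation of \<open>Q\<close> picks out a finitely generated subgroup whose kernel is generated
  by the images of the relators, so that residual finiteness of finitely generated abelian groups
  applies. The same residual finiteness shows that the abelianization of \<open>Q\<close> is
  trivial.\<close>

section \<open>Subgroups of finite index\<close>

lemma (in group) rcos_eq_iff:
  assumes "subgroup H G" "x \<in> carrier G" "y \<in> carrier G"
  shows "H #> x = H #> y \<longleftrightarrow> x \<otimes> inv y \<in> H"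
proof -
  have "H #> x = H #> y \<longleftrightarrow> x \<in> H #> y"
    using repr_independence[OF _ assms(3,1)] rcos_self[OF assms(2,1)] by auto
  then show ?thesis using subgroup.rcos_module[OF assms(1) is_group assms(3,2)] by simp
qed

text \<open>A labelling with finite range that separates cosets bounds the index. Most finiteness
  proofs below consist in choosing \<open>k\<close>: pairs of cosets, induced maps on a finite set,
  or values in a finite kernel.\<close>

lemma (in group) finite_rcosetsI:
  assumes "subgroup H G" "finite (k ` carrier G)"
    and "\<And>x y. x \<in> carrier G \<Longrightarrow> y \<in> carrier G \<Longrightarrow> k x = k y \<Longrightarrow> x \<otimes> inv y \<in> H"
  shows "finite (rcosets H)"
proof -
  define g where "g v = H #> inv_into (carrier G) k v" for v
  have "H #> x = g (k x)" if x: "x \<in> carrier G" for x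
  proof -
    have kx: "k x \<in> k ` carrier G" using x by blast
    show ?thesis unfolding g_def
      using rcos_eq_iff[OF assms(1) x inv_into_into[OF kx]] assms(3)[OF x inv_into_into[OF kx]] f_inv_into_f[OF kx]
      by simp
  qed
  then have "rcosets H \<subseteq> g ` k ` carrier G" by (auto simp: RCOSETS_def)
  then show ?thesis by (rule finite_subset) (simp add: assms(2))
qed

lemma rcosets_eq_image: "rcosets\<^bsub>G\<^esub> H = (\<lambda>x. H #>\<^bsub>G\<^esub> x) ` carrier G"
  by (auto simp: RCOSETS_def)

lemma (in group) finite_rcosets_Int:
  assumes "subgroup H G" "subgroup K G" "finite (rcosets H)" "finite (rcosets K)"
  shows "finite (rcosets (H \<inter> K))"
proof (rule finite_rcosetsI[where k = "\<lambda>x. (H #> x, K #> x)"])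
  show "subgroup (H \<inter> K) G" by (rule subgroups_Inter_pair[OF assms(1,2)])
  have "(\<lambda>x. (H #> x, K #> x)) ` carrier G \<subseteq> (rcosets H) \<times> (rcosets K)" by (auto simp: rcosets_eq_image)
  then show "finite ((\<lambda>x. (H #> x, K #> x)) ` carrier G)"
    by (rule finite_subset) (simp add: assms(3,4))
  show "x \<otimes> inv y \<in> H \<inter> K"
    if "x \<in> carrier G" "y \<in> carrier G" "(H #> x, K #> x) = (H #> y, K #> y)" for x y
    using that rcos_eq_iff[OF assms(1)] rcos_eq_iff[OF assms(2)] by simp
qed

lemma (in group_hom) subgroup_vimage:
  assumes "subgroup K H" shows "subgroup {x \<in> carrier G. h x \<in> K} G"
  using assms by (auto intro!: G.subgroupI exI[of _ \<one>] simp: subgroup.m_inv_closed subgroup.m_closed subgroup.one_closed)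

lemma (in group_hom) finite_rcosets_vimage:
  assumes "subgroup K H" "finite (rcosets\<^bsub>H\<^esub> K)"
  shows "finite (rcosets {x \<in> carrier G. h x \<in> K})"
proof (rule G.finite_rcosetsI[where k = "\<lambda>x. K #>\<^bsub>H\<^esub> h x"])
  have "(\<lambda>x. K #>\<^bsub>H\<^esub> h x) ` carrier G \<subseteq> rcosets\<^bsub>H\<^esub> K" by (auto simp: rcosets_eq_image)
  then show "finite ((\<lambda>x. K #>\<^bsub>H\<^esub> h x) ` carrier G)" by (rule finite_subset) (rule assms(2))
  show "x \<otimes> inv y \<in> {x \<in> carrier G. h x \<in> K}"
    if "x \<in> carrier G" "y \<in> carrier G" "K #>\<^bsub>H\<^esub> h x = K #>\<^bsub>H\<^esub> h y" for x y
    using that H.rcos_eq_iff[OF assms(1), of "h x" "h y"] by simp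
qed (rule subgroup_vimage[OF assms(1)])

lemma (in group_hom) finite_rcosets_image:
  assumes "h ` carrier G = carrier H" "subgroup B G" "finite (rcosets B)"
  shows "subgroup (h ` B) H" "finite (rcosets\<^bsub>H\<^esub> (h ` B))"
proof -
  show "subgroup (h ` B) H" using assms(2) subgroup_img_is_subgroup by blast
  have "(h ` B) #>\<^bsub>H\<^esub> h x = h ` (B #> x)" if "x \<in> carrier G" for x
    using that subgroup.mem_carrier[OF assms(2)] by (force simp: r_coset_def)
  then have "rcosets\<^bsub>H\<^esub> (h ` B) = (`) h ` (rcosets B)"
    unfolding rcosets_eq_image assms(1)[symmetric] image_image by (auto intro!: image_cong)
  then show "finite (rcosets\<^bsub>H\<^esub> (h ` B))" using assms(3) by simp
qed

lemma fin_index_normal_iff: "N \<in> fin_index_normal G \<longleftrightarrow> N \<lhd> G \<and> finite (rcosets\<^bsub>G\<^esub> N)"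
  by (simp add: fin_index_normal_def FactGroup_def)

lemma fin_index_normal_subgroup: "N \<in> fin_index_normal G \<Longrightarrow> subgroup N G"
  by (simp add: fin_index_normal_iff normal_imp_subgroup)

lemma (in group) fin_index_normal_Int:
  assumes "M \<in> fin_index_normal G" "N \<in> fin_index_normal G"
  shows "M \<inter> N \<in> fin_index_normal G"
  using assms finite_rcosets_Int[of M N] normal_subgroup_intersect[of M N]
  by (auto simp: fin_index_normal_iff normal_imp_subgroup)

lemma (in group) carrier_fin_index_normal: "carrier G \<in> fin_index_normal G"
  unfolding fin_index_normal_iff
  by (auto intro: normal_self finite_rcosetsI[OF subgroup_self, where k = "\<lambda>x. ()"])

text \<open>The factor \<open>carrier G\<close> covers the empty family, whose intersection is the
  whole type. Such finite families come from basic open sets of the completion.\<close>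

lemma (in group) fin_index_normal_INT:
  assumes "finite J" "J \<subseteq> fin_index_normal G"
  shows "carrier G \<inter> \<Inter> J \<in> fin_index_normal G"
  using assms
proof (induction J)
  case (insert M J)
  then have "M \<inter> (carrier G \<inter> \<Inter> J) \<in> fin_index_normal G" by (simp add: fin_index_normal_Int)
  moreover have "carrier G \<inter> \<Inter> (insert M J) = M \<inter> (carrier G \<inter> \<Inter> J)" by auto
  ultimately show ?case by presburger
qed (simp add: carrier_fin_index_normal)

lemma (in group_hom) normal_vimage:
  assumes "N \<lhd> H" shows "{x \<in> carrier G. h x \<in> N} \<lhd> G"
  using assms subgroup_vimage[OF normal_imp_subgroup[OF assms]]
  by (auto simp: G.normal_inv_iff H.normal_inv_iff)

lemma (in group_hom) fin_index_normal_vimage: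
  assumes "N \<in> fin_index_normal H"
  shows "{x \<in> carrier G. h x \<in> N} \<in> fin_index_normal G"
  using assms normal_vimage finite_rcosets_vimage normal_imp_subgroup by (auto simp: fin_index_normal_iff)

text \<open>Only normal subgroups index the completion, so subgroups of finite index have to be
  shrunk to normal ones. The intersection \<open>N\<close> of all conjugates is the kernel of the
  right multiplication action on the cosets of \<open>H\<close>, so its index is bounded by the
  number of self-maps of a finite set.\<close>

lemma (in group) fin_index_normal_core:
  assumes "subgroup H G" "finite (rcosets H)"
  obtains N where "N \<in> fin_index_normal G" "N \<subseteq> H"
proof
  define N where "N = {x \<in> carrier G. \<forall>g\<in>carrier G. g \<otimes> x \<otimes> inv g \<in> H}"
  note sub = subgroup.m_closed[OF assms(1)] subgroup.m_inv_closed[OF assms(1)] subgroup.one_closed[OF assms(1)]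
  have mult: "g \<otimes> (x \<otimes> y) \<otimes> inv g = (g \<otimes> x \<otimes> inv g) \<otimes> (g \<otimes> y \<otimes> inv g)"
    if "g \<in> carrier G" "x \<in> carrier G" "y \<in> carrier G" for g x y
    using that by (simp add: m_assoc inv_solve_left)
  have sg: "subgroup N G"
  proof (rule subgroupI)
    show "N \<subseteq> carrier G" by (auto simp: N_def)
    have "\<one> \<in> N" by (simp add: N_def sub)
    then show "N \<noteq> {}" by blast
    show "inv a \<in> N" if "a \<in> N" for a
    proof -
      have "g \<otimes> inv a \<otimes> inv g = inv (g \<otimes> a \<otimes> inv g)" if "g \<in> carrier G" for g
        using that \<open>a \<in> N\<close> by (simp add: N_def inv_mult_group m_assoc)
      then show ?thesis using that by (simp add: N_def sub)
    qed
    show "a \<otimes> b \<in> N" if "a \<in> N" "b \<in> N" for a b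
      using that mult by (auto simp: N_def sub)
  qed
  moreover have "g \<otimes> x \<otimes> inv g \<in> N" if "g \<in> carrier G" "x \<in> N" for g x
  proof -
    have "k \<otimes> (g \<otimes> x \<otimes> inv g) \<otimes> inv k = (k \<otimes> g) \<otimes> x \<otimes> inv (k \<otimes> g)" if "k \<in> carrier G" for k
      using that \<open>g \<in> carrier G\<close> \<open>x \<in> N\<close> by (simp add: N_def inv_mult_group m_assoc)
    then show ?thesis using that by (auto simp: N_def)
  qed
  ultimately have "N \<lhd> G" by (simp add: normal_inv_iff)
  moreover have "finite (rcosets N)"
  proof (rule finite_rcosetsI[where k = "\<lambda>x. \<lambda>C\<in>rcosets H. C #> x", OF sg])
    have "(\<lambda>x. \<lambda>C\<in>rcosets H. C #> x) ` carrier G \<subseteq> rcosets H \<rightarrow>\<^sub>E rcosets H"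
      using subgroup.subset[OF assms(1)] by (auto simp: rcosets_eq_image coset_mult_assoc)
    then show "finite ((\<lambda>x. \<lambda>C\<in>rcosets H. C #> x) ` carrier G)"
      using assms(2) by (meson finite_PiE finite_subset)
    fix x y assume xy: "x \<in> carrier G" "y \<in> carrier G"
      and eq: "(\<lambda>C\<in>rcosets H. C #> x) = (\<lambda>C\<in>rcosets H. C #> y)"
    have "g \<otimes> (x \<otimes> inv y) \<otimes> inv g \<in> H" if g: "g \<in> carrier G" for g
    proof -
      have "H #> g \<in> rcosets H" using g by (auto simp: RCOSETS_def)
      then have "(H #> g) #> x = (H #> g) #> y" using fun_cong[OF eq, of "H #> g"] by simp
      then have "H #> (g \<otimes> x) = H #> (g \<otimes> y)"
        using g xy subgroup.subset[OF assms(1)] by (simp add: coset_mult_assoc)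
      then have "(g \<otimes> x) \<otimes> inv (g \<otimes> y) \<in> H" using rcos_eq_iff[OF assms(1)] g xy by simp
      then show ?thesis using g xy by (simp add: inv_mult_group m_assoc)
    qed
    then show "x \<otimes> inv y \<in> N" using xy by (simp add: N_def)
  qed
  ultimately show "N \<in> fin_index_normal G" by (simp add: fin_index_normal_iff)
  show "N \<subseteq> H"
  proof
    fix x assume "x \<in> N"
    then have "x \<in> carrier G" "\<one> \<otimes> x \<otimes> inv \<one> \<in> H" unfolding N_def by blast+
    then show "x \<in> H" by simp
  qed
qed

section \<open>Residual finiteness of finitely generated abelian groups\<close>

lemma (in comm_group) subgroup_adjoin:
  assumes B: "subgroup B G" and a: "a \<in> carrier G"
  shows "subgroup {b \<otimes> a [^] (k::int) | b k. b \<in> B} G" (is "subgroup ?A G")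
proof (rule subgroupI)
  note sub = subgroup.mem_carrier[OF B] subgroup.m_closed[OF B] subgroup.m_inv_closed[OF B] subgroup.one_closed[OF B]
  show "?A \<subseteq> carrier G" using a sub by auto
  show "?A \<noteq> {}" using sub by blast
  show "inv x \<in> ?A" if xA: "x \<in> ?A" for x
  proof -
    obtain b k where x: "b \<in> B" "x = b \<otimes> a [^] (k::int)" using xA by blast
    then have "inv x = inv b \<otimes> a [^] (- k)" using a sub(1) by (simp add: inv_mult int_pow_neg)
    then show ?thesis using x sub(3) by blast
  qed
  show "x \<otimes> y \<in> ?A" if xA: "x \<in> ?A" "y \<in> ?A" for x y
  proof -
    obtain b k c l where x: "b \<in> B" "x = b \<otimes> a [^] (k::int)" "c \<in> B" "y = c \<otimes> a [^] (l::int)" using xA by blast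
    then have "x \<otimes> y = (b \<otimes> c) \<otimes> a [^] (k + l)" using a sub(1) by (simp add: int_pow_mult m_ac)
    then show ?thesis using x sub(2) by blast
  qed
qed

text \<open>If a positive power of \<open>a\<close> lies in \<open>B\<close>, nothing new is
  adjoined. Otherwise the powers of \<open>a\<close> are independent modulo \<open>B\<close>: either
  \<open>z\<close> is outside the group generated by \<open>B\<close> and \<open>a\<close>, and
  \<open>a\<close> itself is adjoined, or \<open>z = b a^k\<close>, and a power of \<open>a\<close>
  with exponent larger than the absolute value of \<open>k\<close> is adjoined.\<close>

lemma (in comm_group) adjoin_power_avoiding:
  assumes B: "subgroup B G" and a: "a \<in> carrier G" and z: "z \<notin> B"
  obtains B' m where "subgroup B' G" "B \<subseteq> B'" "m > 0" "a [^] (m::nat) \<in> B'" "z \<notin> B'"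
proof -
  note sub = subgroup.mem_carrier[OF B] subgroup.m_closed[OF B] subgroup.m_inv_closed[OF B] subgroup.one_closed[OF B]
  have "\<exists>m>0. \<forall>b\<in>B. \<forall>k::int. z \<noteq> b \<otimes> (a [^] (m::nat)) [^] k"
  proof (cases "\<exists>m>0. a [^] (m::nat) \<in> B")
    case True
    then obtain m where m: "m > 0" "a [^] (m::nat) \<in> B" by blast
    have "b \<otimes> (a [^] m) [^] k \<in> B" if "b \<in> B" for b and k :: int
      using m that B sub(2) subgroup_int_pow_closed by blast
    then show ?thesis using m z by metis
  next
    case False
    show ?thesis
    proof (cases "\<exists>b\<in>B. \<exists>k::int. z = b \<otimes> a [^] k")
      case False
      have "a [^] (1::nat) = a" using a by simp
      then show ?thesis using False by (intro exI[of _ "1::nat"]) auto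
    next
      case True
      then obtain b k where bk: "b \<in> B" "z = b \<otimes> a [^] (k::int)" by blast
      \<comment> \<open>No nonzero power of \<open>a\<close> lies in \<open>B\<close>, so the
        exponent \<open>k\<close> of \<open>z\<close> modulo \<open>B\<close> is unique.\<close>
      have key: "j = 0" if "a [^] (j::int) \<in> B" for j
      proof (rule ccontr)
        assume "j \<noteq> 0"
        have "a [^] \<bar>j\<bar> \<in> B"
          using that int_pow_neg[OF a, of j] sub(3)[OF that] by (cases "j \<ge> 0") simp_all
        then have "a [^] nat \<bar>j\<bar> \<in> B" using int_pow_int[of G a "nat \<bar>j\<bar>"] by simp
        moreover have "nat \<bar>j\<bar> > 0" using \<open>j \<noteq> 0\<close> by simp
        ultimately show False using False by blast
      qed
      have k0: "k \<noteq> 0" using bk z a sub(1) by auto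
      \<comment> \<open>A nonzero \<open>k\<close> of absolute value below \<open>m\<close> is not a
        multiple of \<open>m\<close>, so \<open>z\<close> stays outside after adjoining
        \<open>a [^] m\<close>.\<close>
      define m where "m = Suc (nat \<bar>k\<bar>)"
      have "z \<noteq> c \<otimes> (a [^] m) [^] l" if c: "c \<in> B" for c and l :: int
      proof
        assume "z = c \<otimes> (a [^] m) [^] l"
        moreover have "(a [^] m) [^] l = a [^] (int m * l)"
          using int_pow_pow[OF a, of "int m" l] by (simp add: int_pow_int)
        ultimately have "b \<otimes> a [^] k = c \<otimes> a [^] (int m * l)" using bk by simp
        then have "inv b \<otimes> (b \<otimes> a [^] k) \<otimes> a [^] (- (int m * l)) = inv b \<otimes> (c \<otimes> a [^] (int m * l)) \<otimes> a [^] (- (int m * l))"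
          by simp
        moreover have "inv b \<otimes> (b \<otimes> a [^] k) \<otimes> a [^] (- (int m * l)) = a [^] (k - int m * l)"
          using a sub(1)[OF bk(1)] by (simp add: l_inv flip: m_assoc int_pow_mult)
        moreover have "inv b \<otimes> (c \<otimes> a [^] (int m * l)) \<otimes> a [^] (- (int m * l)) = inv b \<otimes> c"
          using a sub(1)[OF bk(1)] sub(1)[OF c] by (simp add: m_assoc flip: int_pow_mult)
        ultimately have "a [^] (k - int m * l) \<in> B" using sub(2,3) bk(1) c by simp
        then have "k = int m * l" using key by force
        then have "\<bar>k\<bar> = int m * \<bar>l\<bar>" by (simp add: abs_mult)
        moreover have "int m * \<bar>l\<bar> \<ge> int m" using k0 \<open>k = _\<close> by (cases "l = 0") auto
        ultimately show False by (simp add: m_def)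
      qed
      moreover have "m > 0" by (simp add: m_def)
      ultimately show ?thesis by (intro exI[of _ m]) simp
    qed
  qed
  then obtain m where m: "m > 0" "\<And>b k. b \<in> B \<Longrightarrow> z \<noteq> b \<otimes> (a [^] (m::nat)) [^] (k::int)" by blast
  show thesis
  proof (rule that[OF subgroup_adjoin[OF B] _ m(1)])
    show "a [^] m \<in> carrier G" using a by simp
    have "b = b \<otimes> (a [^] m) [^] (0::int)" if "b \<in> B" for b using that sub(1) by simp
    then show "B \<subseteq> {b \<otimes> (a [^] m) [^] (k::int) | b k. b \<in> B}" by blast
    have "a [^] m = \<one> \<otimes> (a [^] m) [^] (1::int)" using a by simp
    then show "a [^] m \<in> {b \<otimes> (a [^] m) [^] (k::int) | b k. b \<in> B}" using sub(4) by blast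
    show "z \<notin> {b \<otimes> (a [^] m) [^] (k::int) | b k. b \<in> B}" using m(2) by blast
  qed
qed

text \<open>Exponents of a generator can be reduced modulo its order relative to \<open>B\<close>,
  so finitely many products of bounded powers represent all cosets of \<open>B\<close> that the
  generated subgroup meets.\<close>

lemma (in comm_group) torsion_quotient_finite:
  assumes "finite S" "S \<subseteq> carrier G" "subgroup B G" "\<And>s. s \<in> S \<Longrightarrow> \<exists>m>0. s [^] (m::nat) \<in> B"
  shows "\<exists>F. finite F \<and> F \<subseteq> carrier G \<and> (\<forall>x\<in>generate G S. \<exists>b\<in>B. \<exists>f\<in>F. x = b \<otimes> f)"
  using assms
proof (induction S)
  case empty
  then show ?case using subgroup.one_closed[OF empty(2)] by (intro exI[of _ "{\<one>}"]) (auto simp: generate_empty intro!: bexI[of _ \<one>])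
next
  case (insert s S)
  then obtain F where F: "finite F" "F \<subseteq> carrier G" "\<And>x. x \<in> generate G S \<Longrightarrow> \<exists>b\<in>B. \<exists>f\<in>F. x = b \<otimes> f"
    by auto
  obtain m where m: "m > 0" "s [^] (m::nat) \<in> B" using insert.prems by blast
  have s: "s \<in> carrier G" and S: "S \<subseteq> carrier G" using insert.prems by auto
  note sub = subgroup.mem_carrier[OF \<open>subgroup B G\<close>]
  define F' where "F' = (\<lambda>(r, f). f \<otimes> s [^] r) ` ({0..<int m} \<times> F)"
  have "\<exists>b\<in>B. \<exists>f\<in>F'. x = b \<otimes> f" if xA: "x \<in> generate G (insert s S)" for x
  proof -
    let ?A = "{b \<otimes> s [^] (k::int) | b k. b \<in> generate G S}"
    have "subgroup ?A G" using S generate_is_subgroup s subgroup_adjoin by blast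
    moreover have "y \<in> ?A" if "y \<in> insert s S" for y
    proof (cases "y = s")
      case True
      have "s = \<one> \<otimes> s [^] (1::int)" using s by simp
      then show ?thesis using True generate.one by blast
    next
      case False
      then have "y \<in> S" using that by simp
      moreover have "y = y \<otimes> s [^] (0::int)" using s that insert.prems by auto
      ultimately show ?thesis using generate.incl[of y S G] by (intro CollectI exI[of _ y] exI[of _ 0]) simp
    qed
    ultimately have "generate G (insert s S) \<subseteq> ?A" by (meson generate_subgroup_incl subsetI)
    then obtain y k where y: "y \<in> generate G S" "x = y \<otimes> s [^] (k::int)" using xA by blast
    then obtain b f where bf: "b \<in> B" "f \<in> F" "y = b \<otimes> f" using F by blast
    have fc: "f \<in> carrier G" using bf F by blast
    have "s [^] k = s [^] (int m * (k div int m) + k mod int m)" by simp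
    also have "\<dots> = (s [^] m) [^] (k div int m) \<otimes> s [^] (k mod int m)"
      using int_pow_mult[OF s] int_pow_pow[OF s, of "int m" "k div int m"] by (simp only: int_pow_int)
    finally have "x = (b \<otimes> (s [^] m) [^] (k div int m)) \<otimes> (f \<otimes> s [^] (k mod int m))"
      using y bf s fc sub by (simp add: m_ac)
    moreover have "b \<otimes> (s [^] m) [^] (k div int m) \<in> B"
      using bf m insert.prems subgroup.m_closed subgroup_int_pow_closed by metis
    moreover have "f \<otimes> s [^] (k mod int m) \<in> F'"
      unfolding F'_def using bf m by (intro image_eqI[of _ _ "(k mod int m, f)"]) auto
    ultimately show ?thesis by blast
  qed
  moreover have "finite F'" "F' \<subseteq> carrier G" using F s by (auto simp: F'_def)
  ultimately show ?case by blast
qed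

text \<open>The classification of finitely generated abelian groups is bypassed: starting from the
  trivial subgroup, a power of each generator in turn is adjoined while \<open>z\<close> stays
  outside. The quotient by the result is generated by finitely many elements of finite order, hence
  finite.\<close>

lemma (in comm_group) residually_finite:
  assumes S: "finite S" "S \<subseteq> carrier G" "generate G S = carrier G" and z: "z \<noteq> \<one>"
  obtains T where "subgroup T G" "finite (rcosets T)" "z \<notin> T"
proof -
  have "\<exists>B. subgroup B G \<and> z \<notin> B \<and> (\<forall>s\<in>S. \<exists>m>0. s [^] (m::nat) \<in> B)"
    using S(1,2)
  proof (induction S)
    case empty
    then show ?case using triv_subgroup z by blast
  next
    case (insert s S)
    then obtain B where B: "subgroup B G" "z \<notin> B" "\<forall>s\<in>S. \<exists>m>0. s [^] (m::nat) \<in> B" by auto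
    then obtain B' m where "subgroup B' G" "B \<subseteq> B'" "m > 0" "s [^] (m::nat) \<in> B'" "z \<notin> B'"
      using adjoin_power_avoiding[of B s z] insert.prems by blast
    then show ?case using B by (intro exI[of _ B']) blast
  qed
  then obtain B where B: "subgroup B G" "z \<notin> B" "\<And>s. s\<in>S \<Longrightarrow> \<exists>m>0. s [^] (m::nat) \<in> B" by blast
  obtain F where F: "finite F" "F \<subseteq> carrier G" "\<And>x. x\<in>carrier G \<Longrightarrow> \<exists>b\<in>B. \<exists>f\<in>F. x = b \<otimes> f"
    using torsion_quotient_finite[OF S(1,2) B(1,3)] S(3) by auto
  have "B #> x \<in> (\<lambda>f. B #> f) ` F" if x: "x \<in> carrier G" for x
  proof -
    obtain b f where bf: "b \<in> B" "f \<in> F" "x = b \<otimes> f" using F x by blast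
    then have "x \<in> B #> f" by (auto simp: r_coset_def)
    then have "B #> f = B #> x" using repr_independence bf F B by blast
    then show ?thesis using bf by auto
  qed
  then have "finite (rcosets B)" using F(1) unfolding rcosets_eq_image
    by (meson finite_imageI finite_subset image_subsetI)
  then show thesis using that B by blast
qed

section \<open>Groups without proper subgroups of finite index\<close>

lemma finitely_generated_image:
  assumes "finitely_generated G" "group H" "h \<in> hom G H" "h ` carrier G = carrier H"
  shows "finitely_generated H"
proof -
  obtain S where S: "finite S" "S \<subseteq> carrier G" "generate G S = carrier G" and "group G"
    using assms by (auto simp: finitely_generated_def)
  interpret group_hom G H h using assms \<open>group G\<close> by (simp add: group_hom_def group_hom_axioms_def)
  have "generate H (h ` S) = carrier H" using generate_img[OF S(2)] S(3) assms(4) by simp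
  moreover have "finite (h ` S)" "h ` S \<subseteq> carrier H" using S by auto
  ultimately show ?thesis using assms(2) unfolding finitely_generated_def by blast
qed

lemma comm_group_trivial_if_no_finite_index:
  assumes fg: "finitely_generated A" and A: "comm_group A"
    and fin: "\<And>H. subgroup H A \<Longrightarrow> finite (rcosets\<^bsub>A\<^esub> H) \<Longrightarrow> H = carrier A"
  shows "carrier A = {\<one>\<^bsub>A\<^esub>}"
proof -
  interpret comm_group A by fact
  obtain S where "finite S" "S \<subseteq> carrier A" "generate A S = carrier A"
    using fg unfolding finitely_generated_def by blast
  then have "z = \<one>\<^bsub>A\<^esub>" if "z \<in> carrier A" for z
    using residually_finite[of S z] fin that by metis
  then show ?thesis by auto
qed

lemma (in comm_group) subgroup_imp_comm_group:
  assumes "subgroup H G" shows "comm_group (G\<lparr>carrier := H\<rparr>)"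
  using assms group.group_comm_groupI[OF subgroup_imp_group[OF assms]] subgroup.mem_carrier[OF assms] m_comm
  by simp

text \<open>The image of \<open>h\<close> is a finitely generated abelian group. Its finite index
  subgroups pull back to finite index subgroups of \<open>Q\<close>, so it has no proper ones, and
  residual finiteness makes it trivial.\<close>

lemma hom_to_comm_group_trivial:
  assumes fg: "finitely_generated Q" and A: "comm_group A" and h: "h \<in> hom Q A"
    and Q: "\<And>H. subgroup H Q \<Longrightarrow> finite (rcosets\<^bsub>Q\<^esub> H) \<Longrightarrow> H = carrier Q"
    and x: "x \<in> carrier Q"
  shows "h x = \<one>\<^bsub>A\<^esub>"
proof -
  let ?I = "A\<lparr>carrier := h ` carrier Q\<rparr>"
  have gQ: "group Q" using fg by (simp add: finitely_generated_def)
  have gA: "group A" using A by (simp add: comm_group_def)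
  have "group_hom Q A h" using gQ gA h by (simp add: group_hom_def group_hom_axioms_def)
  then have I: "comm_group ?I"
    using comm_group.subgroup_imp_comm_group[OF A group_hom.img_is_subgroup] by blast
  then have gI: "group ?I" by (simp add: comm_group_def)
  have hom: "h \<in> hom Q ?I" by (rule homI) (simp_all add: hom_mult[OF h])
  have hI: "group_hom Q ?I h" using gQ gI hom by (simp add: group_hom_def group_hom_axioms_def)
  have "H = carrier ?I" if H: "subgroup H ?I" "finite (rcosets\<^bsub>?I\<^esub> H)" for H
  proof -
    have "{x \<in> carrier Q. h x \<in> H} = carrier Q"
      using Q group_hom.subgroup_vimage[OF hI H(1)] group_hom.finite_rcosets_vimage[OF hI H] by blast
    then show ?thesis using subgroup.subset[OF H(1)] by auto
  qed
  moreover have "finitely_generated ?I" using finitely_generated_image[OF fg gI hom] by simp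
  ultimately have "carrier ?I = {\<one>\<^bsub>?I\<^esub>}"
    using comm_group_trivial_if_no_finite_index[OF _ I] by blast
  then show ?thesis using x by auto
qed

text \<open>The projection of \<open>Q\<close> to its abelianization is trivial by the previous
  lemma.\<close>

lemma perfect_if_no_finite_index:
  assumes fg: "finitely_generated Q"
    and Q: "\<And>H. subgroup H Q \<Longrightarrow> finite (rcosets\<^bsub>Q\<^esub> H) \<Longrightarrow> H = carrier Q"
  shows "derived Q (carrier Q) = carrier Q"
proof
  interpret group Q using fg by (simp add: finitely_generated_def)
  let ?D = "derived Q (carrier Q)"
  interpret D: normal ?D Q using derived_is_normal[OF normal_self] .
  show "?D \<subseteq> carrier Q" using derived_in_carrier by simp
  show "carrier Q \<subseteq> ?D"
  proof
    fix x assume x: "x \<in> carrier Q"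
    have "?D #>\<^bsub>Q\<^esub> x = \<one>\<^bsub>Q Mod ?D\<^esub>"
      by (rule hom_to_comm_group_trivial[OF fg derived_quot_is_comm_group D.r_coset_hom_Mod Q x])
    then show "x \<in> ?D" using rcos_self[OF x D.subgroup_axioms] by simp
  qed
qed

section \<open>Profinite completions\<close>

text \<open>Transition maps and induced maps of completions are encoded as the product of a set of
  representatives with a normal subgroup. Any nonempty part \<open>A\<close> of a coset yields the
  whole coset, so these encodings do not depend on the set supplied.\<close>

lemma (in normal) set_mult_subset_rcoset:
  assumes x: "x \<in> carrier G" and A: "A \<subseteq> H #> x" "A \<noteq> {}"
  shows "A <#> H = H #> x"
proof -
  have eq: "H #> x = x <# H" using coset_eq x by simp
  have HG: "H \<subseteq> carrier G" by (rule subset)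
  show ?thesis
  proof
    show "A <#> H \<subseteq> H #> x"
    proof
      fix y assume "y \<in> A <#> H"
      then obtain a h where ah: "a \<in> A" "h \<in> H" "y = a \<otimes> h" by (auto simp: set_mult_def)
      then have "a \<in> x <# H" using A(1) eq by blast
      then obtain h' where h': "h' \<in> H" "a = x \<otimes> h'" by (auto simp: l_coset_def)
      have "y = x \<otimes> (h' \<otimes> h)" using ah h' x HG by (simp add: m_assoc subsetD)
      then show "y \<in> H #> x" unfolding eq l_coset_def using ah h' by blast
    qed
    show "H #> x \<subseteq> A <#> H"
    proof
      fix y assume "y \<in> H #> x"
      then obtain h where h: "h \<in> H" "y = x \<otimes> h" unfolding eq by (auto simp: l_coset_def)
      obtain a where a: "a \<in> A" using A(2) by blast
      then have "a \<in> x <# H" using A(1) eq by blast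
      then obtain h' where h': "h' \<in> H" "a = x \<otimes> h'" by (auto simp: l_coset_def)
      have "y = a \<otimes> (inv h' \<otimes> h)"
        using h h' x HG by (simp add: subsetD m_assoc[of x h' "inv h' \<otimes> h"] flip: m_assoc[of h' "inv h'" h])
      moreover have "inv h' \<otimes> h \<in> H" using h h' by simp
      ultimately show "y \<in> A <#> H" using a unfolding set_mult_def by blast
    qed
  qed
qed

lemma carrier_Mod_iff: "C \<in> carrier (G Mod N) \<longleftrightarrow> (\<exists>x\<in>carrier G. C = N #>\<^bsub>G\<^esub> x)"
  by (auto simp: carrier_FactGroup)

section \<open>Elements of the completion as compatible families of cosets\<close>

context group begin

lemma profinite_completion_coset:
  assumes "f \<in> carrier (profinite_completion G)" "N \<in> fin_index_normal G"
  obtains x where "x \<in> carrier G" "f N = N #> x"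
proof -
  have "f N \<in> carrier (G Mod N)" using assms by (auto simp: profinite_completion_def)
  then show ?thesis using that by (auto simp: carrier_Mod_iff)
qed

lemma rcoset_set_mult_normal:
  assumes "N \<in> fin_index_normal G" "M \<in> fin_index_normal G" "N \<subseteq> M" "x \<in> carrier G"
  shows "(N #> x) <#> M = M #> x"
proof -
  interpret normal M G using assms(2) by (simp add: fin_index_normal_iff)
  show ?thesis
    using set_mult_subset_rcoset[OF assms(4), of "N #> x"] assms(3) rcos_self[OF assms(4) fin_index_normal_subgroup[OF assms(1)]]
    by (auto simp: r_coset_def)
qed

lemma profinite_completion_compatible:
  assumes "f \<in> carrier (profinite_completion G)" "N \<in> fin_index_normal G" "M \<in> fin_index_normal G"
    and "N \<subseteq> M" "x \<in> carrier G" "f N = N #> x"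
  shows "f M = M #> x"
proof -
  have "f N <#> M = f M" using assms(1-4) by (auto simp: profinite_completion_def)
  then show ?thesis using assms rcoset_set_mult_normal by simp
qed

text \<open>Compatibility along \<open>N \<subseteq> M\<close> means that one representative serves
  both components. In this form later checks pick an element at a fine level and read off the
  coarser cosets.\<close>

lemma profinite_completionI:
  assumes "f \<in> extensional (fin_index_normal G)"
    and "\<And>N M. N \<in> fin_index_normal G \<Longrightarrow> M \<in> fin_index_normal G \<Longrightarrow> N \<subseteq> M \<Longrightarrow>
      \<exists>x\<in>carrier G. f N = N #> x \<and> f M = M #> x"
  shows "f \<in> carrier (profinite_completion G)"
proof -
  have "f N \<in> carrier (G Mod N)" if "N \<in> fin_index_normal G" for N
    using assms(2)[OF that that] by (auto simp: carrier_Mod_iff)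
  moreover have "f N <#> M = f M" if NM: "N \<in> fin_index_normal G" "M \<in> fin_index_normal G" "N \<subseteq> M" for N M
  proof -
    obtain x where "x \<in> carrier G" "f N = N #> x" "f M = M #> x" using assms(2)[OF NM] by blast
    then show ?thesis using rcoset_set_mult_normal[OF NM] by simp
  qed
  ultimately show ?thesis using assms(1) by (auto simp: profinite_completion_def PiE_def)
qed

lemma profinite_completion_eqI:
  assumes "f \<in> carrier (profinite_completion G)" "f' \<in> carrier (profinite_completion G)"
    and "\<And>N. N \<in> fin_index_normal G \<Longrightarrow> f N = f' N"
  shows "f = f'"
  using assms by (intro extensionalityI[of f "fin_index_normal G"]) (auto simp: profinite_completion_def PiE_def)

lemma profinite_completion_mult:
  assumes "N \<in> fin_index_normal G" "f N = N #> x" "f' N = N #> y" "x \<in> carrier G" "y \<in> carrier G"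
  shows "(f \<otimes>\<^bsub>profinite_completion G\<^esub> f') N = N #> (x \<otimes> y)"
proof -
  interpret normal N G using assms(1) by (simp add: fin_index_normal_iff)
  show ?thesis using assms by (simp add: profinite_completion_def rcos_sum)
qed

lemma profinite_completion_mult_closed:
  assumes "f \<in> carrier (profinite_completion G)" "f' \<in> carrier (profinite_completion G)"
  shows "f \<otimes>\<^bsub>profinite_completion G\<^esub> f' \<in> carrier (profinite_completion G)"
proof (rule profinite_completionI)
  show "f \<otimes>\<^bsub>profinite_completion G\<^esub> f' \<in> extensional (fin_index_normal G)"
    by (simp add: profinite_completion_def)
  fix N M assume NM: "N \<in> fin_index_normal G" "M \<in> fin_index_normal G" "N \<subseteq> M"
  obtain x where x: "x \<in> carrier G" "f N = N #> x" using profinite_completion_coset[OF assms(1) NM(1)] .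
  obtain y where y: "y \<in> carrier G" "f' N = N #> y" using profinite_completion_coset[OF assms(2) NM(1)] .
  have "f M = M #> x" "f' M = M #> y"
    using profinite_completion_compatible[OF assms(1) NM x] profinite_completion_compatible[OF assms(2) NM y] by auto
  then show "\<exists>z\<in>carrier G. (f \<otimes>\<^bsub>profinite_completion G\<^esub> f') N = N #> z \<and> (f \<otimes>\<^bsub>profinite_completion G\<^esub> f') M = M #> z"
    using profinite_completion_mult NM x y by (intro bexI[of _ "x \<otimes> y"]) auto
qed

text \<open>The canonical map into the completion; it turns statements about open sets of the
  completion into statements about finite index subgroups of \<open>G\<close>.\<close>

definition to_profinite :: "'a \<Rightarrow> 'a set \<Rightarrow> 'a set" where
  "to_profinite x = (\<lambda>N\<in>fin_index_normal G. N #> x)"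

lemma to_profinite_closed: "x \<in> carrier G \<Longrightarrow> to_profinite x \<in> carrier (profinite_completion G)"
  by (rule profinite_completionI) (auto simp: to_profinite_def)

lemma topspace_profinite_topology: "topspace (profinite_topology G) = carrier (profinite_completion G)"
  by (auto simp: profinite_topology_def profinite_completion_def)

lemma continuous_map_profinite_component:
  assumes "N \<in> fin_index_normal G"
  shows "continuous_map (profinite_topology G) (discrete_topology (carrier (G Mod N))) (\<lambda>f. f N)"
  unfolding profinite_topology_def
  by (intro continuous_map_from_subtopology continuous_map_product_projection assms)

lemma continuous_map_into_profinite:
  assumes "\<And>x. x \<in> topspace X \<Longrightarrow> h x \<in> carrier (profinite_completion G)"
    and "\<And>N. N \<in> fin_index_normal G \<Longrightarrow>
      continuous_map X (discrete_topology (carrier (G Mod N))) (\<lambda>x. h x N)"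
  shows "continuous_map X (profinite_topology G) h"
  unfolding profinite_topology_def continuous_map_in_subtopology continuous_map_componentwise
  using assms by (auto simp: profinite_completion_def PiE_def)

text \<open>A basic open set of the product topology restricts only finitely many components; the
  intersection of the corresponding subgroups serves as \<open>M\<close>.\<close>

lemma profinite_nbhd_one:
  assumes "openin (profinite_topology G) V" "to_profinite \<one> \<in> V"
  obtains M where "M \<in> fin_index_normal G" "\<And>x. x \<in> M \<Longrightarrow> to_profinite x \<in> V"
proof -
  obtain V' where V': "openin (product_topology (\<lambda>N. discrete_topology (carrier (G Mod N))) (fin_index_normal G)) V'"
    "V = V' \<inter> carrier (profinite_completion G)"
    using assms(1) by (auto simp: profinite_topology_def openin_subtopology)
  have "to_profinite \<one> \<in> V'" using assms(2) V'(2) by blast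
  then obtain U where U: "finite {N \<in> fin_index_normal G. U N \<noteq> carrier (G Mod N)}"
      "to_profinite \<one> \<in> Pi\<^sub>E (fin_index_normal G) U" "Pi\<^sub>E (fin_index_normal G) U \<subseteq> V'"
    using V'(1) unfolding openin_product_topology_alt by auto
  let ?J = "{N \<in> fin_index_normal G. U N \<noteq> carrier (G Mod N)}"
  let ?M = "carrier G \<inter> \<Inter> ?J"
  have "to_profinite x \<in> V" if x: "x \<in> ?M" for x
  proof -
    have xc: "x \<in> carrier G" using x by blast
    have "to_profinite x N \<in> U N" if N: "N \<in> fin_index_normal G" for N
    proof (cases "N \<in> ?J")
      case True
      then have "x \<in> N" using x by blast
      then have "N #> x = N #> \<one>"
        using rcos_eq_iff[OF fin_index_normal_subgroup[OF N] xc one_closed] xc by simp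
      then show ?thesis using U(2) N by (auto simp: to_profinite_def PiE_def Pi_def)
    next
      case False
      then have "U N = carrier (G Mod N)" using N by blast
      then show ?thesis using xc N by (auto simp: to_profinite_def carrier_Mod_iff)
    qed
    then have "to_profinite x \<in> Pi\<^sub>E (fin_index_normal G) U" by (simp add: PiE_def Pi_def to_profinite_def)
    then show ?thesis using U(3) V'(2) to_profinite_closed[OF xc] by blast
  qed
  moreover have "?M \<in> fin_index_normal G" using fin_index_normal_INT[OF U(1)] by blast
  ultimately show thesis using that by blast
qed

end

section \<open>Functoriality and continuity of the induced maps\<close>

context group_hom begin

text \<open>The definition evaluates \<open>f\<close> at the full preimage of \<open>M\<close>, but
  any finer \<open>K\<close> gives the same coset. Hence one representative at a common refinement
  computes several components, or several induced maps, at once.\<close>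

lemma profinite_map_coset:
  assumes f: "f \<in> carrier (profinite_completion G)" and M: "M \<in> fin_index_normal H"
    and K: "K \<in> fin_index_normal G" "\<And>y. y \<in> K \<Longrightarrow> h y \<in> M"
    and x: "x \<in> carrier G" "f K = K #> x"
  shows "profinite_map G H h f M = M #>\<^bsub>H\<^esub> h x"
proof -
  let ?L = "{x \<in> carrier G. h x \<in> M}"
  have L: "?L \<in> fin_index_normal G" using fin_index_normal_vimage[OF M] .
  have "K \<subseteq> ?L" using K subgroup.subset[OF fin_index_normal_subgroup[OF K(1)]] by blast
  then have fL: "f ?L = ?L #> x" using G.profinite_completion_compatible[OF f K(1) L _ x] by simp
  interpret M: normal M H using M by (simp add: fin_index_normal_iff)
  have "(h ` (?L #> x)) <#>\<^bsub>H\<^esub> M = M #>\<^bsub>H\<^esub> h x"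
  proof (rule M.set_mult_subset_rcoset)
    show "h x \<in> carrier H" using x by simp
    show "h ` (?L #> x) \<subseteq> M #>\<^bsub>H\<^esub> h x" using x by (auto simp: r_coset_def)
    show "h ` (?L #> x) \<noteq> {}" using G.rcos_self[OF x(1) fin_index_normal_subgroup[OF L]] by blast
  qed
  then show ?thesis using M by (simp add: profinite_map_def fL)
qed

lemma profinite_map_closed:
  assumes f: "f \<in> carrier (profinite_completion G)"
  shows "profinite_map G H h f \<in> carrier (profinite_completion H)"
proof (rule H.profinite_completionI)
  show "profinite_map G H h f \<in> extensional (fin_index_normal H)" by (simp add: profinite_map_def)
  fix N M assume NM: "N \<in> fin_index_normal H" "M \<in> fin_index_normal H" "N \<subseteq> M"
  let ?L = "{x \<in> carrier G. h x \<in> N}"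
  have L: "?L \<in> fin_index_normal G" using fin_index_normal_vimage[OF NM(1)] .
  obtain x where x: "x \<in> carrier G" "f ?L = ?L #> x" using G.profinite_completion_coset[OF f L] .
  show "\<exists>y\<in>carrier H. profinite_map G H h f N = N #>\<^bsub>H\<^esub> y \<and> profinite_map G H h f M = M #>\<^bsub>H\<^esub> y"
    using profinite_map_coset[OF f NM(1) L _ x] profinite_map_coset[OF f NM(2) L _ x] NM(3) x(1)
    by (intro bexI[of _ "h x"]) auto
qed

lemma profinite_map_to_profinite:
  assumes "x \<in> carrier G"
  shows "profinite_map G H h (G.to_profinite x) = H.to_profinite (h x)"
proof (rule H.profinite_completion_eqI)
  show "profinite_map G H h (G.to_profinite x) \<in> carrier (profinite_completion H)"
    using profinite_map_closed G.to_profinite_closed assms by simp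
  show "H.to_profinite (h x) \<in> carrier (profinite_completion H)" using H.to_profinite_closed assms by simp
  fix M assume M: "M \<in> fin_index_normal H"
  have L: "{x \<in> carrier G. h x \<in> M} \<in> fin_index_normal G" using fin_index_normal_vimage[OF M] .
  have "profinite_map G H h (G.to_profinite x) M = M #>\<^bsub>H\<^esub> h x"
    by (rule profinite_map_coset[OF G.to_profinite_closed[OF assms] M L _ assms])
      (use L in \<open>simp_all add: G.to_profinite_def\<close>)
  then show "profinite_map G H h (G.to_profinite x) M = H.to_profinite (h x) M"
    using M by (simp add: H.to_profinite_def)
qed

lemma profinite_map_hom:
  "profinite_map G H h \<in> hom (profinite_completion G) (profinite_completion H)"
proof (rule homI)
  fix f f' assume f: "f \<in> carrier (profinite_completion G)" "f' \<in> carrier (profinite_completion G)"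
  let ?m = "f \<otimes>\<^bsub>profinite_completion G\<^esub> f'"
  let ?p = "profinite_map G H h"
  have m: "?m \<in> carrier (profinite_completion G)" using G.profinite_completion_mult_closed f by simp
  show "?p ?m = ?p f \<otimes>\<^bsub>profinite_completion H\<^esub> ?p f'"
  proof (rule H.profinite_completion_eqI)
    show "?p ?m \<in> carrier (profinite_completion H)" using m by (rule profinite_map_closed)
    show "?p f \<otimes>\<^bsub>profinite_completion H\<^esub> ?p f' \<in> carrier (profinite_completion H)"
      using f by (intro H.profinite_completion_mult_closed profinite_map_closed)
    fix M assume M: "M \<in> fin_index_normal H"
    let ?L = "{x \<in> carrier G. h x \<in> M}"
    have L: "?L \<in> fin_index_normal G" using fin_index_normal_vimage[OF M] .
    obtain x where x: "x \<in> carrier G" "f ?L = ?L #> x" using G.profinite_completion_coset[OF f(1) L] .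
    obtain y where y: "y \<in> carrier G" "f' ?L = ?L #> y" using G.profinite_completion_coset[OF f(2) L] .
    have "?p f M = M #>\<^bsub>H\<^esub> h x" by (rule profinite_map_coset[OF f(1) M L _ x]) simp
    moreover have "?p f' M = M #>\<^bsub>H\<^esub> h y" by (rule profinite_map_coset[OF f(2) M L _ y]) simp
    moreover have "?p ?m M = M #>\<^bsub>H\<^esub> h (x \<otimes> y)"
      by (rule profinite_map_coset[OF m M L])
        (use x y G.profinite_completion_mult[OF L, of f x f' y] in simp_all)
    ultimately show "?p ?m M = (?p f \<otimes>\<^bsub>profinite_completion H\<^esub> ?p f') M"
      using H.profinite_completion_mult[OF M, of "?p f" "h x" "?p f'" "h y"] x y by simp
  qed
qed (rule profinite_map_closed)

text \<open>The component of the image at \<open>M\<close> depends only on the component at the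
  preimage of \<open>M\<close>, through a map between discrete spaces.\<close>

lemma continuous_map_profinite_map:
  "continuous_map (profinite_topology G) (profinite_topology H) (profinite_map G H h)"
proof (rule H.continuous_map_into_profinite)
  show "profinite_map G H h f \<in> carrier (profinite_completion H)" if "f \<in> topspace (profinite_topology G)" for f
    using that profinite_map_closed by (simp add: G.topspace_profinite_topology)
  fix M assume M: "M \<in> fin_index_normal H"
  let ?L = "{x \<in> carrier G. h x \<in> M}"
  have L: "?L \<in> fin_index_normal G" using fin_index_normal_vimage[OF M] .
  interpret M: normal M H using M by (simp add: fin_index_normal_iff)
  have "(h ` C) <#>\<^bsub>H\<^esub> M \<in> carrier (H Mod M)" if C: "C \<in> carrier (G Mod ?L)" for C
  proof -
    obtain x where x: "x \<in> carrier G" "C = ?L #> x" using C by (auto simp: carrier_Mod_iff)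
    have "(h ` C) <#>\<^bsub>H\<^esub> M = M #>\<^bsub>H\<^esub> h x"
    proof (rule M.set_mult_subset_rcoset)
      show "h x \<in> carrier H" using x by simp
      show "h ` C \<subseteq> M #>\<^bsub>H\<^esub> h x" using x by (auto simp: r_coset_def)
      show "h ` C \<noteq> {}" using G.rcos_self[OF x(1) fin_index_normal_subgroup[OF L]] x(2) by blast
    qed
    then show ?thesis using x(1) by (auto simp: carrier_Mod_iff)
  qed
  then have "continuous_map (discrete_topology (carrier (G Mod ?L))) (discrete_topology (carrier (H Mod M)))
      (\<lambda>C. (h ` C) <#>\<^bsub>H\<^esub> M)" by simp
  from continuous_map_compose[OF G.continuous_map_profinite_component[OF L] this]
  show "continuous_map (profinite_topology G) (discrete_topology (carrier (H Mod M)))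
      (\<lambda>f. profinite_map G H h f M)"
    using M by (simp add: profinite_map_def o_def)
qed

end

lemma profinite_map_compose:
  assumes u: "group_hom G H u" and v: "group_hom H K v" and f: "f \<in> carrier (profinite_completion G)"
  shows "profinite_map H K v (profinite_map G H u f) = profinite_map G K (v \<circ> u) f"
proof -
  interpret u: group_hom G H u by fact
  interpret v: group_hom H K v by fact
  interpret vu: group_hom G K "v \<circ> u"
    using u v hom_compose[OF u.homh v.homh] by (simp add: group_hom_def group_hom_axioms_def)
  have uf: "profinite_map G H u f \<in> carrier (profinite_completion H)" using u.profinite_map_closed[OF f] .
  show ?thesis
  proof (rule v.H.profinite_completion_eqI)
    show "profinite_map H K v (profinite_map G H u f) \<in> carrier (profinite_completion K)"
      using uf by (rule v.profinite_map_closed)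
    show "profinite_map G K (v \<circ> u) f \<in> carrier (profinite_completion K)" using f by (rule vu.profinite_map_closed)
    fix M assume M: "M \<in> fin_index_normal K"
    let ?L = "{x \<in> carrier H. v x \<in> M}"
    let ?L' = "{x \<in> carrier G. u x \<in> ?L}"
    have L: "?L \<in> fin_index_normal H" using v.fin_index_normal_vimage[OF M] .
    have L': "?L' \<in> fin_index_normal G" using u.fin_index_normal_vimage[OF L] .
    obtain x where x: "x \<in> carrier G" "f ?L' = ?L' #>\<^bsub>G\<^esub> x" using u.G.profinite_completion_coset[OF f L'] .
    have "profinite_map G H u f ?L = ?L #>\<^bsub>H\<^esub> u x" by (rule u.profinite_map_coset[OF f L L' _ x]) simp
    then have "profinite_map H K v (profinite_map G H u f) M = M #>\<^bsub>K\<^esub> v (u x)"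
      using v.profinite_map_coset[OF uf M L _ u.hom_closed[OF x(1)]] by simp
    moreover have "profinite_map G K (v \<circ> u) f M = M #>\<^bsub>K\<^esub> (v \<circ> u) x"
      by (rule vu.profinite_map_coset[OF f M L' _ x]) simp
    ultimately show "profinite_map H K v (profinite_map G H u f) M = profinite_map G K (v \<circ> u) f M" by simp
  qed
qed

section \<open>When a pair of homomorphisms identifies the completion of \<open>D\<close> with a
  product\<close>

locale two_homs = u: group_hom D G u + v: group_hom D G v
  for D :: "('d, 'k) monoid_scheme" and G :: "('g, 'm) monoid_scheme" and u v
begin

text \<open>Density of the image of \<open>(u, v)\<close> in the product of two copies of the
  completion of \<open>G\<close>. Using the same \<open>M\<close> in both coordinates suffices
  because finite index normal subgroups are closed under intersection.\<close>

definition dense_image :: bool where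
  "dense_image \<longleftrightarrow> (\<forall>M\<in>fin_index_normal G. \<forall>g\<in>carrier G. \<forall>g'\<in>carrier G.
     \<exists>x\<in>carrier D. M #>\<^bsub>G\<^esub> u x = M #>\<^bsub>G\<^esub> g \<and> M #>\<^bsub>G\<^esub> v x = M #>\<^bsub>G\<^esub> g')"

text \<open>Every finite index normal \<open>K\<close> is open for the topology that
  \<open>D\<close> inherits along \<open>(u, v)\<close>; in other words, the inherited topology is
  the full profinite topology.\<close>

definition induced_topology_full :: bool where
  "induced_topology_full \<longleftrightarrow> (\<forall>K\<in>fin_index_normal D. \<exists>M\<in>fin_index_normal G.
     \<forall>x\<in>carrier D. u x \<in> M \<and> v x \<in> M \<longrightarrow> x \<in> K)"

definition profinite_pair :: "('d set \<Rightarrow> 'd set) \<Rightarrow> ('g set \<Rightarrow> 'g set) \<times> ('g set \<Rightarrow> 'g set)" where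
  "profinite_pair f = (profinite_map D G u f, profinite_map D G v f)"

abbreviation pair_iso :: bool where
  "pair_iso \<equiv> topological_group_iso (profinite_completion D) (profinite_topology D)
     (profinite_completion G \<times>\<times> profinite_completion G)
     (prod_topology (profinite_topology G) (profinite_topology G)) profinite_pair"

text \<open>Surjectivity gives a preimage \<open>f\<close> of the canonical images of
  \<open>g\<close> and \<open>g'\<close>. Its component at the intersection of the two preimages of
  \<open>M\<close> supplies \<open>x\<close>.\<close>

lemma dense_image_if_pair_iso:
  assumes "pair_iso" shows dense_image
  unfolding dense_image_def
proof (intro ballI)
  fix M g g' assume M: "M \<in> fin_index_normal G" and g: "g \<in> carrier G" "g' \<in> carrier G"
  have "bij_betw profinite_pair (carrier (profinite_completion D))
      (carrier (profinite_completion G) \<times> carrier (profinite_completion G))"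
    using assms by (simp add: topological_group_iso_def iso_def)
  moreover have "(u.H.to_profinite g, u.H.to_profinite g')
      \<in> carrier (profinite_completion G) \<times> carrier (profinite_completion G)"
    using g u.H.to_profinite_closed by blast
  ultimately have "(u.H.to_profinite g, u.H.to_profinite g') \<in> profinite_pair ` carrier (profinite_completion D)"
    by (simp add: bij_betw_def)
  then obtain f where f: "f \<in> carrier (profinite_completion D)"
    "(u.H.to_profinite g, u.H.to_profinite g') = profinite_pair f" by (rule imageE)
  let ?K = "{x \<in> carrier D. u x \<in> M} \<inter> {x \<in> carrier D. v x \<in> M}"
  have K: "?K \<in> fin_index_normal D"
    using u.G.fin_index_normal_Int[OF u.fin_index_normal_vimage[OF M] v.fin_index_normal_vimage[OF M]] .
  obtain x where x: "x \<in> carrier D" "f ?K = ?K #>\<^bsub>D\<^esub> x" using u.G.profinite_completion_coset[OF f(1) K] .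
  have "profinite_map D G u f M = M #>\<^bsub>G\<^esub> u x" by (rule u.profinite_map_coset[OF f(1) M K _ x]) simp
  moreover have "profinite_map D G v f M = M #>\<^bsub>G\<^esub> v x" by (rule v.profinite_map_coset[OF f(1) M K _ x]) simp
  moreover have "profinite_map D G u f = u.H.to_profinite g" "profinite_map D G v f = u.H.to_profinite g'"
    using f(2) by (simp_all add: profinite_pair_def)
  ultimately have "M #>\<^bsub>G\<^esub> u x = M #>\<^bsub>G\<^esub> g \<and> M #>\<^bsub>G\<^esub> v x = M #>\<^bsub>G\<^esub> g'"
    using M by (simp add: u.H.to_profinite_def)
  then show "\<exists>x\<in>carrier D. M #>\<^bsub>G\<^esub> u x = M #>\<^bsub>G\<^esub> g \<and> M #>\<^bsub>G\<^esub> v x = M #>\<^bsub>G\<^esub> g'" using x(1) by blast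
qed

text \<open>The elements of the completion that are trivial at \<open>K\<close> form an open set,
  whose image is open and contains a box around the identity; the sides of the box contain the
  images of some \<open>M\<close> and \<open>M'\<close>. Injectivity brings an element of
  \<open>D\<close> whose image lies in the box back into that open set.\<close>

lemma induced_topology_full_if_pair_iso:
  assumes "pair_iso" shows induced_topology_full
  unfolding induced_topology_full_def
proof (intro ballI)
  fix K assume K: "K \<in> fin_index_normal D"
  let ?DC = "carrier (profinite_completion D)"
  have inj: "inj_on profinite_pair ?DC"
    using assms by (simp add: topological_group_iso_def iso_def bij_betw_def)
  have hm: "homeomorphic_map (profinite_topology D)
      (prod_topology (profinite_topology G) (profinite_topology G)) profinite_pair"
    using assms by (simp add: topological_group_iso_def)
  let ?U = "{f \<in> topspace (profinite_topology D). f K \<in> {K}}"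
  have "K \<in> carrier (D Mod K)"
    using u.G.coset_mult_one[OF subgroup.subset[OF fin_index_normal_subgroup[OF K]]]
    by (auto simp: carrier_Mod_iff)
  then have "openin (profinite_topology D) ?U"
    by (intro openin_continuous_map_preimage[OF u.G.continuous_map_profinite_component[OF K]]) simp
  then have op: "openin (prod_topology (profinite_topology G) (profinite_topology G)) (profinite_pair ` ?U)"
    using homeomorphic_map_openness_eq[OF hm, of ?U] by blast
  have can: "profinite_pair (u.G.to_profinite x) = (u.H.to_profinite (u x), u.H.to_profinite (v x))"
    if "x \<in> carrier D" for x
    using that u.profinite_map_to_profinite v.profinite_map_to_profinite by (simp add: profinite_pair_def)
  have U_iff: "u.G.to_profinite x \<in> ?U \<longleftrightarrow> x \<in> K" if x: "x \<in> carrier D" for x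
  proof -
    have "K #>\<^bsub>D\<^esub> x = K \<longleftrightarrow> x \<in> K"
      using u.G.coset_join2[OF x fin_index_normal_subgroup[OF K]]
        u.G.coset_join1[OF _ x fin_index_normal_subgroup[OF K]]
        subgroup.subset[OF fin_index_normal_subgroup[OF K]] by blast
    then show ?thesis
      using x K u.G.to_profinite_closed[OF x] by (simp add: u.G.to_profinite_def u.G.topspace_profinite_topology)
  qed
  have one: "(u.H.to_profinite \<one>\<^bsub>G\<^esub>, u.H.to_profinite \<one>\<^bsub>G\<^esub>) \<in> profinite_pair ` ?U"
  proof (rule image_eqI)
    show "u.G.to_profinite \<one>\<^bsub>D\<^esub> \<in> ?U"
      using U_iff[OF u.G.one_closed] subgroup.one_closed[OF fin_index_normal_subgroup[OF K]] by blast
  qed (simp add: can)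
  obtain V W where VW: "openin (profinite_topology G) V" "openin (profinite_topology G) W"
      "u.H.to_profinite \<one>\<^bsub>G\<^esub> \<in> V" "u.H.to_profinite \<one>\<^bsub>G\<^esub> \<in> W" "V \<times> W \<subseteq> profinite_pair ` ?U"
    using op[unfolded openin_prod_topology_alt, rule_format, OF one] by (elim exE conjE) (rule that)
  obtain M where M: "M \<in> fin_index_normal G" "\<And>x. x \<in> M \<Longrightarrow> u.H.to_profinite x \<in> V"
    using u.H.profinite_nbhd_one[OF VW(1,3)] by blast
  obtain M' where M': "M' \<in> fin_index_normal G" "\<And>x. x \<in> M' \<Longrightarrow> u.H.to_profinite x \<in> W"
    using u.H.profinite_nbhd_one[OF VW(2,4)] by blast
  have "x \<in> K" if x: "x \<in> carrier D" "u x \<in> M \<inter> M'" "v x \<in> M \<inter> M'" for x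
  proof -
    have "profinite_pair (u.G.to_profinite x) \<in> profinite_pair ` ?U"
      unfolding can[OF x(1)] using M(2)[of "u x"] M'(2)[of "v x"] x(2,3) by (intro subsetD[OF VW(5)]) simp
    then obtain f where f: "profinite_pair (u.G.to_profinite x) = profinite_pair f" "f \<in> ?U" by (rule imageE)
    then have "f \<in> ?DC" by (simp add: u.G.topspace_profinite_topology)
    then have "u.G.to_profinite x = f"
      using inj_onD[OF inj f(1) u.G.to_profinite_closed[OF x(1)]] by simp
    then show "x \<in> K" using U_iff[OF x(1)] f(2) by simp
  qed
  then show "\<exists>M\<in>fin_index_normal G. \<forall>x\<in>carrier D. u x \<in> M \<and> v x \<in> M \<longrightarrow> x \<in> K"
    using u.H.fin_index_normal_Int[OF M(1) M'(1)] by blast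
qed

text \<open>A continuous inverse is written down explicitly. By fullness the coset of
  \<open>x\<close> modulo \<open>K\<close> is determined by the cosets of \<open>u x\<close> and
  \<open>v x\<close> modulo \<open>m K\<close>, and by density every pair of cosets arises in this
  way. So the component of the inverse at \<open>K\<close> is read off at the single level
  \<open>m K\<close>, which also gives continuity.\<close>

lemma pair_isoI:
  assumes dense: dense_image and full: induced_topology_full
  shows pair_iso
proof -
  let ?DC = "carrier (profinite_completion D)"
  let ?GC = "carrier (profinite_completion G)"
  have "\<forall>K\<in>fin_index_normal D. \<exists>M. M \<in> fin_index_normal G \<and> (\<forall>x\<in>carrier D. u x \<in> M \<and> v x \<in> M \<longrightarrow> x \<in> K)"
    using full unfolding induced_topology_full_def by blast
  then obtain m where m: "\<And>K. K \<in> fin_index_normal D \<Longrightarrow> m K \<in> fin_index_normal G"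
    "\<And>K x. \<lbrakk>K \<in> fin_index_normal D; x \<in> carrier D; u x \<in> m K; v x \<in> m K\<rbrakk> \<Longrightarrow> x \<in> K"
    using bchoice[of "fin_index_normal D"] by metis
  \<comment> \<open>For cosets \<open>A\<close> and \<open>B\<close> of \<open>m K\<close>, the
    elements of \<open>D\<close> lying over both sit in one coset of \<open>K\<close>; multiplying
    by \<open>K\<close> fills that coset.\<close>
  define F where "F = (\<lambda>K (A, B). {x \<in> carrier D. u x \<in> A \<and> v x \<in> B} <#>\<^bsub>D\<^esub> K)"
  define \<Psi> where "\<Psi> = (\<lambda>(a, b). \<lambda>K\<in>fin_index_normal D. F K (a (m K), b (m K)))"
  have F_coset: "F K (m K #>\<^bsub>G\<^esub> u x, m K #>\<^bsub>G\<^esub> v x) = K #>\<^bsub>D\<^esub> x"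
    if K: "K \<in> fin_index_normal D" and x: "x \<in> carrier D" for K x
  proof -
    interpret K: normal K D using K by (simp add: fin_index_normal_iff)
    have sg: "subgroup (m K) G" using m(1)[OF K] by (rule fin_index_normal_subgroup)
    let ?A = "{y \<in> carrier D. u y \<in> m K #>\<^bsub>G\<^esub> u x \<and> v y \<in> m K #>\<^bsub>G\<^esub> v x}"
    have "?A \<subseteq> K #>\<^bsub>D\<^esub> x"
    proof
      fix y assume y: "y \<in> ?A"
      then have "u y \<otimes>\<^bsub>G\<^esub> inv\<^bsub>G\<^esub> u x \<in> m K" "v y \<otimes>\<^bsub>G\<^esub> inv\<^bsub>G\<^esub> v x \<in> m K"
        using subgroup.rcos_module_imp[OF sg u.H.is_group] x by auto
      then have "y \<otimes>\<^bsub>D\<^esub> inv\<^bsub>D\<^esub> x \<in> K" using m(2)[OF K, of "y \<otimes>\<^bsub>D\<^esub> inv\<^bsub>D\<^esub> x"] x y by simp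
      then show "y \<in> K #>\<^bsub>D\<^esub> x" using K.rcos_module_rev[OF u.G.is_group x] y by blast
    qed
    moreover have "x \<in> ?A" using x u.H.rcos_self[OF _ sg] by simp
    ultimately show ?thesis unfolding F_def using K.set_mult_subset_rcoset[OF x, of ?A] by auto
  qed
  have \<Psi>_coset: "\<Psi> (a, b) K = K #>\<^bsub>D\<^esub> x"
    if ab: "a \<in> ?GC" "b \<in> ?GC" and K: "K \<in> fin_index_normal D" and M: "M \<in> fin_index_normal G" "M \<subseteq> m K"
      and x: "x \<in> carrier D" "a M = M #>\<^bsub>G\<^esub> u x" "b M = M #>\<^bsub>G\<^esub> v x" for a b K M x
    using F_coset[OF K x(1)] K
      u.H.profinite_completion_compatible[OF ab(1) M(1) m(1)[OF K] M(2) _ x(2)]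
      u.H.profinite_completion_compatible[OF ab(2) M(1) m(1)[OF K] M(2) _ x(3)] x(1)
    by (simp add: \<Psi>_def)
  have ex: "\<exists>x\<in>carrier D. a M = M #>\<^bsub>G\<^esub> u x \<and> b M = M #>\<^bsub>G\<^esub> v x"
    if ab: "a \<in> ?GC" "b \<in> ?GC" and M: "M \<in> fin_index_normal G" for a b M
  proof -
    obtain g where g: "g \<in> carrier G" "a M = M #>\<^bsub>G\<^esub> g" using u.H.profinite_completion_coset[OF ab(1) M] .
    obtain g' where g': "g' \<in> carrier G" "b M = M #>\<^bsub>G\<^esub> g'" using u.H.profinite_completion_coset[OF ab(2) M] .
    show ?thesis using dense M g g' unfolding dense_image_def by metis
  qed
  have \<Psi>_closed: "\<Psi> (a, b) \<in> ?DC" if ab: "a \<in> ?GC" "b \<in> ?GC" for a b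
  proof (rule u.G.profinite_completionI)
    show "\<Psi> (a, b) \<in> extensional (fin_index_normal D)" by (simp add: \<Psi>_def)
    fix N K assume NK: "N \<in> fin_index_normal D" "K \<in> fin_index_normal D" "N \<subseteq> K"
    \<comment> \<open>The choice \<open>m\<close> need not be monotone, so both components are
      computed from a representative at a common refinement.\<close>
    have M: "m N \<inter> m K \<in> fin_index_normal G" using u.H.fin_index_normal_Int m(1) NK by blast
    obtain x where x: "x \<in> carrier D" "a (m N \<inter> m K) = m N \<inter> m K #>\<^bsub>G\<^esub> u x"
      "b (m N \<inter> m K) = m N \<inter> m K #>\<^bsub>G\<^esub> v x" using ex[OF ab M] by blast
    show "\<exists>x\<in>carrier D. \<Psi> (a, b) N = N #>\<^bsub>D\<^esub> x \<and> \<Psi> (a, b) K = K #>\<^bsub>D\<^esub> x"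
      using \<Psi>_coset[OF ab NK(1) M _ x] \<Psi>_coset[OF ab NK(2) M _ x] x(1) by blast
  qed
  have \<Phi>_closed: "profinite_pair f \<in> ?GC \<times> ?GC" if "f \<in> ?DC" for f
    using that u.profinite_map_closed v.profinite_map_closed by (simp add: profinite_pair_def)
  have \<Phi>\<Psi>: "profinite_pair (\<Psi> (a, b)) = (a, b)" if ab: "a \<in> ?GC" "b \<in> ?GC" for a b
  proof -
    note pc = \<Psi>_closed[OF ab]
    have "profinite_map D G u (\<Psi> (a, b)) M = a M" if M: "M \<in> fin_index_normal G" for M
    proof -
      let ?L = "{x \<in> carrier D. u x \<in> M}"
      have L: "?L \<in> fin_index_normal D" using u.fin_index_normal_vimage[OF M] .
      have M': "M \<inter> m ?L \<in> fin_index_normal G" using u.H.fin_index_normal_Int[OF M m(1)[OF L]] .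
      obtain x where x: "x \<in> carrier D" "a (M \<inter> m ?L) = M \<inter> m ?L #>\<^bsub>G\<^esub> u x"
        "b (M \<inter> m ?L) = M \<inter> m ?L #>\<^bsub>G\<^esub> v x" using ex[OF ab M'] by blast
      have "\<Psi> (a, b) ?L = ?L #>\<^bsub>D\<^esub> x" by (rule \<Psi>_coset[OF ab L M' _ x]) simp
      then have "profinite_map D G u (\<Psi> (a, b)) M = M #>\<^bsub>G\<^esub> u x"
        using u.profinite_map_coset[OF pc M L _ x(1)] by simp
      then show ?thesis using u.H.profinite_completion_compatible[OF ab(1) M' M _ _ x(2)] x(1) by simp
    qed
    then have 1: "profinite_map D G u (\<Psi> (a, b)) = a"
      using u.H.profinite_completion_eqI[OF u.profinite_map_closed[OF pc] ab(1)] by blast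
    have "profinite_map D G v (\<Psi> (a, b)) M = b M" if M: "M \<in> fin_index_normal G" for M
    proof -
      let ?L = "{x \<in> carrier D. v x \<in> M}"
      have L: "?L \<in> fin_index_normal D" using v.fin_index_normal_vimage[OF M] .
      have M': "M \<inter> m ?L \<in> fin_index_normal G" using u.H.fin_index_normal_Int[OF M m(1)[OF L]] .
      obtain x where x: "x \<in> carrier D" "a (M \<inter> m ?L) = M \<inter> m ?L #>\<^bsub>G\<^esub> u x"
        "b (M \<inter> m ?L) = M \<inter> m ?L #>\<^bsub>G\<^esub> v x" using ex[OF ab M'] by blast
      have "\<Psi> (a, b) ?L = ?L #>\<^bsub>D\<^esub> x" by (rule \<Psi>_coset[OF ab L M' _ x]) simp
      then have "profinite_map D G v (\<Psi> (a, b)) M = M #>\<^bsub>G\<^esub> v x"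
        using v.profinite_map_coset[OF pc M L _ x(1)] by simp
      then show ?thesis using u.H.profinite_completion_compatible[OF ab(2) M' M _ _ x(3)] x(1) by simp
    qed
    then have 2: "profinite_map D G v (\<Psi> (a, b)) = b"
      using u.H.profinite_completion_eqI[OF v.profinite_map_closed[OF pc] ab(2)] by blast
    show ?thesis using 1 2 by (simp add: profinite_pair_def)
  qed
  have \<Psi>\<Phi>: "\<Psi> (profinite_pair f) = f" if f: "f \<in> ?DC" for f
  proof -
    have ab: "profinite_map D G u f \<in> ?GC" "profinite_map D G v f \<in> ?GC"
      using u.profinite_map_closed v.profinite_map_closed f by auto
    show ?thesis unfolding profinite_pair_def
    proof (rule u.G.profinite_completion_eqI[OF \<Psi>_closed[OF ab] f])
      fix K assume K: "K \<in> fin_index_normal D"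
      note M = m(1)[OF K]
      let ?L = "{x \<in> carrier D. u x \<in> m K} \<inter> {x \<in> carrier D. v x \<in> m K}"
      have L: "?L \<in> fin_index_normal D"
        using u.G.fin_index_normal_Int[OF u.fin_index_normal_vimage[OF M] v.fin_index_normal_vimage[OF M]] .
      obtain x where x: "x \<in> carrier D" "f ?L = ?L #>\<^bsub>D\<^esub> x" using u.G.profinite_completion_coset[OF f L] .
      have "profinite_map D G u f (m K) = m K #>\<^bsub>G\<^esub> u x" by (rule u.profinite_map_coset[OF f M L _ x]) simp
      moreover have "profinite_map D G v f (m K) = m K #>\<^bsub>G\<^esub> v x" by (rule v.profinite_map_coset[OF f M L _ x]) simp
      ultimately have "\<Psi> (profinite_map D G u f, profinite_map D G v f) K = K #>\<^bsub>D\<^esub> x"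
        by (intro \<Psi>_coset[OF ab K M _ x(1)]) simp_all
      moreover have "?L \<subseteq> K" using m(2)[OF K] by blast
      then have "f K = K #>\<^bsub>D\<^esub> x" by (rule u.G.profinite_completion_compatible[OF f L K _ x])
      ultimately show "\<Psi> (profinite_map D G u f, profinite_map D G v f) K = f K" by simp
    qed
  qed
  have "continuous_map (prod_topology (profinite_topology G) (profinite_topology G)) (profinite_topology D) \<Psi>"
  proof (rule u.G.continuous_map_into_profinite)
    show "\<Psi> c \<in> ?DC" if "c \<in> topspace (prod_topology (profinite_topology G) (profinite_topology G))" for c
      using that \<Psi>_closed by (auto simp: u.H.topspace_profinite_topology)
    fix K assume K: "K \<in> fin_index_normal D"
    let ?C = "carrier (G Mod m K)"
    let ?X = "prod_topology (profinite_topology G) (profinite_topology G)"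
    note comp = u.H.continuous_map_profinite_component[OF m(1)[OF K]]
    have "continuous_map ?X (prod_topology (discrete_topology ?C) (discrete_topology ?C))
        (\<lambda>c. (fst c (m K), snd c (m K)))"
      using continuous_map_compose[OF continuous_map_fst comp] continuous_map_compose[OF continuous_map_snd comp]
      by (intro continuous_map_pairedI) (simp_all add: o_def)
    then have 1: "continuous_map ?X (discrete_topology (?C \<times> ?C)) (\<lambda>c. (fst c (m K), snd c (m K)))"
      by (simp add: prod_topology_discrete_topology)
    have "F K (A, B) \<in> carrier (D Mod K)" if AB: "A \<in> ?C" "B \<in> ?C" for A B
    proof -
      obtain g g' where "g \<in> carrier G" "A = m K #>\<^bsub>G\<^esub> g" "g' \<in> carrier G" "B = m K #>\<^bsub>G\<^esub> g'"
        using AB by (auto simp: carrier_Mod_iff)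
      then obtain x where "x \<in> carrier D" "A = m K #>\<^bsub>G\<^esub> u x" "B = m K #>\<^bsub>G\<^esub> v x"
        using dense m(1)[OF K] unfolding dense_image_def by metis
      then show ?thesis using F_coset[OF K] by (auto simp: carrier_Mod_iff)
    qed
    then have "continuous_map (discrete_topology (?C \<times> ?C)) (discrete_topology (carrier (D Mod K))) (F K)"
      by auto
    from continuous_map_compose[OF 1 this]
    show "continuous_map ?X (discrete_topology (carrier (D Mod K))) (\<lambda>c. \<Psi> c K)"
      using K by (simp add: \<Psi>_def o_def case_prod_beta)
  qed
  moreover have "continuous_map (profinite_topology D)
      (prod_topology (profinite_topology G) (profinite_topology G)) profinite_pair"
    unfolding profinite_pair_def
    by (intro continuous_map_pairedI u.continuous_map_profinite_map v.continuous_map_profinite_map)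
  ultimately have "homeomorphic_maps (profinite_topology D)
      (prod_topology (profinite_topology G) (profinite_topology G)) profinite_pair \<Psi>"
    unfolding homeomorphic_maps_def
    using \<Phi>\<Psi> \<Psi>\<Phi> by (auto simp: u.G.topspace_profinite_topology u.H.topspace_profinite_topology)
  then have "homeomorphic_map (profinite_topology D)
      (prod_topology (profinite_topology G) (profinite_topology G)) profinite_pair"
    using homeomorphic_map_maps by blast
  moreover have "bij_betw profinite_pair ?DC (?GC \<times> ?GC)"
  proof (rule bij_betw_byWitness[where f' = \<Psi>])
    show "profinite_pair ` ?DC \<subseteq> ?GC \<times> ?GC" using \<Phi>_closed by blast
    show "\<Psi> ` (?GC \<times> ?GC) \<subseteq> ?DC" using \<Psi>_closed by blast
    show "\<forall>f\<in>?DC. \<Psi> (profinite_pair f) = f" using \<Psi>\<Phi> by blast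
    show "\<forall>c\<in>?GC \<times> ?GC. profinite_pair (\<Psi> c) = c" using \<Phi>\<Psi> by blast
  qed
  moreover have "profinite_pair \<in> hom (profinite_completion D) (profinite_completion G \<times>\<times> profinite_completion G)"
    using u.profinite_map_hom v.profinite_map_hom
    by (auto simp: hom_def profinite_pair_def DirProd_def)
  ultimately show ?thesis by (simp add: topological_group_iso_def iso_def)
qed

end

lemma topological_group_iso_cong:
  assumes "topspace S = carrier G" "\<And>x. x \<in> carrier G \<Longrightarrow> f x = g x"
    "\<And>x y. x \<in> carrier G \<Longrightarrow> y \<in> carrier G \<Longrightarrow> x \<otimes>\<^bsub>G\<^esub> y \<in> carrier G"
  shows "topological_group_iso G S H T f \<longleftrightarrow> topological_group_iso G S H T g"
proof -
  have "f \<in> hom G H \<longleftrightarrow> g \<in> hom G H" using assms(2,3) by (auto simp: hom_def Pi_def)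
  moreover have "bij_betw f (carrier G) (carrier H) \<longleftrightarrow> bij_betw g (carrier G) (carrier H)"
    using assms(2) by (rule bij_betw_cong)
  moreover have "homeomorphic_map S T f \<longleftrightarrow> homeomorphic_map S T g"
    using assms(1,2) homeomorphic_map_eq[of S T f g] homeomorphic_map_eq[of S T g f] by auto
  ultimately show ?thesis by (simp add: topological_group_iso_def iso_def)
qed

lemma fst_hom_DirProd: "fst \<in> hom (G \<times>\<times> H) G"
  and snd_hom_DirProd: "snd \<in> hom (G \<times>\<times> H) H"
  by (auto simp: hom_def)

section \<open>The fibre product and its two projections\<close>

locale fibre_product_hom = p: group_hom G Q p
  for G :: "('g, 'm) monoid_scheme" and Q :: "('q, 'k) monoid_scheme" and p
begin

lemma subgroup_fibre_product: "subgroup {(g, g'). g \<in> carrier G \<and> g' \<in> carrier G \<and> p g = p g'} (G \<times>\<times> G)"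
proof -
  interpret GG: group "G \<times>\<times> G" using DirProd_group[OF p.G.is_group p.G.is_group] .
  show ?thesis
  proof (rule GG.subgroupI)
    show "{(g, g'). g \<in> carrier G \<and> g' \<in> carrier G \<and> p g = p g'} \<noteq> {}" using p.G.one_closed by blast
  qed (auto simp: inv_DirProd)
qed

lemma carrier_fibre_product [simp]:
  "x \<in> carrier (fibre_product G p) \<longleftrightarrow> fst x \<in> carrier G \<and> snd x \<in> carrier G \<and> p (fst x) = p (snd x)"
  by (auto simp: fibre_product_def)

lemma mult_fibre_product [simp]: "x \<otimes>\<^bsub>fibre_product G p\<^esub> y = (fst x \<otimes>\<^bsub>G\<^esub> fst y, snd x \<otimes>\<^bsub>G\<^esub> snd y)"
  by (simp add: fibre_product_def DirProd_def case_prod_beta)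

lemma group_fibre_product: "group (fibre_product G p)"
  unfolding fibre_product_def
  by (rule group.subgroup_imp_group[OF DirProd_group[OF p.G.is_group p.G.is_group] subgroup_fibre_product])

lemma inv_fibre_product:
  assumes "x \<in> carrier (fibre_product G p)"
  shows "inv\<^bsub>fibre_product G p\<^esub> x = (inv\<^bsub>G\<^esub> (fst x), inv\<^bsub>G\<^esub> (snd x))"
  using assms
  by (intro group.inv_equality[OF group_fibre_product]) (auto simp: fibre_product_def one_DirProd)

end

sublocale fibre_product_hom \<subseteq> two_homs "fibre_product G p" G fst snd
proof -
  have "fst \<in> hom (fibre_product G p) G" "snd \<in> hom (fibre_product G p) G"
    by (rule homI; simp)+
  then show "two_homs (fibre_product G p) G fst snd"
    using group_fibre_product p.G.is_group by (simp add: two_homs_def group_hom_def group_hom_axioms_def)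
qed

context fibre_product_hom begin

text \<open>By functoriality the composite in the definition agrees, on the completion, with the
  pair of maps induced by the two projections of the fibre product, to which the criterion
  applies.\<close>

lemma fibre_product_inclusion_profinite_iso_iff:
  "fibre_product_inclusion_profinite_iso G p \<longleftrightarrow> dense_image \<and> induced_topology_full"
proof -
  let ?P = "fibre_product G p"
  have GG: "group (G \<times>\<times> G)" by (rule DirProd_group[OF p.G.is_group p.G.is_group])
  have "(\<lambda>x. x) \<in> hom ?P (G \<times>\<times> G)"
    using u.homh v.homh by (simp add: hom_pairwise o_def)
  then have i: "group_hom ?P (G \<times>\<times> G) (\<lambda>x. x)"
    using group_fibre_product GG by (simp add: group_hom_def group_hom_axioms_def)
  have 1: "group_hom (G \<times>\<times> G) G fst" and 2: "group_hom (G \<times>\<times> G) G snd"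
    using GG p.G.is_group fst_hom_DirProd[of G G] snd_hom_DirProd[of G G] by (simp_all add: group_hom_def group_hom_axioms_def)
  have "(profinite_prod_map G G \<circ> profinite_map ?P (G \<times>\<times> G) (\<lambda>x. x)) f = profinite_pair f"
    if "f \<in> carrier (profinite_completion ?P)" for f
    using profinite_map_compose[OF i 1 that] profinite_map_compose[OF i 2 that]
    by (simp add: profinite_prod_map_def profinite_pair_def o_def)
  then have "fibre_product_inclusion_profinite_iso G p \<longleftrightarrow> pair_iso"
    unfolding fibre_product_inclusion_profinite_iso_def
    by (rule topological_group_iso_cong[OF u.G.topspace_profinite_topology _ u.G.profinite_completion_mult_closed])
  then show ?thesis
    using dense_image_if_pair_iso induced_topology_full_if_pair_iso pair_isoI by iprover
qed

end

section \<open>The bar complex in low degrees\<close>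

lemma bar_boundary_add: "bar_boundary G n (x + y) = bar_boundary G n x + bar_boundary G n y"
  by (simp add: bar_boundary_def frag_extend_add)

lemma bar_boundary_diff: "bar_boundary G n (x - y) = bar_boundary G n x - bar_boundary G n y"
  by (simp add: bar_boundary_def frag_extend_diff)

lemma bar_boundary_0: "bar_boundary G n 0 = 0"
  by (simp add: bar_boundary_def)

lemma bar_boundary_2_of:
  "bar_boundary G 2 (frag_of [a, b]) = frag_of [b] - frag_of [a \<otimes>\<^bsub>G\<^esub> b] + frag_of [a]"
  by (simp add: bar_boundary_def bar_face_def numeral_2_eq_2)

lemma bar_boundary_3_of:
  "bar_boundary G 3 (frag_of [a, b, c]) =
     frag_of [b, c] - frag_of [a \<otimes>\<^bsub>G\<^esub> b, c] + frag_of [a, b \<otimes>\<^bsub>G\<^esub> c] - frag_of [a, b]"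
  by (simp add: bar_boundary_def bar_face_def numeral_3_eq_3)

lemma carrier_bar_chains:
  "x \<in> carrier (bar_chains G n) \<longleftrightarrow> Poly_Mapping.keys x \<subseteq> {gs \<in> lists (carrier G). length gs = n}"
  by (simp add: bar_chains_def)

lemma bar_chains_mult [simp]: "x \<otimes>\<^bsub>bar_chains G n\<^esub> y = x + y"
  by (simp add: bar_chains_def)

lemma bar_chains_one [simp]: "\<one>\<^bsub>bar_chains G n\<^esub> = 0"
  by (simp add: bar_chains_def)

lemma comm_group_bar_chains: "comm_group (bar_chains G n)"
  by (simp add: bar_chains_def abelian_free_Abelian_group)

lemma group_bar_chains: "group (bar_chains G n)"
  by (simp add: bar_chains_def)

lemma bar_chains_inv:
  "x \<in> carrier (bar_chains G n) \<Longrightarrow> inv\<^bsub>bar_chains G n\<^esub> x = - x"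
  by (simp add: bar_chains_def)

lemma bar_chains_closed:
  assumes "x \<in> carrier (bar_chains G n)" "y \<in> carrier (bar_chains G n)"
  shows "x + y \<in> carrier (bar_chains G n)" "x - y \<in> carrier (bar_chains G n)"
  using assms keys_add[of x y] keys_diff[of x y] unfolding carrier_bar_chains by blast+

lemma bar_chains_induct [consumes 1, case_names zero diff of]:
  assumes "x \<in> carrier (bar_chains G n)" and "P 0"
    and "\<And>x y. x \<in> carrier (bar_chains G n) \<Longrightarrow> y \<in> carrier (bar_chains G n) \<Longrightarrow> P x \<Longrightarrow> P y \<Longrightarrow> P (x - y)"
    and "\<And>gs. gs \<in> lists (carrier G) \<Longrightarrow> length gs = n \<Longrightarrow> P (frag_of gs)"
  shows "P x"
  using free_Abelian_group_induct[of x "{gs \<in> lists (carrier G). length gs = n}" P] assms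
  unfolding carrier_bar_chains by simp

lemma length_2_cases: "length gs = 2 \<Longrightarrow> \<exists>a b. gs = [a, b]"
  by (simp add: numeral_2_eq_2 length_Suc_conv) blast

lemma length_3_cases: "length gs = 3 \<Longrightarrow> \<exists>a b c. gs = [a, b, c]"
  by (simp add: numeral_3_eq_3 length_Suc_conv) blast

lemma frag_of_bar_chains [simp]:
  "frag_of gs \<in> carrier (bar_chains G n) \<longleftrightarrow> gs \<in> lists (carrier G) \<and> length gs = n"
  by (simp add: carrier_bar_chains)

lemma bar_2_induct [consumes 1, case_names zero diff of]:
  assumes "x \<in> carrier (bar_chains G 2)" and "P 0"
    and "\<And>x y. x \<in> carrier (bar_chains G 2) \<Longrightarrow> y \<in> carrier (bar_chains G 2) \<Longrightarrow> P x \<Longrightarrow> P y \<Longrightarrow> P (x - y)"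
    and "\<And>a b. a \<in> carrier G \<Longrightarrow> b \<in> carrier G \<Longrightarrow> P (frag_of [a, b])"
  shows "P x"
proof (rule bar_chains_induct[OF assms(1)])
  fix gs assume "gs \<in> lists (carrier G)" "length gs = 2"
  then show "P (frag_of gs)" using length_2_cases[of gs] assms(4) by auto
qed (fact assms)+

lemma bar_3_induct [consumes 1, case_names zero diff of]:
  assumes "x \<in> carrier (bar_chains G 3)" and "P 0"
    and "\<And>x y. x \<in> carrier (bar_chains G 3) \<Longrightarrow> y \<in> carrier (bar_chains G 3) \<Longrightarrow> P x \<Longrightarrow> P y \<Longrightarrow> P (x - y)"
    and "\<And>a b c. a \<in> carrier G \<Longrightarrow> b \<in> carrier G \<Longrightarrow> c \<in> carrier G \<Longrightarrow> P (frag_of [a, b, c])"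
  shows "P x"
proof (rule bar_chains_induct[OF assms(1)])
  fix gs assume "gs \<in> lists (carrier G)" "length gs = 3"
  then show "P (frag_of gs)" using length_3_cases[of gs] assms(4) by auto
qed (fact assms)+

lemma hom_bar_chains_diff:
  assumes F: "F \<in> hom (bar_chains G n) A" and A: "group A"
    and x: "x \<in> carrier (bar_chains G n)" "y \<in> carrier (bar_chains G n)"
  shows "F (x - y) = F x \<otimes>\<^bsub>A\<^esub> inv\<^bsub>A\<^esub> F y"
proof -
  interpret group_hom "bar_chains G n" A F
    using F A group_bar_chains by (simp add: group_hom_def group_hom_axioms_def)
  show ?thesis using hom_mult[OF x(1) G.inv_closed[OF x(2)]] hom_inv[OF x(2)] x(2) by (simp add: bar_chains_inv)
qed

lemma hom_bar_chains_add:
  assumes "F \<in> hom (bar_chains G n) A" "x \<in> carrier (bar_chains G n)" "y \<in> carrier (bar_chains G n)"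
  shows "F (x + y) = F x \<otimes>\<^bsub>A\<^esub> F y"
  using hom_mult[OF assms] by simp

context group begin

lemma bar_boundary_2_closed:
  assumes "x \<in> carrier (bar_chains G 2)" shows "bar_boundary G 2 x \<in> carrier (bar_chains G 1)"
  using assms
proof (induction rule: bar_2_induct)
  case zero
  show ?case by (simp add: bar_boundary_0 carrier_bar_chains)
next
  case (diff x y)
  then show ?case using bar_chains_closed(2) by (simp only: bar_boundary_diff)
next
  case (of a b)
  then show ?case unfolding bar_boundary_2_of by (intro bar_chains_closed) simp_all
qed

lemma bar_boundary_3_closed:
  assumes "x \<in> carrier (bar_chains G 3)" shows "bar_boundary G 3 x \<in> carrier (bar_chains G 2)"
  using assms
proof (induction rule: bar_3_induct)
  case zero
  show ?case by (simp add: bar_boundary_0 carrier_bar_chains)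
next
  case (diff x y)
  then show ?case using bar_chains_closed(2) by (simp only: bar_boundary_diff)
next
  case (of a b c)
  then show ?case unfolding bar_boundary_3_of by (intro bar_chains_closed) simp_all
qed

lemma bar_boundary_2_3:
  assumes "x \<in> carrier (bar_chains G 3)" shows "bar_boundary G 2 (bar_boundary G 3 x) = 0"
  using assms
proof (induction rule: bar_3_induct)
  case (of a b c)
  then show ?case
    by (simp add: bar_boundary_3_of bar_boundary_add bar_boundary_diff bar_boundary_2_of m_assoc)
qed (simp_all add: bar_boundary_0 bar_boundary_diff)

lemma hom_bar_boundary_2: "bar_boundary G 2 \<in> hom (bar_chains G 2) (bar_chains G 1)"
  by (rule homI) (simp_all add: bar_boundary_2_closed[unfolded One_nat_def] bar_boundary_add)

lemma hom_bar_boundary_3: "bar_boundary G 3 \<in> hom (bar_chains G 3) (bar_chains G 2)"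
  by (rule homI) (simp_all add: bar_boundary_3_closed bar_boundary_add)

definition bar_cycles :: "('a list \<Rightarrow>\<^sub>0 int) set" where
  "bar_cycles = {x \<in> carrier (bar_chains G 2). bar_boundary G 2 x = 0}"

definition bar_boundaries :: "('a list \<Rightarrow>\<^sub>0 int) set" where
  "bar_boundaries = bar_boundary G 3 ` carrier (bar_chains G 3)"

lemma bar_boundaries_subset: "bar_boundaries \<subseteq> bar_cycles"
  using bar_boundary_3_closed bar_boundary_2_3 by (auto simp: bar_boundaries_def bar_cycles_def)

lemma subgroup_bar_cycles: "subgroup bar_cycles (bar_chains G 2)"
proof -
  interpret d: group_hom "bar_chains G 2" "bar_chains G 1" "bar_boundary G 2"
    by (intro group_hom.intro group_hom_axioms.intro group_bar_chains hom_bar_boundary_2)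
  have "bar_cycles = kernel (bar_chains G 2) (bar_chains G 1) (bar_boundary G 2)"
    by (simp add: bar_cycles_def kernel_def)
  then show ?thesis using d.subgroup_kernel by simp
qed

lemma subgroup_bar_boundaries: "subgroup bar_boundaries (bar_chains G 2)"
proof -
  interpret d: group_hom "bar_chains G 3" "bar_chains G 2" "bar_boundary G 3"
    by (intro group_hom.intro group_hom_axioms.intro group_bar_chains hom_bar_boundary_3)
  show ?thesis unfolding bar_boundaries_def by (rule d.img_is_subgroup)
qed

lemma trivial_group_homology_2_iff:
  "trivial_group (group_homology G 2) \<longleftrightarrow> bar_cycles \<subseteq> bar_boundaries"
proof -
  let ?Z = "(bar_chains G 2)\<lparr>carrier := bar_cycles\<rparr>"
  have H: "group_homology G 2 = ?Z Mod bar_boundaries"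
    by (simp add: group_homology_def bar_cycles_def bar_boundaries_def kernel_def)
  interpret Z: comm_group ?Z
    by (rule comm_group.subgroup_imp_comm_group[OF comm_group_bar_chains subgroup_bar_cycles])
  have sub: "subgroup bar_boundaries ?Z"
    using group.subgroup_incl[OF group_bar_chains subgroup_bar_boundaries subgroup_bar_cycles bar_boundaries_subset] .
  interpret B: normal bar_boundaries ?Z using Z.subgroup_imp_normal[OF sub] .
  have c: "carrier (group_homology G 2) = (\<lambda>x. bar_boundaries #>\<^bsub>?Z\<^esub> x) ` bar_cycles"
    unfolding H carrier_FactGroup by simp
  have join: "bar_boundaries #>\<^bsub>?Z\<^esub> x = bar_boundaries \<longleftrightarrow> x \<in> bar_boundaries" if "x \<in> bar_cycles" for x
    using that Z.coset_join1[OF _ _ sub, of x] Z.coset_join2[OF _ sub, of x] by auto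
  have "\<one>\<^bsub>group_homology G 2\<^esub> = bar_boundaries" unfolding H by simp
  moreover have "group (group_homology G 2)" unfolding H by (rule B.factorgroup_is_group)
  ultimately have "trivial_group (group_homology G 2) \<longleftrightarrow> carrier (group_homology G 2) \<subseteq> {bar_boundaries}"
    using group.trivial_group_subset[of "group_homology G 2"] by simp
  also have "\<dots> \<longleftrightarrow> bar_cycles \<subseteq> bar_boundaries" unfolding c using join by auto
  finally show ?thesis .
qed

text \<open>This is the vanishing of \<open>H_1\<close>. Modulo boundaries the symbol
  \<open>[x]\<close> is additive in \<open>x\<close>, so the elements whose symbol is a boundary
  form a subgroup containing all commutators.\<close>

lemma bar_boundary_2_surj:
  assumes perfect: "derived G (carrier G) = carrier G" and x: "x \<in> carrier G"
  shows "\<exists>c\<in>carrier (bar_chains G 2). bar_boundary G 2 c = frag_of [x]"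
proof -
  let ?I = "bar_boundary G 2 ` carrier (bar_chains G 2)"
  define T where "T = {x \<in> carrier G. frag_of [x] \<in> ?I}"
  have add: "u + v \<in> ?I" and diff: "u - v \<in> ?I" if uv: "u \<in> ?I" "v \<in> ?I" for u v
  proof -
    obtain x where x: "u = bar_boundary G 2 x" "x \<in> carrier (bar_chains G 2)" using uv(1) by (rule imageE)
    obtain y where y: "v = bar_boundary G 2 y" "y \<in> carrier (bar_chains G 2)" using uv(2) by (rule imageE)
    show "u + v \<in> ?I" unfolding x(1) y(1) bar_boundary_add[symmetric] by (intro imageI bar_chains_closed x y)
    show "u - v \<in> ?I" unfolding x(1) y(1) bar_boundary_diff[symmetric] by (intro imageI bar_chains_closed x y)
  qed
  have d: "frag_of [b] - frag_of [a \<otimes> b] + frag_of [a] \<in> ?I" if "a \<in> carrier G" "b \<in> carrier G" for a b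
    using that by (intro image_eqI[of _ _ "frag_of [a, b]"]) (simp_all add: bar_boundary_2_of)
  have one: "frag_of [\<one>] \<in> ?I" using d[of \<one> \<one>] by simp
  have inv: "frag_of [a] + frag_of [inv a] \<in> ?I" if "a \<in> carrier G" for a
    using add[OF d[of a "inv a"] one] that by (simp add: add.commute)
  have "derived G (carrier G) \<subseteq> T"
    unfolding derived_def
  proof (rule generate_subgroup_incl)
    show "derived_set G (carrier G) \<subseteq> T"
    proof
      fix z assume "z \<in> derived_set G (carrier G)"
      then obtain a b where ab: "a \<in> carrier G" "b \<in> carrier G" "z = a \<otimes> b \<otimes> inv a \<otimes> inv b" by auto
      have z: "z \<in> carrier G" "z = (a \<otimes> b) \<otimes> (inv a \<otimes> inv b)" using ab by (simp_all add: m_assoc)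
      \<comment> \<open>The subtracted terms are, in this order, the boundaries of
        \<open>[ab|a^-1 b^-1]\<close>, \<open>[a|b]\<close> and \<open>[a^-1|b^-1]\<close>.\<close>
      have eq: "frag_of [z] = (frag_of [a] + frag_of [inv a]) + (frag_of [b] + frag_of [inv b])
          - (frag_of [inv a \<otimes> inv b] - frag_of [z] + frag_of [a \<otimes> b])
          - (frag_of [b] - frag_of [a \<otimes> b] + frag_of [a])
          - (frag_of [inv b] - frag_of [inv a \<otimes> inv b] + frag_of [inv a])"
        by (simp add: algebra_simps)
      have dz: "frag_of [inv a \<otimes> inv b] - frag_of [z] + frag_of [a \<otimes> b] \<in> ?I"
        unfolding z(2) using ab by (intro d) simp_all
      have "frag_of [z] \<in> ?I"
        by (subst eq) (rule diff[OF diff[OF diff[OF add[OF inv[OF ab(1)] inv[OF ab(2)]] dz] d[OF ab(1,2)]]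
              d[OF inv_closed[OF ab(1)] inv_closed[OF ab(2)]]])
      then show "z \<in> T" using z(1) by (simp add: T_def)
    qed
    show "subgroup T G"
    proof (rule subgroupI)
      show "T \<subseteq> carrier G" by (auto simp: T_def)
      show "T \<noteq> {}" using one unfolding T_def by blast
      show "inv a \<in> T" if "a \<in> T" for a
      proof -
        have a: "a \<in> carrier G" "frag_of [a] \<in> ?I" using that by (simp_all add: T_def)
        have "frag_of [inv a] \<in> ?I" using diff[OF inv[OF a(1)] a(2)] by simp
        then show ?thesis using a(1) by (simp add: T_def)
      qed
      show "a \<otimes> b \<in> T" if "a \<in> T" "b \<in> T" for a b
      proof -
        have ab: "a \<in> carrier G" "frag_of [a] \<in> ?I" "b \<in> carrier G" "frag_of [b] \<in> ?I" using that by (simp_all add: T_def)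
        have "frag_of [a \<otimes> b] \<in> ?I" using diff[OF add[OF ab(2,4)] d[OF ab(1,3)]] by simp
        then show ?thesis using ab by (simp add: T_def)
      qed
    qed
  qed
  then have "frag_of [x] \<in> ?I" using x perfect unfolding T_def by blast
  then obtain c where c: "frag_of [x] = bar_boundary G 2 c" "c \<in> carrier (bar_chains G 2)" by (rule imageE)
  then show ?thesis using c(1)[symmetric] by blast
qed

text \<open>Extend \<open>f\<close> linearly to \<open>F\<close> on 2-chains. The cocycle identity
  makes \<open>F\<close> vanish on boundaries, which by \<open>H2\<close> are all the cycles, so the
  value of \<open>F\<close> on a chain with boundary \<open>[a]\<close> does not depend on the
  chain. Perfectness provides such a chain, and \<open>h a\<close> is this value.\<close>

lemma cocycle_is_coboundary:
  assumes perfect: "derived G (carrier G) = carrier G" and H2: "trivial_group (group_homology G 2)"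
    and A: "comm_group A"
    and f: "\<And>a b. a \<in> carrier G \<Longrightarrow> b \<in> carrier G \<Longrightarrow> f a b \<in> carrier A"
    and cocycle: "\<And>a b c. a \<in> carrier G \<Longrightarrow> b \<in> carrier G \<Longrightarrow> c \<in> carrier G \<Longrightarrow>
      f a b \<otimes>\<^bsub>A\<^esub> f (a \<otimes> b) c = f b c \<otimes>\<^bsub>A\<^esub> f a (b \<otimes> c)"
  obtains h where "\<And>a. a \<in> carrier G \<Longrightarrow> h a \<in> carrier A"
    "\<And>a b. a \<in> carrier G \<Longrightarrow> b \<in> carrier G \<Longrightarrow> f a b \<otimes>\<^bsub>A\<^esub> h (a \<otimes> b) = h a \<otimes>\<^bsub>A\<^esub> h b"
proof -
  interpret A: comm_group A by fact
  let ?S = "{gs \<in> lists (carrier G). length gs = 2}"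
  have "(\<lambda>gs. f (gs ! 0) (gs ! 1)) ` ?S \<subseteq> carrier A"
  proof
    fix y assume "y \<in> (\<lambda>gs. f (gs ! 0) (gs ! 1)) ` ?S"
    then obtain gs where gs: "y = f (gs ! 0) (gs ! 1)" "gs \<in> ?S" by (rule imageE)
    then obtain a b where "gs = [a, b]" using length_2_cases[of gs] by blast
    then show "y \<in> carrier A" using gs f by simp
  qed
  then obtain F where F: "F \<in> hom (free_Abelian_group ?S) A"
      "\<And>gs. gs \<in> ?S \<Longrightarrow> F (frag_of gs) = f (gs ! 0) (gs ! 1)"
    by (rule A.free_Abelian_group_universal) blast
  have Fh: "F \<in> hom (bar_chains G 2) A" using F(1) by (simp add: bar_chains_def)
  have Fc: "F x \<in> carrier A" if "x \<in> carrier (bar_chains G 2)" for x using Fh that by (rule hom_in_carrier)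
  have Fab: "F (frag_of [a, b]) = f a b" if "a \<in> carrier G" "b \<in> carrier G" for a b
    using F(2)[of "[a, b]"] that by simp
  note Fadd = hom_bar_chains_add[OF Fh] and Fdiff = hom_bar_chains_diff[OF Fh A.is_group]
  have F3: "F (bar_boundary G 3 x) = \<one>\<^bsub>A\<^esub>" if "x \<in> carrier (bar_chains G 3)" for x
    using that
  proof (induction rule: bar_3_induct)
    case zero
    have "F 0 = \<one>\<^bsub>A\<^esub>" using hom_one[OF Fh group_bar_chains A.is_group] by simp
    then show ?case by (simp add: bar_boundary_0)
  next
    case (diff x y)
    then show ?case using Fdiff[OF bar_boundary_3_closed bar_boundary_3_closed, of x y] by (simp add: bar_boundary_diff)
  next
    case (of a b c)
    have ch: "frag_of [b, c] \<in> carrier (bar_chains G 2)" "frag_of [a \<otimes> b, c] \<in> carrier (bar_chains G 2)"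
      "frag_of [a, b \<otimes> c] \<in> carrier (bar_chains G 2)" "frag_of [a, b] \<in> carrier (bar_chains G 2)"
      using of by simp_all
    have fc: "f a b \<in> carrier A" "f b c \<in> carrier A" "f (a \<otimes> b) c \<in> carrier A" "f a (b \<otimes> c) \<in> carrier A"
      using f of by simp_all
    have "bar_boundary G 3 (frag_of [a, b, c]) =
        (frag_of [b, c] + frag_of [a, b \<otimes> c]) - (frag_of [a, b] + frag_of [a \<otimes> b, c])"
      by (simp add: bar_boundary_3_of)
    then have "F (bar_boundary G 3 (frag_of [a, b, c])) =
        (f b c \<otimes>\<^bsub>A\<^esub> f a (b \<otimes> c)) \<otimes>\<^bsub>A\<^esub> inv\<^bsub>A\<^esub> (f a b \<otimes>\<^bsub>A\<^esub> f (a \<otimes> b) c)"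
      using Fdiff[OF bar_chains_closed(1)[OF ch(1,3)] bar_chains_closed(1)[OF ch(4,2)]]
        Fadd[OF ch(1,3)] Fadd[OF ch(4,2)] of by (simp add: Fab)
    also have "\<dots> = \<one>\<^bsub>A\<^esub>" using cocycle of fc by simp
    finally show ?case .
  qed
  have Fz: "F x = \<one>\<^bsub>A\<^esub>" if "x \<in> carrier (bar_chains G 2)" "bar_boundary G 2 x = 0" for x
  proof -
    have "x \<in> bar_boundaries" using H2 that by (auto simp: trivial_group_homology_2_iff bar_cycles_def)
    then show ?thesis unfolding bar_boundaries_def using F3 by auto
  qed
  define c where "c x = (SOME c. c \<in> carrier (bar_chains G 2) \<and> bar_boundary G 2 c = frag_of [x])" for x
  have c: "c x \<in> carrier (bar_chains G 2) \<and> bar_boundary G 2 (c x) = frag_of [x]" if "x \<in> carrier G" for x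
    unfolding c_def by (rule someI_ex) (use bar_boundary_2_surj[OF perfect that] in auto)
  show thesis
  proof (rule that[of "\<lambda>x. F (c x)"])
    show "F (c a) \<in> carrier A" if "a \<in> carrier G" for a using c[OF that] Fc by simp
    fix a b assume ab: "a \<in> carrier G" "b \<in> carrier G"
    let ?u = "frag_of [a, b] + c (a \<otimes> b)" and ?v = "c a + c b"
    have cl: "frag_of [a, b] \<in> carrier (bar_chains G 2)" "c (a \<otimes> b) \<in> carrier (bar_chains G 2)"
      "c a \<in> carrier (bar_chains G 2)" "c b \<in> carrier (bar_chains G 2)" using c ab by simp_all
    have u: "?u \<in> carrier (bar_chains G 2)" and v: "?v \<in> carrier (bar_chains G 2)"
      using bar_chains_closed(1) cl by blast+
    \<comment> \<open>Both \<open>?u\<close> and \<open>?v\<close> have boundary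
      \<open>[a] + [b]\<close>.\<close>
    have "bar_boundary G 2 (?u - ?v) = 0"
      using c ab by (simp add: bar_boundary_diff bar_boundary_add bar_boundary_2_of)
    then have "F (?u - ?v) = \<one>\<^bsub>A\<^esub>" using Fz bar_chains_closed(2)[OF u v] by blast
    then have "F ?u \<otimes>\<^bsub>A\<^esub> inv\<^bsub>A\<^esub> F ?v = \<one>\<^bsub>A\<^esub>" using Fdiff[OF u v] by simp
    then have "F ?u = F ?v" using A.inv_equality[of "F ?u" "inv\<^bsub>A\<^esub> F ?v"] Fc[OF u] Fc[OF v] by simp
    then show "f a b \<otimes>\<^bsub>A\<^esub> F (c (a \<otimes> b)) = F (c a) \<otimes>\<^bsub>A\<^esub> F (c b)"
      using Fadd[OF cl(1,2)] Fadd[OF cl(3,4)] Fab[OF ab] by simp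
  qed
qed

text \<open>The cochain \<open>h\<close> extends linearly to \<open>H\<close> on 1-chains, and the
  coboundary equation says that \<open>F\<close> is \<open>H\<close> composed with the boundary
  map.\<close>

lemma cycle_in_kernel_if_coboundary:
  assumes A: "comm_group A" and F: "F \<in> hom (bar_chains G 2) A"
    and h: "\<And>a. a \<in> carrier G \<Longrightarrow> h a \<in> carrier A"
    and cob: "\<And>a b. a \<in> carrier G \<Longrightarrow> b \<in> carrier G \<Longrightarrow>
      F (frag_of [a, b]) \<otimes>\<^bsub>A\<^esub> h (a \<otimes> b) = h a \<otimes>\<^bsub>A\<^esub> h b"
    and x: "x \<in> bar_cycles"
  shows "F x = \<one>\<^bsub>A\<^esub>"
proof -
  interpret A: comm_group A by fact
  let ?S = "{gs \<in> lists (carrier G). length gs = 1}"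
  have "(\<lambda>gs. h (gs ! 0)) ` ?S \<subseteq> carrier A"
  proof
    fix y assume "y \<in> (\<lambda>gs. h (gs ! 0)) ` ?S"
    then obtain gs where gs: "y = h (gs ! 0)" "gs \<in> ?S" by (rule imageE)
    then show "y \<in> carrier A" using h nth_mem[of 0 gs] by auto
  qed
  then obtain H where H: "H \<in> hom (free_Abelian_group ?S) A"
      "\<And>gs. gs \<in> ?S \<Longrightarrow> H (frag_of gs) = h (gs ! 0)"
    by (rule A.free_Abelian_group_universal) blast
  have Hh: "H \<in> hom (bar_chains G 1) A" using H(1) by (simp add: bar_chains_def)
  have Ha: "H (frag_of [a]) = h a" if "a \<in> carrier G" for a using H(2)[of "[a]"] that by simp
  note Hadd = hom_bar_chains_add[OF Hh] and Hdiff = hom_bar_chains_diff[OF Hh A.is_group]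
  have H0: "H 0 = \<one>\<^bsub>A\<^esub>" using hom_one[OF Hh group_bar_chains A.is_group] by simp
  have "H (bar_boundary G 2 y) = F y" if "y \<in> carrier (bar_chains G 2)" for y
    using that
  proof (induction rule: bar_2_induct)
    case zero
    have "F 0 = \<one>\<^bsub>A\<^esub>" using hom_one[OF F group_bar_chains A.is_group] by simp
    then show ?case using H0 by (simp add: bar_boundary_0)
  next
    case (diff x y)
    then show ?case
      using Hdiff[OF bar_boundary_2_closed bar_boundary_2_closed, of x y] hom_bar_chains_diff[OF F A.is_group diff(1,2)]
      by (simp add: bar_boundary_diff)
  next
    case (of a b)
    have ch: "frag_of [a] \<in> carrier (bar_chains G 1)" "frag_of [b] \<in> carrier (bar_chains G 1)"
      "frag_of [a \<otimes> b] \<in> carrier (bar_chains G 1)" "frag_of [a, b] \<in> carrier (bar_chains G 2)"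
      using of by simp_all
    have hc: "h a \<in> carrier A" "h b \<in> carrier A" "h (a \<otimes> b) \<in> carrier A" "F (frag_of [a, b]) \<in> carrier A"
      using h of hom_in_carrier[OF F ch(4)] by simp_all
    have "bar_boundary G 2 (frag_of [a, b]) = (frag_of [a] + frag_of [b]) - frag_of [a \<otimes> b]"
      by (simp add: bar_boundary_2_of)
    then have "H (bar_boundary G 2 (frag_of [a, b])) = (h a \<otimes>\<^bsub>A\<^esub> h b) \<otimes>\<^bsub>A\<^esub> inv\<^bsub>A\<^esub> h (a \<otimes> b)"
      using Hdiff[OF bar_chains_closed(1)[OF ch(1,2)] ch(3)] Hadd[OF ch(1,2)] of by (simp add: Ha)
    also have "\<dots> = F (frag_of [a, b])"
      using hc unfolding cob[OF of, symmetric] by (simp add: A.m_assoc)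
    finally show ?case .
  qed
  from this[of x] show ?thesis using x H0 by (simp add: bar_cycles_def)
qed

end

section \<open>Central extensions from cocycles\<close>

locale group_cocycle = group G + A: comm_group A for G (structure) and A :: "('c, 'k) monoid_scheme" +
  fixes f :: "'a \<Rightarrow> 'a \<Rightarrow> 'c"
  assumes f_closed [simp]: "\<And>a b. a \<in> carrier G \<Longrightarrow> b \<in> carrier G \<Longrightarrow> f a b \<in> carrier A"
    and cocycle: "\<And>a b c. a \<in> carrier G \<Longrightarrow> b \<in> carrier G \<Longrightarrow> c \<in> carrier G \<Longrightarrow>
      f a b \<otimes>\<^bsub>A\<^esub> f (a \<otimes> b) c = f b c \<otimes>\<^bsub>A\<^esub> f a (b \<otimes> c)"
begin

text \<open>The cocycle is not assumed normalised, hence the correction by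
  \<open>f \<one> \<one>\<close> in the unit.\<close>

definition extension :: "('c \<times> 'a) monoid" where
  "extension = \<lparr>carrier = carrier A \<times> carrier G,
     mult = (\<lambda>x y. (fst x \<otimes>\<^bsub>A\<^esub> fst y \<otimes>\<^bsub>A\<^esub> f (snd x) (snd y), snd x \<otimes> snd y)),
     one = (inv\<^bsub>A\<^esub> f \<one> \<one>, \<one>)\<rparr>"

lemma carrier_extension [simp]: "x \<in> carrier extension \<longleftrightarrow> fst x \<in> carrier A \<and> snd x \<in> carrier G"
  by (simp add: extension_def mem_Times_iff)

lemma mult_extension [simp]:
  "x \<otimes>\<^bsub>extension\<^esub> y = (fst x \<otimes>\<^bsub>A\<^esub> fst y \<otimes>\<^bsub>A\<^esub> f (snd x) (snd y), snd x \<otimes> snd y)"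
  by (simp add: extension_def)

lemma one_extension [simp]: "\<one>\<^bsub>extension\<^esub> = (inv\<^bsub>A\<^esub> f \<one> \<one>, \<one>)"
  by (simp add: extension_def)

lemma cocycle_one_left: "b \<in> carrier G \<Longrightarrow> f \<one> b = f \<one> \<one>"
  using cocycle[of \<one> \<one> b] by simp

lemma cocycle_one_right: "b \<in> carrier G \<Longrightarrow> f b \<one> = f \<one> \<one>"
  using cocycle[of b \<one> \<one>] by simp

lemma group_extension: "group extension"
proof (rule groupI)
  show "\<one>\<^bsub>extension\<^esub> \<in> carrier extension" by simp
  fix x y assume x: "x \<in> carrier extension" and y: "y \<in> carrier extension"
  show "x \<otimes>\<^bsub>extension\<^esub> y \<in> carrier extension" using x y by simp
  show "x \<otimes>\<^bsub>extension\<^esub> y \<otimes>\<^bsub>extension\<^esub> z = x \<otimes>\<^bsub>extension\<^esub> (y \<otimes>\<^bsub>extension\<^esub> z)"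
    if z: "z \<in> carrier extension" for z
  proof -
    have "fst x \<otimes>\<^bsub>A\<^esub> fst y \<otimes>\<^bsub>A\<^esub> f (snd x) (snd y) \<otimes>\<^bsub>A\<^esub> fst z \<otimes>\<^bsub>A\<^esub> f (snd x \<otimes> snd y) (snd z)
      = fst x \<otimes>\<^bsub>A\<^esub> fst y \<otimes>\<^bsub>A\<^esub> fst z \<otimes>\<^bsub>A\<^esub> (f (snd x) (snd y) \<otimes>\<^bsub>A\<^esub> f (snd x \<otimes> snd y) (snd z))"
      using x y z by (simp add: A.m_ac)
    also have "\<dots> = fst x \<otimes>\<^bsub>A\<^esub> (fst y \<otimes>\<^bsub>A\<^esub> fst z \<otimes>\<^bsub>A\<^esub> f (snd y) (snd z)) \<otimes>\<^bsub>A\<^esub> f (snd x) (snd y \<otimes> snd z)"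
      using x y z cocycle[of "snd x" "snd y" "snd z"] by (simp add: A.m_assoc)
    finally show ?thesis using x y z by (simp add: m_assoc)
  qed
  show "\<one>\<^bsub>extension\<^esub> \<otimes>\<^bsub>extension\<^esub> x = x"
  proof -
    have "inv\<^bsub>A\<^esub> f \<one> \<one> \<otimes>\<^bsub>A\<^esub> fst x = fst x \<otimes>\<^bsub>A\<^esub> inv\<^bsub>A\<^esub> f \<one> \<one>"
      using x by (intro A.m_comm) simp_all
    then have "inv\<^bsub>A\<^esub> f \<one> \<one> \<otimes>\<^bsub>A\<^esub> fst x \<otimes>\<^bsub>A\<^esub> f \<one> \<one> = fst x"
      using x by (simp only:) (simp add: A.m_assoc)
    then show ?thesis using x cocycle_one_left[of "snd x"] by simp
  qed
  show "\<exists>y\<in>carrier extension. y \<otimes>\<^bsub>extension\<^esub> x = \<one>\<^bsub>extension\<^esub>"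
  proof
    let ?b = "inv snd x"
    let ?w = "fst x \<otimes>\<^bsub>A\<^esub> f ?b (snd x)"
    let ?y = "(inv\<^bsub>A\<^esub> f \<one> \<one> \<otimes>\<^bsub>A\<^esub> inv\<^bsub>A\<^esub> ?w, ?b)"
    have w: "?w \<in> carrier A" "f \<one> \<one> \<in> carrier A" "fst x \<in> carrier A" "f ?b (snd x) \<in> carrier A" using x by simp_all
    then show "?y \<in> carrier extension" using x by simp
    have "inv\<^bsub>A\<^esub> f \<one> \<one> \<otimes>\<^bsub>A\<^esub> inv\<^bsub>A\<^esub> ?w \<otimes>\<^bsub>A\<^esub> fst x \<otimes>\<^bsub>A\<^esub> f ?b (snd x) = inv\<^bsub>A\<^esub> f \<one> \<one> \<otimes>\<^bsub>A\<^esub> (inv\<^bsub>A\<^esub> ?w \<otimes>\<^bsub>A\<^esub> ?w)"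
      using w A.m_assoc[of "inv\<^bsub>A\<^esub> f \<one> \<one>" "inv\<^bsub>A\<^esub> ?w" "fst x"]
        A.m_assoc[of "inv\<^bsub>A\<^esub> f \<one> \<one>" "inv\<^bsub>A\<^esub> ?w \<otimes>\<^bsub>A\<^esub> fst x" "f ?b (snd x)"]
        A.m_assoc[of "inv\<^bsub>A\<^esub> ?w" "fst x" "f ?b (snd x)"] by simp
    also have "\<dots> = inv\<^bsub>A\<^esub> f \<one> \<one>" using A.l_inv[OF w(1)] w(2) by simp
    finally show "?y \<otimes>\<^bsub>extension\<^esub> x = \<one>\<^bsub>extension\<^esub>" using x by simp
  qed
qed

lemma hom_snd_extension: "snd \<in> hom extension G"
  by (rule homI) simp_all

lemma snd_extension_surj: "snd ` carrier extension = carrier G"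
proof
  show "carrier G \<subseteq> snd ` carrier extension"
  proof
    fix x assume "x \<in> carrier G"
    then show "x \<in> snd ` carrier extension" by (intro image_eqI[of _ _ "(\<one>\<^bsub>A\<^esub>, x)"]) simp_all
  qed
qed auto

lemma extension_kernel_central:
  assumes "x \<in> carrier extension" "snd x = \<one>" "y \<in> carrier extension"
  shows "x \<otimes>\<^bsub>extension\<^esub> y = y \<otimes>\<^bsub>extension\<^esub> x"
  using assms cocycle_one_left[of "snd y"] cocycle_one_right[of "snd y"] by (simp add: A.m_comm)

text \<open>Multiplicativity of \<open>\<sigma>\<close> expresses the first coordinate of
  \<open>\<sigma> (a \<otimes> b)\<close> as the product of those of \<open>\<sigma> a\<close> and
  \<open>\<sigma> b\<close> with \<open>f a b\<close>; passing to inverses moves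
  \<open>f a b\<close> to the side required of a cochain \<open>h\<close>.\<close>

lemma coboundary_if_section:
  assumes s: "\<sigma> \<in> hom G extension" and sec: "\<And>a. a \<in> carrier G \<Longrightarrow> snd (\<sigma> a) = a"
  obtains h where "\<And>a. a \<in> carrier G \<Longrightarrow> h a \<in> carrier A"
    "\<And>a b. a \<in> carrier G \<Longrightarrow> b \<in> carrier G \<Longrightarrow> f a b \<otimes>\<^bsub>A\<^esub> h (a \<otimes> b) = h a \<otimes>\<^bsub>A\<^esub> h b"
proof (rule that[of "\<lambda>a. inv\<^bsub>A\<^esub> fst (\<sigma> a)"])
  have c: "fst (\<sigma> a) \<in> carrier A" if "a \<in> carrier G" for a
    using hom_in_carrier[OF s that] by simp
  then show "inv\<^bsub>A\<^esub> fst (\<sigma> a) \<in> carrier A" if "a \<in> carrier G" for a using that by simp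
  fix a b assume ab: "a \<in> carrier G" "b \<in> carrier G"
  have "fst (\<sigma> (a \<otimes> b)) = fst (\<sigma> a) \<otimes>\<^bsub>A\<^esub> fst (\<sigma> b) \<otimes>\<^bsub>A\<^esub> f a b"
    using hom_mult[OF s ab] sec ab by simp
  moreover have "f a b \<otimes>\<^bsub>A\<^esub> inv\<^bsub>A\<^esub> (p \<otimes>\<^bsub>A\<^esub> q \<otimes>\<^bsub>A\<^esub> f a b) = inv\<^bsub>A\<^esub> p \<otimes>\<^bsub>A\<^esub> inv\<^bsub>A\<^esub> q"
    if "p \<in> carrier A" "q \<in> carrier A" for p q
    using that ab A.inv_mult_group[of "p \<otimes>\<^bsub>A\<^esub> q" "f a b"] A.inv_mult[of p q]
      A.m_assoc[of "f a b" "inv\<^bsub>A\<^esub> f a b" "inv\<^bsub>A\<^esub> (p \<otimes>\<^bsub>A\<^esub> q)"] by simp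
  ultimately show "f a b \<otimes>\<^bsub>A\<^esub> inv\<^bsub>A\<^esub> fst (\<sigma> (a \<otimes> b)) = inv\<^bsub>A\<^esub> fst (\<sigma> a) \<otimes>\<^bsub>A\<^esub> inv\<^bsub>A\<^esub> fst (\<sigma> b)"
    using c[OF ab(1)] c[OF ab(2)] by simp
qed

end

text \<open>The universal 2-cocycle: its cocycle identity is the vanishing of the boundary of
  \<open>[a|b|c]\<close> in the quotient. The values lie in chains rather than cycles modulo
  boundaries because \<open>[a|b]\<close> is in general not a cycle.\<close>

definition (in group) tautological_cocycle :: "'a \<Rightarrow> 'a \<Rightarrow> ('a list \<Rightarrow>\<^sub>0 int) set" where
  "tautological_cocycle a b = bar_boundaries #>\<^bsub>bar_chains G 2\<^esub> frag_of [a, b]"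

lemma (in group) group_cocycle_tautological:
  "group_cocycle G (bar_chains G 2 Mod bar_boundaries) tautological_cocycle"
proof -
  interpret C: comm_group "bar_chains G 2" by (rule comm_group_bar_chains)
  interpret B: normal bar_boundaries "bar_chains G 2" using C.subgroup_imp_normal[OF subgroup_bar_boundaries] .
  let ?A = "bar_chains G 2 Mod bar_boundaries"
  have "group_cocycle_axioms G ?A tautological_cocycle"
  proof
    show "tautological_cocycle a b \<in> carrier ?A"
      if "a \<in> carrier G" "b \<in> carrier G" for a b
      using that unfolding carrier_FactGroup tautological_cocycle_def by (intro imageI) simp
    fix a b c assume abc: "a \<in> carrier G" "b \<in> carrier G" "c \<in> carrier G"
    let ?u = "frag_of [b, c] + frag_of [a, b \<otimes> c]" and ?v = "frag_of [a, b] + frag_of [a \<otimes> b, c]"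
    have ch: "frag_of [b, c] \<in> carrier (bar_chains G 2)" "frag_of [a, b \<otimes> c] \<in> carrier (bar_chains G 2)"
      "frag_of [a, b] \<in> carrier (bar_chains G 2)" "frag_of [a \<otimes> b, c] \<in> carrier (bar_chains G 2)"
      using abc by simp_all
    have uv: "?u \<in> carrier (bar_chains G 2)" "?v \<in> carrier (bar_chains G 2)"
      using bar_chains_closed(1)[OF ch(1,2)] bar_chains_closed(1)[OF ch(3,4)] by simp_all
    have "?u - ?v = bar_boundary G 3 (frag_of [a, b, c])" by (simp add: bar_boundary_3_of)
    then have "?u - ?v \<in> bar_boundaries" unfolding bar_boundaries_def using abc by simp
    then have "bar_boundaries #>\<^bsub>bar_chains G 2\<^esub> ?u = bar_boundaries #>\<^bsub>bar_chains G 2\<^esub> ?v"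
      using C.rcos_eq_iff[OF subgroup_bar_boundaries uv] uv(2) by (simp only: bar_chains_inv bar_chains_mult) (simp add: algebra_simps)
    then show "tautological_cocycle a b \<otimes>\<^bsub>?A\<^esub> tautological_cocycle (a \<otimes> b) c =
        tautological_cocycle b c \<otimes>\<^bsub>?A\<^esub> tautological_cocycle a (b \<otimes> c)"
      using B.rcos_sum[OF ch(1,2)] B.rcos_sum[OF ch(3,4)] by (simp add: tautological_cocycle_def)
  qed
  moreover have "comm_group ?A" using C.abelian_FactGroup[OF subgroup_bar_boundaries] .
  ultimately show ?thesis using is_group by (simp add: group_cocycle_def)
qed

text \<open>A section makes the tautological cocycle a coboundary, so the projection of 2-chains
  modulo boundaries kills every cycle.\<close>

lemma (in group) trivial_homology_if_extensions_split:
  assumes s: "\<sigma> \<in> hom G (group_cocycle.extension G (bar_chains G 2 Mod bar_boundaries) tautological_cocycle)"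
    and sec: "\<And>a. a \<in> carrier G \<Longrightarrow> snd (\<sigma> a) = a"
  shows "trivial_group (group_homology G 2)"
proof -
  interpret C: comm_group "bar_chains G 2" by (rule comm_group_bar_chains)
  interpret B: normal bar_boundaries "bar_chains G 2" using C.subgroup_imp_normal[OF subgroup_bar_boundaries] .
  let ?A = "bar_chains G 2 Mod bar_boundaries"
  obtain h where h: "\<And>a. a \<in> carrier G \<Longrightarrow> h a \<in> carrier ?A"
    "\<And>a b. a \<in> carrier G \<Longrightarrow> b \<in> carrier G \<Longrightarrow>
       tautological_cocycle a b \<otimes>\<^bsub>?A\<^esub> h (a \<otimes> b) = h a \<otimes>\<^bsub>?A\<^esub> h b"
    by (rule group_cocycle.coboundary_if_section[OF group_cocycle_tautological s sec]) blast+
  have "bar_cycles \<subseteq> bar_boundaries"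
  proof
    fix x assume x: "x \<in> bar_cycles"
    then have xc: "x \<in> carrier (bar_chains G 2)" by (simp add: bar_cycles_def)
    have "bar_boundaries #>\<^bsub>bar_chains G 2\<^esub> x = bar_boundaries"
      using cycle_in_kernel_if_coboundary[OF C.abelian_FactGroup[OF subgroup_bar_boundaries] B.r_coset_hom_Mod h(1) h(2)[unfolded tautological_cocycle_def] x]
      by simp
    then show "x \<in> bar_boundaries" using C.coset_join1[OF _ xc subgroup_bar_boundaries] by blast
  qed
  then show ?thesis by (simp add: trivial_group_homology_2_iff)
qed

section \<open>Free groups\<close>

lemma words_simps [simp]:
  "[] \<in> words X" "(a # w) \<in> words X \<longleftrightarrow> fst a \<in> X \<and> w \<in> words X"
  "(v @ w) \<in> words X \<longleftrightarrow> v \<in> words X \<and> w \<in> words X"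
  by (auto simp: words_def mem_Times_iff)

lemma free_eq_words: "free_eq X v w \<Longrightarrow> v \<in> words X \<and> w \<in> words X"
  by (induction rule: free_eq.induct) auto

lemma free_eq_append_left:
  assumes "free_eq X v w" "u \<in> words X" shows "free_eq X (u @ v) (u @ w)"
  using assms(1)
proof (induction rule: free_eq.induct)
  case (refl w)
  then show ?case using assms(2) by (intro free_eq.refl) simp
next
  case (sym v w)
  show ?case by (rule free_eq.sym[OF sym.IH])
next
  case (trans v w z)
  show ?case by (rule free_eq.trans[OF trans.IH])
next
  case (cancel v w x b)
  then show ?case using free_eq.cancel[of "u @ v" X w x b] assms(2) by simp
qed

lemma free_eq_append_right:
  assumes "free_eq X v w" "u \<in> words X" shows "free_eq X (v @ u) (w @ u)"
  using assms(1)
proof (induction rule: free_eq.induct)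
  case (refl w)
  then show ?case using assms(2) by (intro free_eq.refl) simp
next
  case (sym v w)
  show ?case by (rule free_eq.sym[OF sym.IH])
next
  case (trans v w z)
  show ?case by (rule free_eq.trans[OF trans.IH])
next
  case (cancel v w x b)
  then show ?case using free_eq.cancel[of v X "w @ u" x b] assms(2) by simp
qed

lemma free_eq_append:
  assumes "free_eq X v v'" "free_eq X w w'" shows "free_eq X (v @ w) (v' @ w')"
  using free_eq.trans[OF free_eq_append_right[OF assms(1)] free_eq_append_left[OF assms(2)]]
    free_eq_words[OF assms(1)] free_eq_words[OF assms(2)] by blast

definition word_class :: "'x set \<Rightarrow> ('x \<times> bool) list \<Rightarrow> ('x \<times> bool) list set" where
  "word_class X w = {v. free_eq X w v}"

lemma word_class_eqI: "free_eq X v w \<Longrightarrow> word_class X v = word_class X w"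
  unfolding word_class_def using free_eq.trans[of X] free_eq.sym[of X] by blast

lemma carrier_free_group: "carrier (free_group X) = word_class X ` words X"
  by (auto simp: free_group_def word_class_def quotient_def)

lemma free_group_cases:
  assumes "A \<in> carrier (free_group X)" obtains w where "w \<in> words X" "A = word_class X w"
  using assms unfolding carrier_free_group by blast

lemma word_class_closed: "w \<in> words X \<Longrightarrow> word_class X w \<in> carrier (free_group X)"
  by (simp add: carrier_free_group)

lemma one_free_group: "\<one>\<^bsub>free_group X\<^esub> = word_class X []"
  by (simp add: free_group_def word_class_def)

lemma mult_free_group:
  assumes "u \<in> words X" "v \<in> words X"
  shows "word_class X u \<otimes>\<^bsub>free_group X\<^esub> word_class X v = word_class X (u @ v)"
proof -
  have "(\<exists>u'. free_eq X u u' \<and> (\<exists>v'. free_eq X v v' \<and> free_eq X (u' @ v') w)) \<longleftrightarrow> free_eq X (u @ v) w" for w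
    using free_eq_append[of X u _ v] free_eq.trans[of X "u @ v"] free_eq.refl[OF assms(1)] free_eq.refl[OF assms(2)]
    by blast
  then show ?thesis by (simp add: free_group_def word_class_def Bex_def)
qed

definition inv_word :: "('x \<times> bool) list \<Rightarrow> ('x \<times> bool) list" where
  "inv_word w = rev (map (\<lambda>(x, b). (x, \<not> b)) w)"

lemma inv_word_closed: "w \<in> words X \<Longrightarrow> inv_word w \<in> words X"
  by (induction w) (auto simp: inv_word_def)

lemma inv_word_cancel: "w \<in> words X \<Longrightarrow> free_eq X (inv_word w @ w) []"
proof (induction w)
  case Nil
  then show ?case by (simp add: inv_word_def free_eq.refl)
next
  case (Cons a w)
  obtain x b where a: "a = (x, b)" by (cases a)
  have "free_eq X (inv_word w @ [(x, \<not> b), (x, \<not> \<not> b)] @ w) (inv_word w @ w)"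
    using Cons.prems a inv_word_closed by (intro free_eq.cancel) auto
  moreover have "free_eq X (inv_word w @ w) []" using Cons by simp
  ultimately have "free_eq X (inv_word w @ [(x, \<not> b), (x, \<not> \<not> b)] @ w) []" by (rule free_eq.trans)
  then show ?case by (simp add: a inv_word_def)
qed

lemma group_free_group: "group (free_group X)"
proof (rule groupI)
  show "\<one>\<^bsub>free_group X\<^esub> \<in> carrier (free_group X)" by (simp add: one_free_group word_class_closed)
  fix A B assume A: "A \<in> carrier (free_group X)" and B: "B \<in> carrier (free_group X)"
  obtain u where u: "u \<in> words X" "A = word_class X u" using A by (rule free_group_cases)
  obtain v where v: "v \<in> words X" "B = word_class X v" using B by (rule free_group_cases)
  show "A \<otimes>\<^bsub>free_group X\<^esub> B \<in> carrier (free_group X)" using u v by (simp add: mult_free_group word_class_closed)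
  show "A \<otimes>\<^bsub>free_group X\<^esub> B \<otimes>\<^bsub>free_group X\<^esub> C = A \<otimes>\<^bsub>free_group X\<^esub> (B \<otimes>\<^bsub>free_group X\<^esub> C)"
    if C: "C \<in> carrier (free_group X)" for C
  proof -
    obtain w where "w \<in> words X" "C = word_class X w" using C by (rule free_group_cases)
    then show ?thesis using u v by (simp add: mult_free_group)
  qed
  show "\<one>\<^bsub>free_group X\<^esub> \<otimes>\<^bsub>free_group X\<^esub> A = A" using u by (simp add: one_free_group mult_free_group)
  show "\<exists>C\<in>carrier (free_group X). C \<otimes>\<^bsub>free_group X\<^esub> A = \<one>\<^bsub>free_group X\<^esub>"
    using u word_class_eqI[OF inv_word_cancel[OF u(1)]]
    by (intro bexI[of _ "word_class X (inv_word u)"])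
      (simp_all add: one_free_group mult_free_group inv_word_closed word_class_closed)
qed

lemma (in group) free_group_universal:
  assumes \<phi>: "\<And>x. x \<in> X \<Longrightarrow> \<phi> x \<in> carrier G"
  obtains \<theta> where "\<theta> \<in> hom (free_group X) G" "\<And>x. x \<in> X \<Longrightarrow> \<theta> (word_class X [(x, True)]) = \<phi> x"
proof -
  define ev where "ev w = foldr (\<lambda>(x, b) y. (if b then \<phi> x else inv \<phi> x) \<otimes> y) w \<one>" for w
  have ev_Nil: "ev [] = \<one>" and ev_Cons: "ev ((x, b) # w) = (if b then \<phi> x else inv \<phi> x) \<otimes> ev w" for x b w
    by (simp_all add: ev_def)
  have ev_closed: "ev w \<in> carrier G" if "w \<in> words X" for w
    using that
  proof (induction w)
    case (Cons a w)
    then show ?case using \<phi>[of "fst a"] by (cases a) (simp add: ev_Cons)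
  qed (simp add: ev_Nil)
  have ev_append: "ev (v @ w) = ev v \<otimes> ev w" if "v \<in> words X" "w \<in> words X" for v w
    using that(1)
  proof (induction v)
    case Nil
    then show ?case using ev_closed[OF that(2)] by (simp add: ev_Nil)
  next
    case (Cons a v)
    then show ?case using \<phi>[of "fst a"] ev_closed[OF that(2)] ev_closed[of v]
      by (cases a) (simp add: ev_Cons m_assoc)
  qed
  have ev_eq: "ev v = ev w" if "free_eq X v w" for v w
    using that
  proof (induction rule: free_eq.induct)
    case (cancel u v x b)
    have x: "\<phi> x \<in> carrier G" using \<phi> cancel by simp
    have "ev [(x, b), (x, \<not> b)] = \<one>" using x by (cases b) (simp_all add: ev_Cons ev_Nil)
    then have "ev ([(x, b), (x, \<not> b)] @ v) = ev v"
      using ev_append[of "[(x, b), (x, \<not> b)]" v] cancel ev_closed by simp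
    then show ?case using ev_append[of u "[(x, b), (x, \<not> b)] @ v"] ev_append[of u v] cancel by simp
  qed simp_all
  \<comment> \<open>Evaluation is constant on classes by \<open>ev_eq\<close>, so the choice of
    representative does not matter.\<close>
  define \<theta> where "\<theta> A = ev (SOME w. w \<in> A)" for A
  have \<theta>: "\<theta> (word_class X w) = ev w" if "w \<in> words X" for w
  proof -
    have "w \<in> word_class X w" using free_eq.refl[OF that] by (simp add: word_class_def)
    then have "(SOME v. v \<in> word_class X w) \<in> word_class X w" by (rule someI)
    then show ?thesis unfolding \<theta>_def using ev_eq[of w] by (simp add: word_class_def)
  qed
  show thesis
  proof (rule that[of \<theta>])
    show "\<theta> \<in> hom (free_group X) G"
    proof (rule homI)
      fix A B assume A: "A \<in> carrier (free_group X)" and B: "B \<in> carrier (free_group X)"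
      obtain u where u: "u \<in> words X" "A = word_class X u" using A by (rule free_group_cases)
      obtain v where v: "v \<in> words X" "B = word_class X v" using B by (rule free_group_cases)
      show "\<theta> A \<in> carrier G" using u by (simp add: \<theta> ev_closed)
      show "\<theta> (A \<otimes>\<^bsub>free_group X\<^esub> B) = \<theta> A \<otimes> \<theta> B" using u v by (simp add: mult_free_group \<theta> ev_append)
    qed
    show "\<theta> (word_class X [(x, True)]) = \<phi> x" if "x \<in> X" for x
      using that \<phi> by (simp add: \<theta> ev_Cons ev_Nil)
  qed
qed

lemma generate_free_group:
  "generate (free_group X) ((\<lambda>x. word_class X [(x, True)]) ` X) = carrier (free_group X)"
proof
  interpret group "free_group X" by (rule group_free_group)
  let ?S = "(\<lambda>x. word_class X [(x, True)]) ` X"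
  have "?S \<subseteq> carrier (free_group X)" by (auto intro!: word_class_closed)
  then show "generate (free_group X) ?S \<subseteq> carrier (free_group X)" by (rule generate_incl)
  have "word_class X w \<in> generate (free_group X) ?S" if "w \<in> words X" for w
    using that
  proof (induction w)
    case Nil
    then show ?case using generate.one[of "free_group X" ?S] by (simp add: one_free_group)
  next
    case (Cons a w)
    obtain x b where a: "a = (x, b)" by (cases a)
    have x: "x \<in> X" "w \<in> words X" using Cons.prems a by simp_all
    have "free_eq X [(x, False), (x, True)] []"
      using free_eq.cancel[of "[]" X "[]" x False] x by simp
    then have "word_class X [(x, False)] \<otimes>\<^bsub>free_group X\<^esub> word_class X [(x, True)] = \<one>\<^bsub>free_group X\<^esub>"
      using word_class_eqI[of X "[(x, False), (x, True)]" "[]"] x by (simp add: mult_free_group one_free_group)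
    then have "inv\<^bsub>free_group X\<^esub> (word_class X [(x, True)]) = word_class X [(x, False)]"
      using x by (intro inv_equality word_class_closed) simp_all
    then have "word_class X [(x, b)] \<in> generate (free_group X) ?S"
      using generate.incl[of "word_class X [(x, True)]" ?S] generate.inv[of "word_class X [(x, True)]" ?S "free_group X"] x
      by (cases b) simp_all
    then have "word_class X [(x, b)] \<otimes>\<^bsub>free_group X\<^esub> word_class X w \<in> generate (free_group X) ?S"
      using Cons.IH x(2) by (intro generate.eng) simp_all
    then show ?case using x by (simp add: a mult_free_group)
  qed
  then show "carrier (free_group X) \<subseteq> generate (free_group X) ?S" by (auto simp: carrier_free_group)
qed

lemma finitely_generated_free_group: "finite X \<Longrightarrow> finitely_generated (free_group X)"
  unfolding finitely_generated_def
  using group_free_group[of X] generate_free_group[of X]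
  by (intro conjI exI[of _ "(\<lambda>x. word_class X [(x, True)]) ` X"]) (auto intro!: word_class_closed)

lemma (in group) subgroup_equalizer:
  assumes "group H" "\<phi> \<in> hom G H" "\<psi> \<in> hom G H"
  shows "subgroup {x \<in> carrier G. \<phi> x = \<psi> x} G"
proof -
  interpret \<phi>: group_hom G H \<phi> using assms is_group by (simp add: group_hom_def group_hom_axioms_def)
  interpret \<psi>: group_hom G H \<psi> using assms is_group by (simp add: group_hom_def group_hom_axioms_def)
  show ?thesis
  proof (rule subgroupI)
    have "\<one> \<in> {x \<in> carrier G. \<phi> x = \<psi> x}" by simp
    then show "{x \<in> carrier G. \<phi> x = \<psi> x} \<noteq> {}" by blast
  qed auto
qed

lemma free_group_hom_eq:
  assumes "group H" "\<phi> \<in> hom (free_group X) H" "\<psi> \<in> hom (free_group X) H"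
    and "\<And>x. x \<in> X \<Longrightarrow> \<phi> (word_class X [(x, True)]) = \<psi> (word_class X [(x, True)])"
    and "A \<in> carrier (free_group X)"
  shows "\<phi> A = \<psi> A"
proof -
  let ?T = "{x \<in> carrier (free_group X). \<phi> x = \<psi> x}"
  have "(\<lambda>x. word_class X [(x, True)]) ` X \<subseteq> ?T" using assms(4) by (auto intro!: word_class_closed)
  then have "generate (free_group X) ((\<lambda>x. word_class X [(x, True)]) ` X) \<subseteq> ?T"
    by (rule group.generate_subgroup_incl[OF group_free_group _ group.subgroup_equalizer[OF group_free_group assms(1-3)]])
  then show ?thesis using assms(5) unfolding generate_free_group by blast
qed

section \<open>Finite presentations\<close>

lemma (in group) normal_closure_normal:
  assumes "R \<subseteq> carrier G" shows "normal_closure G R \<lhd> G"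
  unfolding normal_closure_def
proof (rule normal_generateI)
  show "{g \<otimes> r \<otimes> inv g |g r. g \<in> carrier G \<and> r \<in> R} \<subseteq> carrier G" using assms by auto
  fix h k assume "h \<in> {g \<otimes> r \<otimes> inv g |g r. g \<in> carrier G \<and> r \<in> R}" and k: "k \<in> carrier G"
  then obtain g r where h: "h = g \<otimes> r \<otimes> inv g" "g \<in> carrier G" "r \<in> R" by blast
  have "r \<in> carrier G" using h(3) assms by (rule subsetD[rotated])
  then have "k \<otimes> h \<otimes> inv k = (k \<otimes> g) \<otimes> r \<otimes> inv (k \<otimes> g)"
    using h k by (simp add: m_assoc inv_mult_group)
  moreover have "k \<otimes> g \<in> carrier G" using k h by simp
  ultimately show "k \<otimes> h \<otimes> inv k \<in> {g \<otimes> r \<otimes> inv g |g r. g \<in> carrier G \<and> r \<in> R}" using h(3) by blast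
qed

text \<open>The form of a presentation that can be lifted through an extension: an epimorphism
  \<open>q\<close> from a free group whose kernel is generated by conjugates of finitely many
  relators.\<close>

lemma finitely_presentedE:
  assumes "finitely_presented Q"
  obtains X :: "nat set" and R q where "finite X" "finite R" "R \<subseteq> carrier (free_group X)"
    "q \<in> hom (free_group X) Q" "q ` carrier (free_group X) = carrier Q"
    "{x \<in> carrier (free_group X). q x = \<one>\<^bsub>Q\<^esub>} = normal_closure (free_group X) R"
proof -
  obtain X :: "nat set" and R where Q: "group Q" and XR: "finite X" "finite R" "R \<subseteq> carrier (free_group X)"
    and iso: "Q \<cong> free_group X Mod normal_closure (free_group X) R"
    using assms unfolding finitely_presented_def by blast
  let ?F = "free_group X" and ?N = "normal_closure (free_group X) R"
  interpret F: group ?F by (rule group_free_group)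
  interpret N: normal ?N ?F by (rule F.normal_closure_normal[OF XR(3)])
  obtain k where "k \<in> iso Q (?F Mod ?N)" using iso by (auto simp: is_iso_def)
  then have "inv_into (carrier Q) k \<in> iso (?F Mod ?N) Q" by (rule group.iso_set_sym[OF Q])
  then obtain h where h: "h \<in> hom (?F Mod ?N) Q" "bij_betw h (carrier (?F Mod ?N)) (carrier Q)"
    by (auto simp: iso_def)
  interpret h: group_hom "?F Mod ?N" Q h
    using h(1) Q N.factorgroup_is_group by (simp add: group_hom_def group_hom_axioms_def)
  let ?q = "h \<circ> (\<lambda>x. ?N #>\<^bsub>?F\<^esub> x)"
  show thesis
  proof (rule that[OF XR, of ?q])
    show "?q \<in> hom ?F Q" using hom_compose[OF N.r_coset_hom_Mod h(1)] .
    show "?q ` carrier ?F = carrier Q"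
      using h(2) by (simp add: bij_betw_def carrier_FactGroup image_image)
    have "?q x = \<one>\<^bsub>Q\<^esub> \<longleftrightarrow> x \<in> ?N" if x: "x \<in> carrier ?F" for x
    proof -
      have c: "?N #>\<^bsub>?F\<^esub> x \<in> carrier (?F Mod ?N)" using x by (auto simp: carrier_FactGroup)
      have "h (?N #>\<^bsub>?F\<^esub> x) = \<one>\<^bsub>Q\<^esub> \<longleftrightarrow> ?N #>\<^bsub>?F\<^esub> x = \<one>\<^bsub>?F Mod ?N\<^esub>"
        using h.inj_on_one_iff h(2) c h.hom_one by (auto simp: bij_betw_def)
      also have "\<dots> \<longleftrightarrow> x \<in> ?N"
        using F.coset_join1[OF _ x N.subgroup_axioms] F.coset_join2[OF x N.subgroup_axioms] by auto
      finally show ?thesis by simp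
    qed
    then show "{x \<in> carrier ?F. ?q x = \<one>\<^bsub>Q\<^esub>} = ?N" using N.subset by blast
  qed
qed

lemma finitely_presented_imp_finitely_generated:
  assumes "finitely_presented Q" shows "finitely_generated Q"
proof -
  obtain X :: "nat set" and R q where "finite X" "q \<in> hom (free_group X) Q" "q ` carrier (free_group X) = carrier Q"
    using assms by (rule finitely_presentedE)
  moreover have "group Q" using assms by (simp add: finitely_presented_def)
  ultimately show ?thesis using finitely_generated_image[OF finitely_generated_free_group] by blast
qed

text \<open>
  Lift the free group of a finite presentation to \<open>E\<close>. Conjugation acts trivially on the central
  kernel, so the images of the finitely many relators generate the kernel inside the image of the lift.
\<close>

lemma central_extension_finitely_generated_subgroup:
  assumes Q: "finitely_presented Q" and E: "group E" and \<pi>: "\<pi> \<in> hom E Q" "\<pi> ` carrier E = carrier Q"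
    and central: "\<And>x y. x \<in> carrier E \<Longrightarrow> \<pi> x = \<one>\<^bsub>Q\<^esub> \<Longrightarrow> y \<in> carrier E \<Longrightarrow> x \<otimes>\<^bsub>E\<^esub> y = y \<otimes>\<^bsub>E\<^esub> x"
  obtains G S where "subgroup G E" "finitely_generated (E\<lparr>carrier := G\<rparr>)" "\<pi> ` G = carrier Q"
    "finite S" "S \<subseteq> G" "{x \<in> G. \<pi> x = \<one>\<^bsub>Q\<^esub>} = generate E S"
proof -
  obtain X :: "nat set" and R q where XR: "finite X" "finite R" "R \<subseteq> carrier (free_group X)"
    and q: "q \<in> hom (free_group X) Q" "q ` carrier (free_group X) = carrier Q"
    and ker: "{x \<in> carrier (free_group X). q x = \<one>\<^bsub>Q\<^esub>} = normal_closure (free_group X) R"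
    using Q by (rule finitely_presentedE)
  let ?F = "free_group X"
  interpret F: group ?F by (rule group_free_group)
  interpret E: group E by fact
  have gQ: "group Q" using Q by (simp add: finitely_presented_def)
  \<comment> \<open>Each free generator is sent to some preimage under \<open>\<pi>\<close> of its
    image in \<open>Q\<close>; freeness extends this choice to a lift \<open>\<theta>\<close> of
    \<open>q\<close>.\<close>
  define \<phi> where "\<phi> x = inv_into (carrier E) \<pi> (q (word_class X [(x, True)]))" for x
  have lift: "q (word_class X [(x, True)]) \<in> \<pi> ` carrier E" if "x \<in> X" for x
    using that \<pi>(2) hom_in_carrier[OF q(1) word_class_closed[of "[(x, True)]" X]] by simp
  have "\<phi> x \<in> carrier E" if "x \<in> X" for x unfolding \<phi>_def using lift[OF that] by (rule inv_into_into)
  then obtain \<theta> where \<theta>: "\<theta> \<in> hom ?F E" "\<And>x. x \<in> X \<Longrightarrow> \<theta> (word_class X [(x, True)]) = \<phi> x"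
    using E.free_group_universal[of X \<phi>] by blast
  interpret \<theta>: group_hom ?F E \<theta> using \<theta>(1) by (simp add: group_hom_def group_hom_axioms_def F.is_group E.is_group)
  have \<pi>\<theta>: "\<pi> (\<theta> x) = q x" if "x \<in> carrier ?F" for x
    using free_group_hom_eq[OF gQ hom_compose[OF \<theta>(1) \<pi>(1)] q(1) _ that] \<theta>(2) f_inv_into_f[OF lift]
    by (simp add: \<phi>_def)
  let ?G = "\<theta> ` carrier ?F"
  have sub: "subgroup ?G E" by (rule \<theta>.img_is_subgroup)
  have "\<theta> \<in> hom ?F (E\<lparr>carrier := ?G\<rparr>)" by (rule homI) simp_all
  then have fg: "finitely_generated (E\<lparr>carrier := ?G\<rparr>)"
    using finitely_generated_image[OF finitely_generated_free_group[OF XR(1)] E.subgroup_imp_group[OF sub]] by simp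
  let ?C = "{g \<otimes>\<^bsub>?F\<^esub> r \<otimes>\<^bsub>?F\<^esub> inv\<^bsub>?F\<^esub> g |g r. g \<in> carrier ?F \<and> r \<in> R}"
  have C: "?C \<subseteq> carrier ?F" using XR(3) by auto
  have \<theta>C: "\<theta> (g \<otimes>\<^bsub>?F\<^esub> r \<otimes>\<^bsub>?F\<^esub> inv\<^bsub>?F\<^esub> g) = \<theta> r" if "g \<in> carrier ?F" "r \<in> R" for g r
  proof -
    have r: "r \<in> carrier ?F" using that(2) XR(3) by (rule subsetD[rotated])
    have "r = \<one>\<^bsub>?F\<^esub> \<otimes>\<^bsub>?F\<^esub> r \<otimes>\<^bsub>?F\<^esub> inv\<^bsub>?F\<^esub> \<one>\<^bsub>?F\<^esub>" using r by simp
    then have "r \<in> ?C" using that(2) F.one_closed by blast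
    then have "r \<in> normal_closure ?F R" unfolding normal_closure_def by (rule generate.incl)
    then have "q r = \<one>\<^bsub>Q\<^esub>" using ker by blast
    then have "\<theta> r \<otimes>\<^bsub>E\<^esub> \<theta> g = \<theta> g \<otimes>\<^bsub>E\<^esub> \<theta> r" using central r that(1) \<pi>\<theta>[OF r] by simp
    then have "\<theta> (g \<otimes>\<^bsub>?F\<^esub> r \<otimes>\<^bsub>?F\<^esub> inv\<^bsub>?F\<^esub> g) = \<theta> r \<otimes>\<^bsub>E\<^esub> \<theta> g \<otimes>\<^bsub>E\<^esub> inv\<^bsub>E\<^esub> \<theta> g"
      using r that(1) by simp
    also have "\<dots> = \<theta> r" using r that(1) by (simp add: E.m_assoc)
    finally show ?thesis .
  qed
  have "\<theta> ` ?C = \<theta> ` R"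
  proof
    show "\<theta> ` ?C \<subseteq> \<theta> ` R" using \<theta>C by auto
    show "\<theta> ` R \<subseteq> \<theta> ` ?C"
    proof
      fix y assume "y \<in> \<theta> ` R"
      then obtain r where r: "y = \<theta> r" "r \<in> R" by (rule imageE)
      have "y = \<theta> (\<one>\<^bsub>?F\<^esub> \<otimes>\<^bsub>?F\<^esub> r \<otimes>\<^bsub>?F\<^esub> inv\<^bsub>?F\<^esub> \<one>\<^bsub>?F\<^esub>)" using \<theta>C[OF F.one_closed r(2)] r(1) by simp
      then show "y \<in> \<theta> ` ?C" using r(2) F.one_closed by blast
    qed
  qed
  then have "\<theta> ` normal_closure ?F R = generate E (\<theta> ` R)"
    unfolding normal_closure_def using \<theta>.generate_img[OF C] by simp
  moreover have "{x \<in> ?G. \<pi> x = \<one>\<^bsub>Q\<^esub>} = \<theta> ` {x \<in> carrier ?F. q x = \<one>\<^bsub>Q\<^esub>}"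
  proof
    show "{x \<in> ?G. \<pi> x = \<one>\<^bsub>Q\<^esub>} \<subseteq> \<theta> ` {x \<in> carrier ?F. q x = \<one>\<^bsub>Q\<^esub>}"
      using \<pi>\<theta> by auto
    show "\<theta> ` {x \<in> carrier ?F. q x = \<one>\<^bsub>Q\<^esub>} \<subseteq> {x \<in> ?G. \<pi> x = \<one>\<^bsub>Q\<^esub>}"
      using \<pi>\<theta> by auto
  qed
  ultimately have "{x \<in> ?G. \<pi> x = \<one>\<^bsub>Q\<^esub>} = generate E (\<theta> ` R)" using ker by simp
  moreover have "\<pi> ` ?G = carrier Q"
    unfolding q(2)[symmetric] image_image using \<pi>\<theta> by (intro image_cong) simp_all
  moreover have "\<theta> ` R \<subseteq> ?G" using XR(3) by (rule image_mono)
  ultimately show thesis using that[OF sub fg, of "\<theta> ` R"] XR(2) by blast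
qed

section \<open>Extensions with finite kernel\<close>

text \<open>The centralizer is the kernel of the conjugation action on the finite set
  \<open>N\<close>, so the index is bounded by the number of self-maps of \<open>N\<close>.\<close>

lemma (in group) finite_index_centralizer:
  assumes "N \<lhd> G" "finite N"
  defines "C \<equiv> {x \<in> carrier G. \<forall>n\<in>N. x \<otimes> n = n \<otimes> x}"
  shows "subgroup C G" "finite (rcosets C)"
proof -
  interpret N: normal N G by fact
  have N_closed: "n \<in> carrier G" if "n \<in> N" for n using that by (rule N.mem_carrier)
  show sub: "subgroup C G"
  proof (rule subgroupI)
    show "C \<subseteq> carrier G" by (auto simp: C_def)
    have "\<one> \<in> C" using N_closed by (simp add: C_def)
    then show "C \<noteq> {}" by blast
    show "inv x \<in> C" if x: "x \<in> C" for x
    proof -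
      have xc: "x \<in> carrier G" using x by (simp add: C_def)
      have "inv x \<otimes> n = n \<otimes> inv x" if n: "n \<in> N" for n
      proof -
        have "inv x \<otimes> (n \<otimes> x) = inv x \<otimes> (x \<otimes> n)" using x n by (simp add: C_def)
        also have "\<dots> = n" using xc N_closed[OF n] by (simp flip: m_assoc)
        finally have "inv x \<otimes> (n \<otimes> x) \<otimes> inv x = n \<otimes> inv x" by simp
        then show ?thesis using xc N_closed[OF n] by (simp add: m_assoc)
      qed
      then show ?thesis using xc by (simp add: C_def)
    qed
    show "x \<otimes> y \<in> C" if x: "x \<in> C" and y: "y \<in> C" for x y
    proof -
      have xc: "x \<in> carrier G" "y \<in> carrier G" using x y by (simp_all add: C_def)
      have "x \<otimes> y \<otimes> n = n \<otimes> (x \<otimes> y)" if n: "n \<in> N" for n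
      proof -
        have "x \<otimes> y \<otimes> n = x \<otimes> (n \<otimes> y)" using y n xc N_closed[OF n] by (simp add: C_def m_assoc)
        also have "\<dots> = n \<otimes> x \<otimes> y" using x n xc N_closed[OF n] by (simp add: C_def flip: m_assoc)
        finally show ?thesis using xc N_closed[OF n] by (simp add: m_assoc)
      qed
      then show ?thesis using xc by (simp add: C_def)
    qed
  qed
  show "finite (rcosets C)"
  proof (rule finite_rcosetsI[where k = "\<lambda>x. \<lambda>n\<in>N. x \<otimes> n \<otimes> inv x", OF sub])
    have "(\<lambda>x. \<lambda>n\<in>N. x \<otimes> n \<otimes> inv x) ` carrier G \<subseteq> N \<rightarrow>\<^sub>E N"
      using N.inv_op_closed2 by auto
    then show "finite ((\<lambda>x. \<lambda>n\<in>N. x \<otimes> n \<otimes> inv x) ` carrier G)"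
      by (rule finite_subset) (simp add: finite_PiE assms(2))
    fix x y assume xy: "x \<in> carrier G" "y \<in> carrier G"
      and eq: "(\<lambda>n\<in>N. x \<otimes> n \<otimes> inv x) = (\<lambda>n\<in>N. y \<otimes> n \<otimes> inv y)"
    have "x \<otimes> inv y \<otimes> n = n \<otimes> (x \<otimes> inv y)" if n: "n \<in> N" for n
    proof -
      \<comment> \<open>Conjugation by \<open>y\<close> takes \<open>?m\<close> to \<open>n\<close>,
        and equality of the labels says that conjugation by \<open>x\<close> does the same.\<close>
      let ?m = "inv y \<otimes> n \<otimes> y"
      have m: "?m \<in> N" using N.inv_op_closed1[OF xy(2) n] .
      have "x \<otimes> ?m \<otimes> inv x = y \<otimes> ?m \<otimes> inv y" using fun_cong[OF eq, of ?m] m by simp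
      also have "\<dots> = (y \<otimes> inv y) \<otimes> n \<otimes> (y \<otimes> inv y)"
        using xy N_closed[OF n] by (simp only: m_assoc m_closed inv_closed)
      also have "\<dots> = n" using xy N_closed[OF n] by simp
      finally have "x \<otimes> ?m \<otimes> inv x \<otimes> (x \<otimes> inv y) = n \<otimes> (x \<otimes> inv y)" by simp
      moreover have "x \<otimes> ?m \<otimes> inv x \<otimes> (x \<otimes> inv y) = x \<otimes> inv y \<otimes> n \<otimes> y \<otimes> (inv x \<otimes> x) \<otimes> inv y"
        using xy N_closed[OF n] by (simp only: m_assoc m_closed inv_closed)
      moreover have "\<dots> = x \<otimes> inv y \<otimes> n" using xy N_closed[OF n] by (simp add: m_assoc)
      ultimately show ?thesis by simp
    qed
    then show "x \<otimes> inv y \<in> C" using xy by (simp add: C_def)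
  qed
qed

text \<open>Condition (B) together with finite generation. Superperfect means that
  \<open>H_1\<close> and \<open>H_2\<close> vanish; the vanishing of \<open>H_1\<close> follows from
  \<open>no_finite_index\<close>.\<close>

locale finite_quotient_free_superperfect = group Q for Q :: "('q, 'k) monoid_scheme" +
  assumes fin_gen: "finitely_generated Q"
    and no_finite_index: "\<And>H. subgroup H Q \<Longrightarrow> finite (rcosets\<^bsub>Q\<^esub> H) \<Longrightarrow> H = carrier Q"
    and H2: "trivial_group (group_homology Q 2)"
begin

text \<open>
  The centralizer of the finite kernel has finite index, hence still maps onto \<open>Q\<close>. It is a central
  extension of \<open>Q\<close> by a finite group, which splits because \<open>Q\<close> is perfect and \<open>H\<^sub>2\<close> vanishes.
\<close>

lemma finite_kernel_virtual_complement:
  assumes E: "group E" and \<pi>: "\<pi> \<in> hom E Q" "\<pi> ` carrier E = carrier Q"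
    and fin: "finite {x \<in> carrier E. \<pi> x = \<one>\<^bsub>Q\<^esub>}"
  obtains S where "subgroup S E" "finite (rcosets\<^bsub>E\<^esub> S)" "\<And>x. x \<in> S \<Longrightarrow> \<pi> x = \<one>\<^bsub>Q\<^esub> \<Longrightarrow> x = \<one>\<^bsub>E\<^esub>"
proof -
  interpret E: group E by fact
  interpret \<pi>: group_hom E Q \<pi> using \<pi>(1) by (simp add: group_hom_def group_hom_axioms_def E.is_group is_group)
  define N where "N = {x \<in> carrier E. \<pi> x = \<one>\<^bsub>Q\<^esub>}"
  have "N = kernel E Q \<pi>" by (simp add: N_def kernel_def)
  then have N: "N \<lhd> E" using \<pi>.normal_kernel by simp
  have finN: "finite N" using fin by (simp add: N_def)
  define C where "C = {x \<in> carrier E. \<forall>n\<in>N. x \<otimes>\<^bsub>E\<^esub> n = n \<otimes>\<^bsub>E\<^esub> x}"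
  have C: "subgroup C E" "finite (rcosets\<^bsub>E\<^esub> C)"
    using E.finite_index_centralizer[OF N finN] by (simp_all add: C_def)
  have \<pi>C: "\<pi> ` C = carrier Q"
    using no_finite_index[OF \<pi>.finite_rcosets_image[OF \<pi>(2) C]] .
  have comm: "x \<otimes>\<^bsub>E\<^esub> n = n \<otimes>\<^bsub>E\<^esub> x" if "x \<in> C" "n \<in> N" for x n using that by (simp add: C_def)
  note Cm = subgroup.m_closed[OF C(1)] and Ci = subgroup.m_inv_closed[OF C(1)] and Cc = subgroup.mem_carrier[OF C(1)]
  have subN: "subgroup N E" using N by (rule normal_imp_subgroup)
  note Nm = subgroup.m_closed[OF subN] and Ni = subgroup.m_inv_closed[OF subN] and Nc = subgroup.mem_carrier[OF subN]
  \<comment> \<open>This is the kernel of \<open>\<pi>\<close> on \<open>C\<close>; it is central in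
    \<open>C\<close> because \<open>C\<close> commutes with \<open>N\<close>.\<close>
  let ?A = "E\<lparr>carrier := C \<inter> N\<rparr>"
  have A: "comm_group ?A"
  proof (rule group.group_comm_groupI[OF E.subgroup_imp_group[OF E.subgroups_Inter_pair[OF C(1) subN]]])
    show "x \<otimes>\<^bsub>?A\<^esub> y = y \<otimes>\<^bsub>?A\<^esub> x" if "x \<in> carrier ?A" "y \<in> carrier ?A" for x y
      using that comm[of x y] by simp
  qed
  define s where "s q = inv_into C \<pi> q" for q
  have s: "s q \<in> C" "\<pi> (s q) = q" if "q \<in> carrier Q" for q
    unfolding s_def using that \<pi>C by (simp_all add: inv_into_into f_inv_into_f)
  \<comment> \<open>The factor set of the section \<open>s\<close> measures its failure to be
    multiplicative. Lying in \<open>N\<close>, it commutes with every element of \<open>C\<close>,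
    which gives the cocycle identity for trivial coefficients.\<close>
  define f where "f a b = s a \<otimes>\<^bsub>E\<^esub> s b \<otimes>\<^bsub>E\<^esub> inv\<^bsub>E\<^esub> s (a \<otimes>\<^bsub>Q\<^esub> b)" for a b
  have f: "f a b \<in> C" "f a b \<in> N" and f_mult: "f a b \<otimes>\<^bsub>E\<^esub> s (a \<otimes>\<^bsub>Q\<^esub> b) = s a \<otimes>\<^bsub>E\<^esub> s b"
    if "a \<in> carrier Q" "b \<in> carrier Q" for a b
  proof -
    have ab: "a \<otimes>\<^bsub>Q\<^esub> b \<in> carrier Q" using that by simp
    note c = s(1)[OF that(1)] s(1)[OF that(2)] s(1)[OF ab]
    show "f a b \<in> C" unfolding f_def by (intro Cm Ci c)
    have e: "s a \<in> carrier E" "s b \<in> carrier E" "s (a \<otimes>\<^bsub>Q\<^esub> b) \<in> carrier E" using c Cc by simp_all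
    then show "f a b \<in> N" using s(2)[OF that(1)] s(2)[OF that(2)] s(2)[OF ab] that by (simp add: f_def N_def)
    show "f a b \<otimes>\<^bsub>E\<^esub> s (a \<otimes>\<^bsub>Q\<^esub> b) = s a \<otimes>\<^bsub>E\<^esub> s b" using e by (simp add: f_def E.m_assoc)
  qed
  have cocycle: "f a b \<otimes>\<^bsub>E\<^esub> f (a \<otimes>\<^bsub>Q\<^esub> b) c = f b c \<otimes>\<^bsub>E\<^esub> f a (b \<otimes>\<^bsub>Q\<^esub> c)"
    if abc: "a \<in> carrier Q" "b \<in> carrier Q" "c \<in> carrier Q" for a b c
  proof -
    let ?w = "s (a \<otimes>\<^bsub>Q\<^esub> b \<otimes>\<^bsub>Q\<^esub> c)"
    have q: "a \<otimes>\<^bsub>Q\<^esub> b \<in> carrier Q" "b \<otimes>\<^bsub>Q\<^esub> c \<in> carrier Q" "a \<otimes>\<^bsub>Q\<^esub> b \<otimes>\<^bsub>Q\<^esub> c \<in> carrier Q" using abc by simp_all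
    have e: "s a \<in> carrier E" "s b \<in> carrier E" "s c \<in> carrier E" "s (a \<otimes>\<^bsub>Q\<^esub> b) \<in> carrier E"
        "s (b \<otimes>\<^bsub>Q\<^esub> c) \<in> carrier E" "?w \<in> carrier E"
      using Cc s(1) abc q by simp_all
    have fe: "f a b \<in> carrier E" "f (a \<otimes>\<^bsub>Q\<^esub> b) c \<in> carrier E" "f b c \<in> carrier E" "f a (b \<otimes>\<^bsub>Q\<^esub> c) \<in> carrier E"
      using Cc f(1) abc q by simp_all
    have "f a b \<otimes>\<^bsub>E\<^esub> f (a \<otimes>\<^bsub>Q\<^esub> b) c \<otimes>\<^bsub>E\<^esub> ?w = f a b \<otimes>\<^bsub>E\<^esub> (f (a \<otimes>\<^bsub>Q\<^esub> b) c \<otimes>\<^bsub>E\<^esub> ?w)"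
      using e fe by (simp add: E.m_assoc)
    also have "\<dots> = f a b \<otimes>\<^bsub>E\<^esub> s (a \<otimes>\<^bsub>Q\<^esub> b) \<otimes>\<^bsub>E\<^esub> s c"
      using f_mult[OF q(1) abc(3)] e fe by (simp add: E.m_assoc)
    also have "\<dots> = s a \<otimes>\<^bsub>E\<^esub> (s b \<otimes>\<^bsub>E\<^esub> s c)" using f_mult[OF abc(1,2)] e by (simp add: E.m_assoc)
    also have "\<dots> = s a \<otimes>\<^bsub>E\<^esub> f b c \<otimes>\<^bsub>E\<^esub> s (b \<otimes>\<^bsub>Q\<^esub> c)"
      using f_mult[OF abc(2,3)] e fe by (simp add: E.m_assoc)
    also have "\<dots> = f b c \<otimes>\<^bsub>E\<^esub> (s a \<otimes>\<^bsub>E\<^esub> s (b \<otimes>\<^bsub>Q\<^esub> c))"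
      using comm[OF s(1)[OF abc(1)] f(2)[OF abc(2,3)]] e fe by (simp add: E.m_assoc)
    also have "\<dots> = f b c \<otimes>\<^bsub>E\<^esub> (f a (b \<otimes>\<^bsub>Q\<^esub> c) \<otimes>\<^bsub>E\<^esub> ?w)"
      using f_mult[OF abc(1) q(2)] abc by (simp add: m_assoc)
    also have "\<dots> = f b c \<otimes>\<^bsub>E\<^esub> f a (b \<otimes>\<^bsub>Q\<^esub> c) \<otimes>\<^bsub>E\<^esub> ?w" using e fe by (simp add: E.m_assoc)
    finally show ?thesis using e fe by simp
  qed
  have fA: "f a b \<in> carrier ?A" if "a \<in> carrier Q" "b \<in> carrier Q" for a b using f that by simp
  have coA: "f a b \<otimes>\<^bsub>?A\<^esub> f (a \<otimes>\<^bsub>Q\<^esub> b) c = f b c \<otimes>\<^bsub>?A\<^esub> f a (b \<otimes>\<^bsub>Q\<^esub> c)"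
    if "a \<in> carrier Q" "b \<in> carrier Q" "c \<in> carrier Q" for a b c
    using cocycle[OF that] by simp
  obtain h where h: "\<And>a. a \<in> carrier Q \<Longrightarrow> h a \<in> carrier ?A"
    "\<And>a b. a \<in> carrier Q \<Longrightarrow> b \<in> carrier Q \<Longrightarrow> f a b \<otimes>\<^bsub>?A\<^esub> h (a \<otimes>\<^bsub>Q\<^esub> b) = h a \<otimes>\<^bsub>?A\<^esub> h b"
    by (rule cocycle_is_coboundary[OF perfect_if_no_finite_index[OF fin_gen no_finite_index] H2 A fA coA]) blast+
  have hN: "h a \<in> N" "h a \<in> C" if "a \<in> carrier Q" for a using h(1)[OF that] by simp_all
  \<comment> \<open>Dividing the section by the cochain \<open>h\<close> absorbs the factor set and
    makes it multiplicative.\<close>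
  define \<sigma> where "\<sigma> a = s a \<otimes>\<^bsub>E\<^esub> inv\<^bsub>E\<^esub> h a" for a
  have \<sigma>C: "\<sigma> a \<in> C" if "a \<in> carrier Q" for a
    unfolding \<sigma>_def using that by (intro Cm Ci s hN)
  have \<pi>\<sigma>: "\<pi> (\<sigma> a) = a" if "a \<in> carrier Q" for a
    using that s[OF that] hN(1)[OF that] Cc by (simp add: \<sigma>_def N_def)
  have \<sigma>_mult: "\<sigma> (a \<otimes>\<^bsub>Q\<^esub> b) = \<sigma> a \<otimes>\<^bsub>E\<^esub> \<sigma> b" if ab: "a \<in> carrier Q" "b \<in> carrier Q" for a b
  proof -
    have q: "a \<otimes>\<^bsub>Q\<^esub> b \<in> carrier Q" using ab by simp
    let ?F = "f a b" and ?w = "s (a \<otimes>\<^bsub>Q\<^esub> b)" and ?z = "h (a \<otimes>\<^bsub>Q\<^esub> b)"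
    have e: "s a \<in> carrier E" "s b \<in> carrier E" "?w \<in> carrier E" "h a \<in> carrier E" "h b \<in> carrier E"
        "?z \<in> carrier E" "?F \<in> carrier E"
      using Cc s(1) hN(2) f(1) ab q by simp_all
    have F: "?F \<otimes>\<^bsub>E\<^esub> ?z = h a \<otimes>\<^bsub>E\<^esub> h b" using h(2)[OF ab] by simp
    have zF: "?z \<otimes>\<^bsub>E\<^esub> ?F = h b \<otimes>\<^bsub>E\<^esub> h a"
      using F comm[OF hN(2)[OF q] f(2)[OF ab]] comm[OF hN(2)[OF ab(1)] hN(1)[OF ab(2)]] by simp
    have "\<sigma> a \<otimes>\<^bsub>E\<^esub> \<sigma> b = s a \<otimes>\<^bsub>E\<^esub> (inv\<^bsub>E\<^esub> h a \<otimes>\<^bsub>E\<^esub> s b) \<otimes>\<^bsub>E\<^esub> inv\<^bsub>E\<^esub> h b"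
      using e by (simp add: \<sigma>_def E.m_assoc)
    also have "\<dots> = s a \<otimes>\<^bsub>E\<^esub> (s b \<otimes>\<^bsub>E\<^esub> inv\<^bsub>E\<^esub> h a) \<otimes>\<^bsub>E\<^esub> inv\<^bsub>E\<^esub> h b"
      using comm[OF s(1)[OF ab(2)] Ni[OF hN(1)[OF ab(1)]]] by simp
    also have "\<dots> = s a \<otimes>\<^bsub>E\<^esub> s b \<otimes>\<^bsub>E\<^esub> inv\<^bsub>E\<^esub> (h b \<otimes>\<^bsub>E\<^esub> h a)"
      using e by (simp add: E.m_assoc E.inv_mult_group)
    also have "\<dots> = ?F \<otimes>\<^bsub>E\<^esub> ?w \<otimes>\<^bsub>E\<^esub> inv\<^bsub>E\<^esub> (?z \<otimes>\<^bsub>E\<^esub> ?F)"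
      unfolding zF f_mult[OF ab] ..
    also have "\<dots> = ?w \<otimes>\<^bsub>E\<^esub> (?F \<otimes>\<^bsub>E\<^esub> inv\<^bsub>E\<^esub> ?F) \<otimes>\<^bsub>E\<^esub> inv\<^bsub>E\<^esub> ?z"
      unfolding comm[OF s(1)[OF q] f(2)[OF ab], symmetric] using e by (simp only: E.m_assoc E.inv_mult_group E.m_closed E.inv_closed)
    also have "\<dots> = \<sigma> (a \<otimes>\<^bsub>Q\<^esub> b)" using e by (simp add: \<sigma>_def)
    finally show ?thesis by simp
  qed
  interpret \<sigma>: group_hom Q E \<sigma>
    using \<sigma>C Cc \<sigma>_mult by (simp add: group_hom_def group_hom_axioms_def is_group E.is_group hom_def)
  have sub: "subgroup (\<sigma> ` carrier Q) E" by (rule \<sigma>.img_is_subgroup)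
  show thesis
  proof (rule that[OF sub])
    show "x = \<one>\<^bsub>E\<^esub>" if "x \<in> \<sigma> ` carrier Q" "\<pi> x = \<one>\<^bsub>Q\<^esub>" for x
      using that \<pi>\<sigma> \<sigma>.hom_one by auto
    show "finite (rcosets\<^bsub>E\<^esub> (\<sigma> ` carrier Q))"
    \<comment> \<open>The label lies over the identity of \<open>Q\<close>, hence in the finite
      group \<open>N\<close>. If \<open>x\<close> and \<open>y\<close> have equal labels,
      \<open>x y^-1\<close> equals the quotient of \<open>\<sigma> (\<pi> x)\<close> by
      \<open>\<sigma> (\<pi> y)\<close>.\<close>
    proof (rule E.finite_rcosetsI[where k = "\<lambda>x. inv\<^bsub>E\<^esub> x \<otimes>\<^bsub>E\<^esub> \<sigma> (\<pi> x)", OF sub])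
      have "(\<lambda>x. inv\<^bsub>E\<^esub> x \<otimes>\<^bsub>E\<^esub> \<sigma> (\<pi> x)) ` carrier E \<subseteq> N"
        using \<pi>\<sigma> by (auto simp: N_def)
      then show "finite ((\<lambda>x. inv\<^bsub>E\<^esub> x \<otimes>\<^bsub>E\<^esub> \<sigma> (\<pi> x)) ` carrier E)" using finN by (rule finite_subset)
      fix x y assume xy: "x \<in> carrier E" "y \<in> carrier E"
        and eq: "inv\<^bsub>E\<^esub> x \<otimes>\<^bsub>E\<^esub> \<sigma> (\<pi> x) = inv\<^bsub>E\<^esub> y \<otimes>\<^bsub>E\<^esub> \<sigma> (\<pi> y)"
      let ?u = "\<sigma> (\<pi> x)" and ?v = "\<sigma> (\<pi> y)"
      have uv: "?u \<in> carrier E" "?v \<in> carrier E" using xy by simp_all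
      have "x \<otimes>\<^bsub>E\<^esub> (inv\<^bsub>E\<^esub> x \<otimes>\<^bsub>E\<^esub> ?u) \<otimes>\<^bsub>E\<^esub> inv\<^bsub>E\<^esub> ?v = x \<otimes>\<^bsub>E\<^esub> (inv\<^bsub>E\<^esub> y \<otimes>\<^bsub>E\<^esub> ?v) \<otimes>\<^bsub>E\<^esub> inv\<^bsub>E\<^esub> ?v"
        using eq by simp
      moreover have "x \<otimes>\<^bsub>E\<^esub> (inv\<^bsub>E\<^esub> x \<otimes>\<^bsub>E\<^esub> ?u) \<otimes>\<^bsub>E\<^esub> inv\<^bsub>E\<^esub> ?v = ?u \<otimes>\<^bsub>E\<^esub> inv\<^bsub>E\<^esub> ?v"
        using xy uv by (simp flip: E.m_assoc[of x "inv\<^bsub>E\<^esub> x"])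
      moreover have "x \<otimes>\<^bsub>E\<^esub> (inv\<^bsub>E\<^esub> y \<otimes>\<^bsub>E\<^esub> ?v) \<otimes>\<^bsub>E\<^esub> inv\<^bsub>E\<^esub> ?v = x \<otimes>\<^bsub>E\<^esub> inv\<^bsub>E\<^esub> y"
        using xy uv by (simp add: E.m_assoc)
      ultimately have "x \<otimes>\<^bsub>E\<^esub> inv\<^bsub>E\<^esub> y = ?u \<otimes>\<^bsub>E\<^esub> inv\<^bsub>E\<^esub> ?v" by simp
      moreover have "?u \<in> \<sigma> ` carrier Q" "?v \<in> \<sigma> ` carrier Q" using xy by simp_all
      ultimately show "x \<otimes>\<^bsub>E\<^esub> inv\<^bsub>E\<^esub> y \<in> \<sigma> ` carrier Q"
        using subgroup.m_closed[OF sub] subgroup.m_inv_closed[OF sub] by simp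
    qed
  qed
qed

end

section \<open>Fibre products\<close>

context fibre_product_hom begin

text \<open>
  As a simplification rule, closure of the carrier under the projections loops with
  \<open>carrier_fibre_product\<close>.
\<close>

declare u.hom_closed [simp del] v.hom_closed [simp del]

lemma fibre_productD:
  assumes "x \<in> carrier (fibre_product G p)"
  shows "fst x \<in> carrier G" "snd x \<in> carrier G" "p (fst x) = p (snd x)"
  using assms by simp_all

lemma fin_index_normal_image:
  assumes onto: "p ` carrier G = carrier Q" and M: "M \<in> fin_index_normal G"
    and no_fin: "\<And>H. subgroup H Q \<Longrightarrow> finite (rcosets\<^bsub>Q\<^esub> H) \<Longrightarrow> H = carrier Q"
  shows "p ` M = carrier Q"
  using no_fin[OF p.finite_rcosets_image[OF onto fin_index_normal_subgroup[OF M]]] M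
  by (simp add: fin_index_normal_iff)

text \<open>Every finite index normal \<open>M\<close> maps onto \<open>Q\<close>, so
  \<open>g\<close> can be replaced within its coset of \<open>M\<close> by an element with the same
  image in \<open>Q\<close> as \<open>g'\<close>.\<close>

lemma dense_image_if_no_finite_index:
  assumes onto: "p ` carrier G = carrier Q"
    and no_fin: "\<And>H. subgroup H Q \<Longrightarrow> finite (rcosets\<^bsub>Q\<^esub> H) \<Longrightarrow> H = carrier Q"
  shows dense_image
  unfolding dense_image_def
proof (intro ballI)
  fix M g g' assume M: "M \<in> fin_index_normal G" and g: "g \<in> carrier G" "g' \<in> carrier G"
  have sub: "subgroup M G" using M by (rule fin_index_normal_subgroup)
  have pM: "p ` M = carrier Q" by (rule fin_index_normal_image[OF onto M no_fin])
  have "p g' \<otimes>\<^bsub>Q\<^esub> inv\<^bsub>Q\<^esub> p g \<in> p ` M" unfolding pM using g by simp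
  then obtain m where m: "p g' \<otimes>\<^bsub>Q\<^esub> inv\<^bsub>Q\<^esub> p g = p m" "m \<in> M" by (rule imageE)
  have mc: "m \<in> carrier G" using sub m(2) by (rule subgroup.mem_carrier)
  have "p (m \<otimes>\<^bsub>G\<^esub> g) = p g'" using g mc by (simp add: m(1)[symmetric] p.H.m_assoc)
  then have "(m \<otimes>\<^bsub>G\<^esub> g, g') \<in> carrier (fibre_product G p)" using g mc by simp
  moreover have "M #>\<^bsub>G\<^esub> (m \<otimes>\<^bsub>G\<^esub> g) = M #>\<^bsub>G\<^esub> g"
    using p.G.rcos_eq_iff[OF sub _ g(1), of "m \<otimes>\<^bsub>G\<^esub> g"] g mc m(2) by (simp add: p.G.m_assoc)
  ultimately show "\<exists>x\<in>carrier (fibre_product G p). M #>\<^bsub>G\<^esub> fst x = M #>\<^bsub>G\<^esub> g \<and> M #>\<^bsub>G\<^esub> snd x = M #>\<^bsub>G\<^esub> g'"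
    by (intro bexI[of _ "(m \<otimes>\<^bsub>G\<^esub> g, g')"]) simp_all
qed

text \<open>Take the preimage in \<open>G\<close> of a normal core \<open>R\<close> of
  \<open>H\<close>, and approximate the pair formed by the identity and a lift of \<open>q\<close>.
  Both coordinates of an element of the fibre product have the same image in \<open>Q\<close>, which
  forces \<open>q\<close> into \<open>R\<close>.\<close>

lemma no_finite_index_if_dense_image:
  assumes onto: "p ` carrier G = carrier Q" and dense: dense_image
    and H: "subgroup H Q" "finite (rcosets\<^bsub>Q\<^esub> H)"
  shows "H = carrier Q"
proof
  show "H \<subseteq> carrier Q" using H(1) by (rule subgroup.subset)
  obtain R where R: "R \<in> fin_index_normal Q" "R \<subseteq> H" using p.H.fin_index_normal_core[OF H] .
  have subR: "subgroup R Q" using R(1) by (rule fin_index_normal_subgroup)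
  let ?M = "{x \<in> carrier G. p x \<in> R}"
  have M: "?M \<in> fin_index_normal G" using p.fin_index_normal_vimage[OF R(1)] .
  have sub: "subgroup ?M G" using M by (rule fin_index_normal_subgroup)
  show "carrier Q \<subseteq> H"
  proof
    fix q assume "q \<in> carrier Q"
    then have "q \<in> p ` carrier G" using onto by simp
    then obtain g where g: "q = p g" "g \<in> carrier G" by (rule imageE)
    have "\<exists>x\<in>carrier (fibre_product G p).
        ?M #>\<^bsub>G\<^esub> fst x = ?M #>\<^bsub>G\<^esub> \<one>\<^bsub>G\<^esub> \<and> ?M #>\<^bsub>G\<^esub> snd x = ?M #>\<^bsub>G\<^esub> g"
      by (rule dense[unfolded dense_image_def, THEN bspec, OF M, THEN bspec, OF p.G.one_closed, THEN bspec, OF g(2)])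
    then obtain x where x: "x \<in> carrier (fibre_product G p)"
      "?M #>\<^bsub>G\<^esub> fst x = ?M #>\<^bsub>G\<^esub> \<one>\<^bsub>G\<^esub> \<and> ?M #>\<^bsub>G\<^esub> snd x = ?M #>\<^bsub>G\<^esub> g" by (rule bexE)
    note xc = fibre_productD[OF x(1)]
    have "fst x \<in> ?M" using conjunct1[OF x(2)] p.G.rcos_eq_iff[OF sub xc(1) p.G.one_closed] xc by simp
    then have R1: "p (snd x) \<in> R" using xc(3) by simp
    have "snd x \<otimes>\<^bsub>G\<^esub> inv\<^bsub>G\<^esub> g \<in> ?M" using conjunct2[OF x(2)] p.G.rcos_eq_iff[OF sub xc(2) g(2)] by simp
    then have "p (snd x) \<otimes>\<^bsub>Q\<^esub> inv\<^bsub>Q\<^esub> q \<in> R" using xc g by simp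
    then have "inv\<^bsub>Q\<^esub> (p (snd x) \<otimes>\<^bsub>Q\<^esub> inv\<^bsub>Q\<^esub> q) \<otimes>\<^bsub>Q\<^esub> p (snd x) \<in> R"
      using R1 subgroup.m_closed[OF subR] subgroup.m_inv_closed[OF subR] by simp
    moreover have "inv\<^bsub>Q\<^esub> (p (snd x) \<otimes>\<^bsub>Q\<^esub> inv\<^bsub>Q\<^esub> q) \<otimes>\<^bsub>Q\<^esub> p (snd x) = q"
      using xc g by (simp add: p.H.inv_mult_group p.H.m_assoc)
    ultimately show "q \<in> H" using R(2) by auto
  qed
qed

text \<open>Every \<open>(g, g')\<close> in the fibre product is \<open>(g, g)\<close> times
  \<open>(1, g^-1 g')\<close>. The finite index subgroup meeting the kernel inside \<open>L\<close>
  puts the second factor into \<open>K\<close>; the diagonal factor is handled by intersecting with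
  the preimage of \<open>K\<close> under the diagonal map.\<close>

lemma induced_topology_full_if_superperfect:
  assumes onto: "p ` carrier G = carrier Q" and Q: "finite_quotient_free_superperfect Q"
  shows induced_topology_full
  unfolding induced_topology_full_def
proof (intro ballI)
  fix K assume K: "K \<in> fin_index_normal (fibre_product G p)"
  let ?P = "fibre_product G p"
  interpret P: group ?P by (rule group_fibre_product)
  interpret K: normal K ?P using K by (simp add: fin_index_normal_iff)
  define N where "N = kernel G Q p"
  have N_iff: "x \<in> N \<longleftrightarrow> x \<in> carrier G \<and> p x = \<one>\<^bsub>Q\<^esub>" for x by (simp add: N_def kernel_def)
  let ?N = "G\<lparr>carrier := N\<rparr>"
  have gN: "group ?N" unfolding N_def by (rule p.G.subgroup_imp_group[OF p.subgroup_kernel])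
  define L where "L = {n \<in> N. (\<one>\<^bsub>G\<^esub>, n) \<in> K}"
  have i: "group_hom ?N ?P (\<lambda>n. (\<one>\<^bsub>G\<^esub>, n))"
    by (simp add: group_hom_def group_hom_axioms_def gN group_fibre_product hom_def N_iff)
  have L_eq: "L = {n \<in> carrier ?N. (\<one>\<^bsub>G\<^esub>, n) \<in> K}" by (simp add: L_def)
  have subLN: "subgroup L ?N" unfolding L_eq by (rule group_hom.subgroup_vimage[OF i K.subgroup_axioms])
  have "finite (rcosets\<^bsub>?N\<^esub> L)" unfolding L_eq
    by (rule group_hom.finite_rcosets_vimage[OF i K.subgroup_axioms]) (use K in \<open>simp add: fin_index_normal_iff\<close>)
  then have finL: "finite ((\<lambda>n. L #>\<^bsub>G\<^esub> n) ` N)" by (simp add: rcosets_eq_image)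
  have subL: "subgroup L G"
    using p.G.incl_subgroup[OF _ subLN] p.subgroup_kernel by (simp add: N_def)
  \<comment> \<open>Normality of \<open>L\<close> in all of \<open>G\<close> comes from conjugating
    by the diagonal elements \<open>(g, g)\<close> of the fibre product.\<close>
  have "g \<otimes>\<^bsub>G\<^esub> n \<otimes>\<^bsub>G\<^esub> inv\<^bsub>G\<^esub> g \<in> L" if g: "g \<in> carrier G" and n: "n \<in> L" for g n
  proof -
    have nc: "n \<in> carrier G" "p n = \<one>\<^bsub>Q\<^esub>" "(\<one>\<^bsub>G\<^esub>, n) \<in> K" using n by (simp_all add: L_def N_iff)
    have gg: "(g, g) \<in> carrier ?P" using g by simp
    have "(g, g) \<otimes>\<^bsub>?P\<^esub> (\<one>\<^bsub>G\<^esub>, n) \<otimes>\<^bsub>?P\<^esub> inv\<^bsub>?P\<^esub> (g, g) \<in> K" using K.inv_op_closed2[OF gg nc(3)] .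
    moreover have "(g, g) \<otimes>\<^bsub>?P\<^esub> (\<one>\<^bsub>G\<^esub>, n) \<otimes>\<^bsub>?P\<^esub> inv\<^bsub>?P\<^esub> (g, g) = (\<one>\<^bsub>G\<^esub>, g \<otimes>\<^bsub>G\<^esub> n \<otimes>\<^bsub>G\<^esub> inv\<^bsub>G\<^esub> g)"
      using g nc inv_fibre_product[OF gg] by simp
    ultimately show ?thesis using g nc by (simp add: L_def N_iff)
  qed
  then have "L \<lhd> G" using subL p.G.normal_inv_iff by blast
  then interpret L: normal L G .
  have "L \<subseteq> kernel G Q p" by (auto simp: L_def N_def)
  then obtain \<pi> where \<pi>: "\<pi> \<in> hom (G Mod L) Q" "\<And>x. x \<in> carrier G \<Longrightarrow> \<pi> (L #>\<^bsub>G\<^esub> x) = p x"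
    using p.FactGroup_universal_kernel[OF L.normal_axioms] by metis
  have "\<pi> ` carrier (G Mod L) = carrier Q"
    unfolding carrier_FactGroup image_image onto[symmetric] using \<pi>(2) by (intro image_cong) simp_all
  moreover have "{C \<in> carrier (G Mod L). \<pi> C = \<one>\<^bsub>Q\<^esub>} \<subseteq> (\<lambda>n. L #>\<^bsub>G\<^esub> n) ` N"
    unfolding carrier_FactGroup using \<pi>(2) by (auto simp: N_iff)
  then have "finite {C \<in> carrier (G Mod L). \<pi> C = \<one>\<^bsub>Q\<^esub>}" using finL by (rule finite_subset)
  ultimately obtain S where S: "subgroup S (G Mod L)" "finite (rcosets\<^bsub>G Mod L\<^esub> S)"
    "\<And>x. x \<in> S \<Longrightarrow> \<pi> x = \<one>\<^bsub>Q\<^esub> \<Longrightarrow> x = \<one>\<^bsub>G Mod L\<^esub>"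
    using finite_quotient_free_superperfect.finite_kernel_virtual_complement[OF Q L.factorgroup_is_group \<pi>(1)] by metis
  have r: "group_hom G (G Mod L) (\<lambda>x. L #>\<^bsub>G\<^esub> x)"
    using L.r_coset_hom_Mod L.factorgroup_is_group by (simp add: group_hom_def group_hom_axioms_def p.G.is_group)
  \<comment> \<open>Since \<open>S\<close> contains no nontrivial element of the kernel of
    \<open>\<pi>\<close>, its preimage meets \<open>N\<close> only inside \<open>L\<close>.\<close>
  let ?G1 = "{x \<in> carrier G. L #>\<^bsub>G\<^esub> x \<in> S}"
  have G1: "subgroup ?G1 G" "finite (rcosets\<^bsub>G\<^esub> ?G1)"
    using group_hom.subgroup_vimage[OF r S(1)] group_hom.finite_rcosets_vimage[OF r S(1,2)] by simp_all
  have G1_ker: "x \<in> L" if "x \<in> ?G1" "p x = \<one>\<^bsub>Q\<^esub>" for x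
  proof -
    have x: "x \<in> carrier G" using that by simp
    have "L #>\<^bsub>G\<^esub> x = L" using S(3)[of "L #>\<^bsub>G\<^esub> x"] that \<pi>(2)[OF x] by simp
    then show ?thesis using p.G.rcos_self[OF x L.subgroup_axioms] by simp
  qed
  have d: "group_hom G ?P (\<lambda>x. (x, x))"
    by (simp add: group_hom_def group_hom_axioms_def p.G.is_group group_fibre_product hom_def)
  let ?D = "{x \<in> carrier G. (x, x) \<in> K}"
  have D: "?D \<in> fin_index_normal G" using group_hom.fin_index_normal_vimage[OF d K] .
  have GD: "subgroup (?G1 \<inter> ?D) G" "finite (rcosets\<^bsub>G\<^esub> (?G1 \<inter> ?D))"
    using p.G.subgroups_Inter_pair[OF G1(1) fin_index_normal_subgroup[OF D]]
      p.G.finite_rcosets_Int[OF G1(1) fin_index_normal_subgroup[OF D] G1(2)] D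
    by (simp_all add: fin_index_normal_iff)
  obtain M where M: "M \<in> fin_index_normal G" "M \<subseteq> ?G1 \<inter> ?D" using p.G.fin_index_normal_core[OF GD] .
  have "x \<in> K" if x: "x \<in> carrier ?P" "fst x \<in> M" "snd x \<in> M" for x
  proof -
    note xc = fibre_productD[OF x(1)]
    let ?n = "inv\<^bsub>G\<^esub> fst x \<otimes>\<^bsub>G\<^esub> snd x"
    note subM = fin_index_normal_subgroup[OF M(1)]
    have "?n \<in> M" using subgroup.m_closed[OF subM subgroup.m_inv_closed[OF subM x(2)] x(3)] .
    then have "?n \<in> ?G1" using M(2) by (rule subsetD[OF Int_lower1, OF subsetD, rotated])
    moreover have "p ?n = \<one>\<^bsub>Q\<^esub>" using xc by simp
    ultimately have "?n \<in> L" by (rule G1_ker)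
    then have n: "(\<one>\<^bsub>G\<^esub>, ?n) \<in> K" by (simp add: L_def)
    have "fst x \<in> ?D" using M(2) x(2) by blast
    then have "(fst x, fst x) \<otimes>\<^bsub>?P\<^esub> (\<one>\<^bsub>G\<^esub>, ?n) \<in> K" using n K.m_closed by blast
    moreover have "(fst x, fst x) \<otimes>\<^bsub>?P\<^esub> (\<one>\<^bsub>G\<^esub>, ?n) = x"
      using xc by (simp add: prod_eq_iff flip: p.G.m_assoc)
    ultimately show ?thesis by simp
  qed
  then show "\<exists>M\<in>fin_index_normal G. \<forall>x\<in>carrier ?P. fst x \<in> M \<and> snd x \<in> M \<longrightarrow> x \<in> K" using M(1) by blast
qed

text \<open>
  Since the kernel is central, \<open>(g, g n) \<mapsto> n\<close> is a homomorphism on the fibre product. A finite index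
  normal subgroup of \<open>G\<close> maps onto \<open>Q\<close>, so it differs from \<open>G\<close> only by central elements and contains all
  commutators. Hence a commutator in the kernel lies in every subgroup of finite index of the kernel.
\<close>

lemma derived_Int_central_kernel:
  assumes onto: "p ` carrier G = carrier Q" and full: induced_topology_full
    and no_fin: "\<And>H. subgroup H Q \<Longrightarrow> finite (rcosets\<^bsub>Q\<^esub> H) \<Longrightarrow> H = carrier Q"
    and central: "\<And>x y. x \<in> carrier G \<Longrightarrow> p x = \<one>\<^bsub>Q\<^esub> \<Longrightarrow> y \<in> carrier G \<Longrightarrow> x \<otimes>\<^bsub>G\<^esub> y = y \<otimes>\<^bsub>G\<^esub> x"
    and S: "finite S" "S \<subseteq> carrier G" "{x \<in> carrier G. p x = \<one>\<^bsub>Q\<^esub>} = generate G S"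
    and z: "z \<in> derived G (carrier G)" "p z = \<one>\<^bsub>Q\<^esub>"
  shows "z = \<one>\<^bsub>G\<^esub>"
proof (rule ccontr)
  assume neq: "z \<noteq> \<one>\<^bsub>G\<^esub>"
  let ?P = "fibre_product G p"
  interpret P: group ?P by (rule group_fibre_product)
  define N where "N = kernel G Q p"
  have N_iff: "x \<in> N \<longleftrightarrow> x \<in> carrier G \<and> p x = \<one>\<^bsub>Q\<^esub>" for x by (simp add: N_def kernel_def)
  have N_gen: "N = generate G S" using S(3) N_iff by auto
  have subN: "subgroup N G" unfolding N_def by (rule p.subgroup_kernel)
  let ?A = "G\<lparr>carrier := N\<rparr>"
  have A: "comm_group ?A"
  proof (rule group.group_comm_groupI[OF p.G.subgroup_imp_group[OF subN]])
    show "x \<otimes>\<^bsub>?A\<^esub> y = y \<otimes>\<^bsub>?A\<^esub> x" if "x \<in> carrier ?A" "y \<in> carrier ?A" for x y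
      using that central[of x y] by (simp add: N_iff)
  qed
  have SN: "S \<subseteq> N" unfolding N_gen by (intro subsetI generate.incl)
  have "generate ?A S = carrier ?A" using p.G.generate_consistent[OF SN subN] N_gen by simp
  then obtain T where T: "subgroup T ?A" "finite (rcosets\<^bsub>?A\<^esub> T)" "z \<notin> T"
    using comm_group.residually_finite[OF A S(1), of z] SN neq by auto
  have gA: "group ?A" using A by (simp add: comm_group_def)
  let ?\<delta> = "\<lambda>x. inv\<^bsub>G\<^esub> fst x \<otimes>\<^bsub>G\<^esub> snd x"
  have "?\<delta> \<in> hom ?P ?A"
  proof (rule homI)
    fix x y assume x: "x \<in> carrier ?P" and y: "y \<in> carrier ?P"
    note xc = fibre_productD[OF x]
    note yc = fibre_productD[OF y]
    show "?\<delta> x \<in> carrier ?A" using xc by (simp add: N_iff)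
    then have "?\<delta> x \<in> carrier G" "p (?\<delta> x) = \<one>\<^bsub>Q\<^esub>" by (simp_all add: N_iff)
    then have c: "?\<delta> x \<otimes>\<^bsub>G\<^esub> inv\<^bsub>G\<^esub> fst y = inv\<^bsub>G\<^esub> fst y \<otimes>\<^bsub>G\<^esub> ?\<delta> x" using central yc(1) by simp
    have "?\<delta> (x \<otimes>\<^bsub>?P\<^esub> y) = (inv\<^bsub>G\<^esub> fst y \<otimes>\<^bsub>G\<^esub> ?\<delta> x) \<otimes>\<^bsub>G\<^esub> snd y"
      using xc yc by (simp add: p.G.inv_mult_group p.G.m_assoc)
    also have "\<dots> = ?\<delta> x \<otimes>\<^bsub>G\<^esub> ?\<delta> y" unfolding c[symmetric] using xc yc by (simp add: p.G.m_assoc)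
    finally show "?\<delta> (x \<otimes>\<^bsub>?P\<^esub> y) = ?\<delta> x \<otimes>\<^bsub>?A\<^esub> ?\<delta> y" by simp
  qed
  then have \<delta>: "group_hom ?P ?A ?\<delta>" by (simp add: group_hom_def group_hom_axioms_def group_fibre_product gA)
  have "T \<in> fin_index_normal ?A"
    using comm_group.subgroup_imp_normal[OF A T(1)] T(2) by (simp add: fin_index_normal_iff)
  then have KT: "{x \<in> carrier ?P. ?\<delta> x \<in> T} \<in> fin_index_normal ?P"
    by (rule group_hom.fin_index_normal_vimage[OF \<delta>])
  obtain M where M: "M \<in> fin_index_normal G"
    "\<And>x. x \<in> carrier ?P \<Longrightarrow> fst x \<in> M \<Longrightarrow> snd x \<in> M \<Longrightarrow> ?\<delta> x \<in> T"
    using full[unfolded induced_topology_full_def, THEN bspec, OF KT] by (elim bexE) simp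
  have subM: "subgroup M G" using M(1) by (rule fin_index_normal_subgroup)
  have pM: "p ` M = carrier Q" by (rule fin_index_normal_image[OF onto M(1) no_fin])
  have split: "\<exists>m\<in>M. \<exists>n\<in>N. a = m \<otimes>\<^bsub>G\<^esub> n" if a: "a \<in> carrier G" for a
  proof -
    have "p a \<in> p ` M" unfolding pM using a by simp
    then obtain m where m: "p a = p m" "m \<in> M" by (rule imageE)
    have mc: "m \<in> carrier G" using subM m(2) by (rule subgroup.mem_carrier)
    have "inv\<^bsub>G\<^esub> m \<otimes>\<^bsub>G\<^esub> a \<in> N" using a m mc by (simp add: N_iff)
    moreover have "a = m \<otimes>\<^bsub>G\<^esub> (inv\<^bsub>G\<^esub> m \<otimes>\<^bsub>G\<^esub> a)" using a mc by (simp flip: p.G.m_assoc)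
    ultimately show ?thesis using m(2) by blast
  qed
  have "derived_set G (carrier G) \<subseteq> M"
  proof
    fix c assume "c \<in> derived_set G (carrier G)"
    then obtain a b where ab: "a \<in> carrier G" "b \<in> carrier G" "c = a \<otimes>\<^bsub>G\<^esub> b \<otimes>\<^bsub>G\<^esub> inv\<^bsub>G\<^esub> a \<otimes>\<^bsub>G\<^esub> inv\<^bsub>G\<^esub> b" by auto
    obtain m n where a: "m \<in> M" "n \<in> N" "a = m \<otimes>\<^bsub>G\<^esub> n" using split[OF ab(1)] by blast
    obtain m' n' where b: "m' \<in> M" "n' \<in> N" "b = m' \<otimes>\<^bsub>G\<^esub> n'" using split[OF ab(2)] by blast
    have e: "m \<in> carrier G" "m' \<in> carrier G" "n \<in> carrier G" "n' \<in> carrier G"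
      using subgroup.mem_carrier[OF subM] subgroup.mem_carrier[OF subN] a b by simp_all
    have n: "n \<otimes>\<^bsub>G\<^esub> y = y \<otimes>\<^bsub>G\<^esub> n" and n': "n' \<otimes>\<^bsub>G\<^esub> y = y \<otimes>\<^bsub>G\<^esub> n'" if "y \<in> carrier G" for y
      using central[OF _ _ that] a(2) b(2) by (simp_all add: N_iff)
    have "a \<otimes>\<^bsub>G\<^esub> b = m \<otimes>\<^bsub>G\<^esub> (n \<otimes>\<^bsub>G\<^esub> m') \<otimes>\<^bsub>G\<^esub> n'" using e a b by (simp add: p.G.m_assoc)
    also have "\<dots> = (m \<otimes>\<^bsub>G\<^esub> m') \<otimes>\<^bsub>G\<^esub> (n \<otimes>\<^bsub>G\<^esub> n')" unfolding n[OF e(2)] using e by (simp add: p.G.m_assoc)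
    finally have 1: "a \<otimes>\<^bsub>G\<^esub> b = (m \<otimes>\<^bsub>G\<^esub> m') \<otimes>\<^bsub>G\<^esub> (n \<otimes>\<^bsub>G\<^esub> n')" .
    have "b \<otimes>\<^bsub>G\<^esub> a = m' \<otimes>\<^bsub>G\<^esub> (n' \<otimes>\<^bsub>G\<^esub> m) \<otimes>\<^bsub>G\<^esub> n" using e a b by (simp add: p.G.m_assoc)
    also have "\<dots> = (m' \<otimes>\<^bsub>G\<^esub> m) \<otimes>\<^bsub>G\<^esub> (n' \<otimes>\<^bsub>G\<^esub> n)" unfolding n'[OF e(1)] using e by (simp add: p.G.m_assoc)
    finally have 2: "b \<otimes>\<^bsub>G\<^esub> a = (m' \<otimes>\<^bsub>G\<^esub> m) \<otimes>\<^bsub>G\<^esub> (n \<otimes>\<^bsub>G\<^esub> n')" unfolding n[OF e(4)] .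
    \<comment> \<open>The two products \<open>ab\<close> and \<open>ba\<close> share the kernel
      factor \<open>?w\<close>, which cancels in the commutator.\<close>
    let ?u = "m \<otimes>\<^bsub>G\<^esub> m'" and ?v = "m' \<otimes>\<^bsub>G\<^esub> m" and ?w = "n \<otimes>\<^bsub>G\<^esub> n'"
    have uvw: "?u \<in> carrier G" "?v \<in> carrier G" "?w \<in> carrier G" using e by simp_all
    have "c = (a \<otimes>\<^bsub>G\<^esub> b) \<otimes>\<^bsub>G\<^esub> inv\<^bsub>G\<^esub> (b \<otimes>\<^bsub>G\<^esub> a)" using ab by (simp add: p.G.inv_mult_group p.G.m_assoc)
    also have "\<dots> = ?u \<otimes>\<^bsub>G\<^esub> (?w \<otimes>\<^bsub>G\<^esub> inv\<^bsub>G\<^esub> ?w) \<otimes>\<^bsub>G\<^esub> inv\<^bsub>G\<^esub> ?v"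
      unfolding 1 2 p.G.inv_mult_group[OF uvw(2,3)] using uvw by (simp only: p.G.m_assoc p.G.m_closed p.G.inv_closed)
    also have "\<dots> = ?u \<otimes>\<^bsub>G\<^esub> inv\<^bsub>G\<^esub> ?v" unfolding p.G.r_inv[OF uvw(3)] using uvw by simp
    finally show "c \<in> M"
      using subgroup.m_closed[OF subM] subgroup.m_inv_closed[OF subM] a(1) b(1) by simp
  qed
  then have "z \<in> M" using p.G.generate_subgroup_incl[OF _ subM] z(1) unfolding derived_def by blast
  moreover have zc: "z \<in> carrier G" using \<open>z \<in> M\<close> by (rule subgroup.mem_carrier[OF subM])
  \<comment> \<open>The pair \<open>(1, z)\<close> lies in the fibre product because
    \<open>p z = 1\<close>, and \<open>?\<delta>\<close> sends it to \<open>z\<close>, which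
    \<open>T\<close> was chosen to miss.\<close>
  ultimately have "?\<delta> (\<one>\<^bsub>G\<^esub>, z) \<in> T" using z(2) subgroup.one_closed[OF subM] by (intro M(2)) simp_all
  then show False using T(3) zc by simp
qed

text \<open>Perfectness of \<open>Q\<close> makes the derived subgroup of \<open>G\<close> map onto
  \<open>Q\<close>, and the preceding lemma makes this map injective; \<open>\<sigma>\<close> is its
  inverse.\<close>

lemma central_extension_splits:
  assumes onto: "p ` carrier G = carrier Q" and full: induced_topology_full and fg: "finitely_generated Q"
    and no_fin: "\<And>H. subgroup H Q \<Longrightarrow> finite (rcosets\<^bsub>Q\<^esub> H) \<Longrightarrow> H = carrier Q"
    and central: "\<And>x y. x \<in> carrier G \<Longrightarrow> p x = \<one>\<^bsub>Q\<^esub> \<Longrightarrow> y \<in> carrier G \<Longrightarrow> x \<otimes>\<^bsub>G\<^esub> y = y \<otimes>\<^bsub>G\<^esub> x"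
    and S: "finite S" "S \<subseteq> carrier G" "{x \<in> carrier G. p x = \<one>\<^bsub>Q\<^esub>} = generate G S"
  obtains \<sigma> where "\<sigma> \<in> hom Q G" "\<And>q. q \<in> carrier Q \<Longrightarrow> p (\<sigma> q) = q"
proof -
  let ?D = "derived G (carrier G)"
  have sub: "subgroup ?D G" by (rule p.G.derived_is_subgroup) simp
  have "derived Q (carrier Q) = carrier Q" by (rule perfect_if_no_finite_index[OF fg no_fin])
  then have pD: "p ` ?D = carrier Q" using p.derived_img[of "carrier G"] onto by simp
  have inj: "x = y" if "x \<in> ?D" "y \<in> ?D" "p x = p y" for x y
  proof -
    have c: "x \<in> carrier G" "y \<in> carrier G" using subgroup.mem_carrier[OF sub] that by simp_all
    have z: "x \<otimes>\<^bsub>G\<^esub> inv\<^bsub>G\<^esub> y \<in> ?D"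
      using that subgroup.m_closed[OF sub] subgroup.m_inv_closed[OF sub] by simp
    have pz: "p (x \<otimes>\<^bsub>G\<^esub> inv\<^bsub>G\<^esub> y) = \<one>\<^bsub>Q\<^esub>" using c that(3) by simp
    have "x \<otimes>\<^bsub>G\<^esub> inv\<^bsub>G\<^esub> y = \<one>\<^bsub>G\<^esub>"
      by (rule derived_Int_central_kernel[OF onto full no_fin central S z pz])
    then show ?thesis using c p.G.inv_equality[of x "inv\<^bsub>G\<^esub> y"] by simp
  qed
  define \<sigma> where "\<sigma> q = inv_into ?D p q" for q
  have \<sigma>: "\<sigma> q \<in> ?D" "p (\<sigma> q) = q" if "q \<in> carrier Q" for q
    unfolding \<sigma>_def using that pD by (simp_all add: inv_into_into f_inv_into_f)
  show thesis
  proof (rule that[of \<sigma>])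
    show "\<sigma> \<in> hom Q G"
    proof (rule homI)
      show "\<sigma> q \<in> carrier G" if "q \<in> carrier Q" for q using \<sigma>(1)[OF that] by (rule subgroup.mem_carrier[OF sub])
      fix a b assume ab: "a \<in> carrier Q" "b \<in> carrier Q"
      have c: "\<sigma> a \<in> carrier G" "\<sigma> b \<in> carrier G" using \<sigma>(1) ab subgroup.mem_carrier[OF sub] by simp_all
      show "\<sigma> (a \<otimes>\<^bsub>Q\<^esub> b) = \<sigma> a \<otimes>\<^bsub>G\<^esub> \<sigma> b"
        using ab \<sigma> c by (intro inj subgroup.m_closed[OF sub]) simp_all
    qed
  qed (rule \<sigma>(2))
qed

end

text \<open>The theorem quantifies over groups on the types \<open>'n\<close> and \<open>'g\<close>,
  while the extensions to which (A) is applied live on other types. Finitely generated groups and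
  their kernels are countable, so copies exist; \<open>p (f x) = \<pi> x\<close> allows properties
  of the extension to be carried across.\<close>

lemma short_exact_on_infinite_types:
  assumes fg: "finitely_generated E" and Q: "group Q" and \<pi>: "\<pi> \<in> hom E Q" "\<pi> ` carrier E = carrier Q"
    and "infinite (UNIV :: 'n set)" "infinite (UNIV :: 'g set)"
  obtains N :: "'n monoid" and G :: "'g monoid" and i p f
  where "short_exact N i G p Q" "finitely_generated G" "f \<in> iso E G" "\<And>x. x \<in> carrier E \<Longrightarrow> p (f x) = \<pi> x"
proof -
  have E: "group E" using fg by (simp add: finitely_generated_def)
  obtain G :: "'g monoid" and f where G: "group G" and f: "f \<in> iso E G"
    using group_iso_on_infinite_type[OF E finitely_generated_countable[OF fg] assms(6)] .
  define g where "g = inv_into (carrier E) f"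
  have g: "g \<in> iso G E" unfolding g_def by (rule group.iso_set_sym[OF E f])
  have "f \<in> hom E G" "f ` carrier E = carrier G" using f by (simp_all add: iso_def bij_betw_def)
  then have fgG: "finitely_generated G" by (rule finitely_generated_image[OF fg G])
  let ?p = "\<pi> \<circ> g"
  have p: "?p \<in> hom G Q" using hom_compose[of g G E \<pi> Q] g \<pi>(1) by (simp add: iso_def)
  have "?p ` carrier G = \<pi> ` (g ` carrier G)" by (simp add: image_comp)
  then have onto: "?p ` carrier G = carrier Q" using g \<pi>(2) by (simp add: iso_def bij_betw_def)
  have gf: "g (f x) = x" if "x \<in> carrier E" for x
    using f that by (simp add: g_def iso_def bij_betw_def)
  let ?K = "kernel G Q ?p"
  have p_hom: "group_hom G Q ?p" using G Q p by (simp add: group_hom_def group_hom_axioms_def)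
  have K: "group (G\<lparr>carrier := ?K\<rparr>)"
    by (rule group.subgroup_imp_group[OF G group_hom.subgroup_kernel[OF p_hom]])
  have "?K \<subseteq> carrier G" by (auto simp: kernel_def)
  then have "countable (carrier (G\<lparr>carrier := ?K\<rparr>))"
    using countable_subset[OF _ finitely_generated_countable[OF fgG]] by simp
  then obtain N :: "'n monoid" and e where N: "group N" and e: "e \<in> iso (G\<lparr>carrier := ?K\<rparr>) N"
    using group_iso_on_infinite_type[OF K _ assms(5)] by blast
  define i where "i = inv_into ?K e"
  have "inv_into (carrier (G\<lparr>carrier := ?K\<rparr>)) e \<in> iso N (G\<lparr>carrier := ?K\<rparr>)" by (rule group.iso_set_sym[OF K e])
  then have i: "i \<in> iso N (G\<lparr>carrier := ?K\<rparr>)" by (simp add: i_def)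
  then have "i \<in> hom N G" using \<open>?K \<subseteq> carrier G\<close> by (auto simp: iso_def hom_def)
  moreover have "inj_on i (carrier N)" "i ` carrier N = ?K" using i by (simp_all add: iso_def bij_betw_def)
  ultimately have "short_exact N i G ?p Q" using N G Q p onto by (simp add: short_exact_def)
  then show thesis using fgG f gf by (intro that[of N i G ?p f]) simp_all
qed

theorem theorem1p2:
  fixes Q :: "'q monoid"
  assumes "group Q" and "finitely_presented Q"
    and "infinite (UNIV :: 'n set)" and "infinite (UNIV :: 'g set)"
  shows "(\<forall>(N :: 'n monoid) (G :: 'g monoid) \<iota> p.
            short_exact N \<iota> G p Q \<and> finitely_generated G \<longrightarrow>
            fibre_product_inclusion_profinite_iso G p)
     \<longleftrightarrow>
         (\<forall>H. subgroup H Q \<and> finite (rcosets\<^bsub>Q\<^esub> H) \<longrightarrow> H = carrier Q) \<and>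
         trivial_group (group_homology Q 2)"
  (is "?A \<longleftrightarrow> ?B \<and> ?C")
proof (intro iffI conjI)
  have fgQ: "finitely_generated Q" using assms(2) by (rule finitely_presented_imp_finitely_generated)
  interpret Q: group Q by fact
  have fp: "fibre_product_hom G Q p" "p ` carrier G = carrier Q" if "short_exact N \<iota> G p Q"
    for N :: "'n monoid" and G :: "'g monoid" and \<iota> p
    using that by (simp_all add: short_exact_def fibre_product_hom_def group_hom_def group_hom_axioms_def)
  show B: ?B if A: ?A
  proof (intro allI impI, elim conjE)
    fix H assume H: "subgroup H Q" "finite (rcosets\<^bsub>Q\<^esub> H)"
    \<comment> \<open>For (1) it is enough to use (A) for the extension with trivial kernel, where
      \<open>G\<close> is a copy of \<open>Q\<close> and the fibre product is the diagonal.\<close>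
    have id: "(\<lambda>x. x) \<in> hom Q Q" "(\<lambda>x. x) ` carrier Q = carrier Q" by (simp_all add: hom_def)
    obtain N :: "'n monoid" and G :: "'g monoid" and i p f
      where se: "short_exact N i G p Q" and fg: "finitely_generated G"
      by (rule short_exact_on_infinite_types[OF fgQ assms(1) id assms(3,4)])
    interpret fibre_product_hom G Q p using fp(1)[OF se] .
    have "fibre_product_inclusion_profinite_iso G p" using A se fg by blast
    then have dense_image by (simp add: fibre_product_inclusion_profinite_iso_iff)
    then show "H = carrier Q" using H by (rule no_finite_index_if_dense_image[OF fp(2)[OF se]])
  qed
  show ?C if A: ?A
  proof -
    have no_fin: "H = carrier Q" if "subgroup H Q" "finite (rcosets\<^bsub>Q\<^esub> H)" for H
      using B[OF A] that by blast
    interpret E: group_cocycle Q "bar_chains Q 2 Mod Q.bar_boundaries" Q.tautological_cocycle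
      by (rule Q.group_cocycle_tautological)
    interpret EG: group E.extension by (rule E.group_extension)
    \<comment> \<open>The tautological extension need not be finitely generated, so (A) is applied
      to a subgroup that still maps onto \<open>Q\<close> and whose kernel is finitely
      generated.\<close>
    obtain E1 S where E1: "subgroup E1 E.extension" "finitely_generated (E.extension\<lparr>carrier := E1\<rparr>)"
        "snd ` E1 = carrier Q"
      and S: "finite S" "S \<subseteq> E1" "{x \<in> E1. snd x = \<one>\<^bsub>Q\<^esub>} = generate E.extension S"
      by (rule central_extension_finitely_generated_subgroup[OF assms(2) E.group_extension E.hom_snd_extension
            E.snd_extension_surj E.extension_kernel_central])
    let ?E = "E.extension\<lparr>carrier := E1\<rparr>"
    have E1c: "x \<in> carrier E.extension" if "x \<in> E1" for x using E1(1) that by (rule subgroup.mem_carrier)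
    have snd: "snd \<in> hom ?E Q"
      using E1c hom_in_carrier[OF E.hom_snd_extension] hom_mult[OF E.hom_snd_extension] by (intro homI) simp_all
    have "snd ` carrier ?E = carrier Q" using E1(3) by simp
    then obtain N :: "'n monoid" and G :: "'g monoid" and i p f
      where se: "short_exact N i G p Q" and fg: "finitely_generated G"
        and f: "f \<in> iso ?E G" and pf: "\<And>x. x \<in> carrier ?E \<Longrightarrow> p (f x) = snd x"
      by (rule short_exact_on_infinite_types[OF E1(2) assms(1) snd _ assms(3,4)]) blast
    interpret fibre_product_hom G Q p using fp(1)[OF se] .
    have gE: "group ?E" by (rule EG.subgroup_imp_group[OF E1(1)])
    have fh: "f \<in> hom ?E G" and fc: "f ` E1 = carrier G" using f by (simp_all add: iso_def bij_betw_def)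
    have fhom: "group_hom ?E G f" using gE p.G.is_group fh by (simp add: group_hom_def group_hom_axioms_def)
    have "fibre_product_inclusion_profinite_iso G p" using A se fg by blast
    then have full: induced_topology_full by (simp add: fibre_product_inclusion_profinite_iso_iff)
    have central: "x \<otimes>\<^bsub>G\<^esub> y = y \<otimes>\<^bsub>G\<^esub> x"
      if x: "x \<in> carrier G" "p x = \<one>\<^bsub>Q\<^esub>" and y: "y \<in> carrier G" for x y
    proof -
      obtain x' where x': "x = f x'" "x' \<in> E1" using x(1) unfolding fc[symmetric] by (rule imageE)
      obtain y' where y': "y = f y'" "y' \<in> E1" using y unfolding fc[symmetric] by (rule imageE)
      have "snd x' = \<one>\<^bsub>Q\<^esub>" using pf[of x'] x' x(2) by simp
      then have "x' \<otimes>\<^bsub>E.extension\<^esub> y' = y' \<otimes>\<^bsub>E.extension\<^esub> x'"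
        by (rule E.extension_kernel_central[OF E1c[OF x'(2)] _ E1c[OF y'(2)]])
      then show ?thesis using hom_mult[OF fh, of x' y'] hom_mult[OF fh, of y' x'] x' y' by simp
    qed
    have "{x \<in> carrier G. p x = \<one>\<^bsub>Q\<^esub>} = f ` {x \<in> E1. snd x = \<one>\<^bsub>Q\<^esub>}"
      unfolding fc[symmetric] using pf by auto
    also have "\<dots> = f ` generate ?E S" unfolding S(3) using EG.generate_consistent[OF S(2) E1(1)] by simp
    also have "\<dots> = generate G (f ` S)" using group_hom.generate_img[OF fhom, of S] S(2) by simp
    finally have ker: "{x \<in> carrier G. p x = \<one>\<^bsub>Q\<^esub>} = generate G (f ` S)" .
    have fS: "finite (f ` S)" "f ` S \<subseteq> carrier G" using S(1,2) fc by auto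
    obtain \<sigma> where \<sigma>: "\<sigma> \<in> hom Q G" "\<And>q. q \<in> carrier Q \<Longrightarrow> p (\<sigma> q) = q"
      by (rule central_extension_splits[OF fp(2)[OF se] full fgQ no_fin central fS ker]) blast+
    \<comment> \<open>The section found for the copy is carried back along the inverse of
      \<open>f\<close>, since the criterion for vanishing homology concerns the tautological
      extension itself.\<close>
    define g where "g = inv_into E1 f"
    have "inv_into (carrier ?E) f \<in> iso G ?E" by (rule group.iso_set_sym[OF gE f])
    then have g: "g \<in> hom G ?E" by (simp add: g_def iso_def)
    have fg_id: "f (g x) = x" if "x \<in> carrier G" for x unfolding g_def using that fc by (intro f_inv_into_f) simp
    have gs: "g \<circ> \<sigma> \<in> hom Q ?E" using \<sigma>(1) g by (rule hom_compose)
    have "g \<circ> \<sigma> \<in> hom Q E.extension"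
      using hom_in_carrier[OF gs] hom_mult[OF gs] E1c by (intro homI) simp_all
    moreover have "snd ((g \<circ> \<sigma>) q) = q" if q: "q \<in> carrier Q" for q
      using pf[of "g (\<sigma> q)"] hom_in_carrier[OF gs q] fg_id[OF hom_in_carrier[OF \<sigma>(1) q]] \<sigma>(2)[OF q] by simp
    ultimately show ?C by (rule Q.trivial_homology_if_extensions_split)
  qed
  show ?A if BC: "?B \<and> ?C"
  proof (intro allI impI, elim conjE)
    fix N :: "'n monoid" and G :: "'g monoid" and \<iota> p
    assume se: "short_exact N \<iota> G p Q"
    interpret fibre_product_hom G Q p using fp(1)[OF se] .
    have no_fin: "H = carrier Q" if "subgroup H Q" "finite (rcosets\<^bsub>Q\<^esub> H)" for H
      using BC that by blast
    have "finite_quotient_free_superperfect Q"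
      using fgQ no_fin BC assms(1)
      by (simp add: finite_quotient_free_superperfect_def finite_quotient_free_superperfect_axioms_def)
    then show "fibre_product_inclusion_profinite_iso G p"
      using dense_image_if_no_finite_index[OF fp(2)[OF se]] no_fin
        induced_topology_full_if_superperfect[OF fp(2)[OF se]]
      by (simp add: fibre_product_inclusion_profinite_iso_iff)
  qed
qed

end
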